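(* Let $G=(\mathcal A,\Delta)$ be a compact quantum group, let $\mathcal F,\mathcal G:\mathrm{Rep}(G)\to\mathcal H$ be two quasitensor $^*$-functors and let $U:\mathcal F\to\mathcal G$ be a unitary quasitensor natural transformation. Then there exists a unique $^*$-isomorphism $\alpha_U:\mathcal B_{\mathcal F}\to\mathcal B_{\mathcal G}$ intertwining the corresponding $G$-actions $\eta_{\mathcal F}$, $\eta_{\mathcal G}$, such that $$\alpha_U(\overline T\otimes\phi)=\overline{U_uT}\otimes\phi,\qquad T\in\mathcal F(u),\ \phi\in H_u,\ u\in\hat{\mathcal F}.$$
   Context: Compact quantum group (Woronowicz): $G=(\mathcal A,\Delta)$, $\mathcal A$ a unital $C^*$-algebra, $\Delta:\mathcal A\to\mathcal A\otimes\mathcal A$ a coassociative unital $^*$-homomorphism such that $\{(b\otimes I)\Delta(c)\}$ and $\{(I\otimes b)\Delta(c)\}$ each span dense subspaces. A unitary representation $u$ on a finite-dimensional $H_u$ is a linear map $u:H_u\to H_u\otimes\mathcal A$, $u(e_j)=\sum_i e_i\otimes u_{ij}$, with $(u_{ij})$ unitary and $\Delta(u_{ij})=\sum_k u_{ik}\otimes u_{kj}$; arrows $(u,v)$ in $\mathrm{Rep}(G)$ are linear $T:H_u\to H_v$ with $(T\otimes I)u=vT$; $u\otimes v$ acts on $H_u\otimes H_v$ with coefficients $u_{ij}v_{pq}$. $\mathcal H$ is the (strict) tensor $C^*$-category of Hilbert spaces and bounded linear maps. Quasitensor: a $^*$-functor $\mathcal F$ to $\mathcal H$ is quasitensor if $\mathcal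 F(\iota)=\mathbb C$ and there are isometries $S_{\rho,\sigma}=S^{\mathcal F}_{\rho,\sigma}:\mathcal F(\rho)\otimes\mathcal F(\sigma)\to\mathcal F(\rho\otimes\sigma)$ with: $S_{\rho,\iota}=S_{\iota,\rho}=1_{\mathcal F(\rho)}$; $S_{\rho\otimes\sigma,\tau}\circ(S_{\rho,\sigma}\otimes1)=S_{\rho,\sigma\otimes\tau}\circ(1\otimes S_{\sigma,\tau})=:S_{\rho,\sigma,\tau}$; $E_{\rho\otimes\sigma,\tau}\circ E_{\rho,\sigma\otimes\tau}\le E_{\rho,\sigma,\tau}$ for the range projections $E_{\rho,\sigma}$ of $S_{\rho,\sigma}$ and $E_{\rho,\sigma,\tau}$ of $S_{\rho,\sigma,\tau}$; $\mathcal F(S\otimes T)\circ S_{\rho,\sigma}=S_{\rho',\sigma'}\circ(\mathcal F(S)\otimes\mathcal F(T))$ for $S\in(\rho,\rho')$, $T\in(\sigma,\sigma')$. A natural transformation $U:\mathcal F\to\mathcal G$ is quasitensor if $U_\iota=1_{\mathbb C}$ and $U_{\rho\otimes\sigma}S^{\mathcal F}_{\rho,\sigma}=S^{\mathcal G}_{\rho,\sigma}(U_\rho\otimes U_\sigma)$; unitary if every $U_\rho$ is. The system $(\mathcal B_{\mathcal F},\eta_{\mathcal F})$: let $\hat{\mathcal F}$ be a complete set of pairwise inequivalent irreducible unitary representations $u$ with $\mathcal F(u)\neq0$ (the same set is used for $\mathcal G$), and $\mathcal C_{\mathcal F}=\bigoplus_{u\in\hat{\mathcal F}}\overline{\mathcal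 F(u)}\otimes H_u$ (algebraic direct sum), with unit $\overline1\otimes1\in\overline{\mathcal F(\iota)}\otimes H_\iota$ and product $$(\overline T\otimes\phi)(\overline{T'}\otimes\phi')=\sum_r\overline{\mathcal F(s_r)^*S_{u,v}(T\otimes T')}\otimes s_r^*(\phi\otimes\phi')$$ for $T\in\mathcal F(u)$, $\phi\in H_u$, $T'\in\mathcal F(v)$, $\phi'\in H_v$, where $s_r\in(u_r,u\otimes v)$ are isometries, $u_r$ irreducible (from a fixed complete set containing $\hat{\mathcal F}$), $\sum_rs_rs_r^*=1$, terms with $\mathcal F(u_r)=0$ being $0$. Involution: $(\overline T\otimes\phi)^*=\overline{JT}\otimes(j^{-1})^*\phi\in\overline{\mathcal F(\overline u)}\otimes H_{\overline u}$, where $\overline u\in\hat{\mathcal F}$ is the conjugate of $u$; $R\in(\iota,\overline u\otimes u)$, $\overline R\in(\iota,u\otimes\overline u)$ satisfy $(\overline R^*\otimes1_u)(1_u\otimes R)=1_u$, $(R^*\otimes1_{\overline u})(1_{\overline u}\otimes\overline R)=1_{\overline u}$; $j:H_u\to H_{\overline u}$ is the antilinear invertible map with $R=\sum_ije_i\otimes e_i$; $J:\mathcal F(u)\to\mathcal F(\overline u)$ is the antilinear invertible map with $S_{\overline u,u}^*\mathcal F(R)=\sum_iJT_i\otimes T_i$ ($(e_i)$, $(T_i)$ orthonormal bases); the adjoint of an antilinear map is given by $(j\phi,\psi)=(j^*\psi,\phi)$. Action: $\eta_{\mathcal F}(\overline T\otimes\phi)=\overline T\otimes u(\phi)$. $\mathcal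 B_{\mathcal F}$ is the completion of $\mathcal C_{\mathcal F}$ in its maximal $C^*$-seminorm (which is finite and a norm), and $\eta_{\mathcal F}:\mathcal B_{\mathcal F}\to\mathcal B_{\mathcal F}\otimes\mathcal A$ is extended by continuity. *)

theory Defs
  imports "HOL-Analysis.Analysis"
begin

section \<open>Unital C*-algebras\<close>

text \<open>Nonzero unital C*-algebras as a type class. The complex scalar multiplication extends
  the real one of the library classes.\<close>

class cstar_algebra = banach + real_normed_algebra_1 +
  fixes scaleC :: "complex \<Rightarrow> 'a \<Rightarrow> 'a" (infixr "*\<^sub>C" 75)
    and star :: "'a \<Rightarrow> 'a"
  assumes scaleC_add_right: "c *\<^sub>C (x + y) = c *\<^sub>C x + c *\<^sub>C y"
    and scaleC_add_left: "(c + d) *\<^sub>C x = c *\<^sub>C x + d *\<^sub>C x"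
    and scaleC_scaleC: "c *\<^sub>C d *\<^sub>C x = (c * d) *\<^sub>C x"
    and scaleR_scaleC: "r *\<^sub>R x = complex_of_real r *\<^sub>C x"
    and mult_scaleC_left: "(c *\<^sub>C x) * y = c *\<^sub>C (x * y)"
    and mult_scaleC_right: "x * (c *\<^sub>C y) = c *\<^sub>C (x * y)"
    and norm_scaleC: "norm (c *\<^sub>C x) = cmod c * norm x"
    and star_add: "star (x + y) = star x + star y"
    and star_scaleC: "star (c *\<^sub>C x) = cnj c *\<^sub>C star x"
    and star_mult: "star (x * y) = star y * star x"
    and star_star: "star (star x) = x"
    and norm_star_mult: "norm (star x * x) = (norm x)\<^sup>2"

abbreviation cspan :: "'a::cstar_algebra set \<Rightarrow> 'a set" where
  "cspan \<equiv> module.span scaleC"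

definition clin :: "('a::cstar_algebra \<Rightarrow> 'b::cstar_algebra) \<Rightarrow> bool" where
  "clin h \<longleftrightarrow> (\<forall>x y. h (x + y) = h x + h y) \<and> (\<forall>c x. h (c *\<^sub>C x) = c *\<^sub>C h x)"

definition star_hom :: "('a::cstar_algebra \<Rightarrow> 'b::cstar_algebra) \<Rightarrow> bool" where
  "star_hom h \<longleftrightarrow> clin h \<and> (\<forall>x y. h (x * y) = h x * h y) \<and> (\<forall>x. h (star x) = star (h x)) \<and> h 1 = 1"

definition star_iso :: "('a::cstar_algebra \<Rightarrow> 'b::cstar_algebra) \<Rightarrow> bool" where
  "star_iso h \<longleftrightarrow> star_hom h \<and> bij h"


section \<open>C*-seminorms on *-algebras, and completions\<close>

record 'x star_alg =
  carr :: "'x set"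
  add :: "'x \<Rightarrow> 'x \<Rightarrow> 'x"
  scl :: "complex \<Rightarrow> 'x \<Rightarrow> 'x"
  mul :: "'x \<Rightarrow> 'x \<Rightarrow> 'x"
  str :: "'x \<Rightarrow> 'x"
  unt :: 'x

definition cstar_seminorm :: "'x star_alg \<Rightarrow> ('x \<Rightarrow> real) \<Rightarrow> bool" where
  "cstar_seminorm X p \<longleftrightarrow>
     (\<forall>x\<in>carr X. 0 \<le> p x) \<and>
     (\<forall>x\<in>carr X. \<forall>y\<in>carr X. p (add X x y) \<le> p x + p y) \<and>
     (\<forall>c. \<forall>x\<in>carr X. p (scl X c x) = cmod c * p x) \<and>
     (\<forall>x\<in>carr X. \<forall>y\<in>carr X. p (mul X x y) \<le> p x * p y) \<and>
     (\<forall>x\<in>carr X. p (mul X (str X x) x) = (p x)\<^sup>2)"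

definition maximal_cstar_seminorm :: "'x star_alg \<Rightarrow> ('x \<Rightarrow> real) \<Rightarrow> bool" where
  "maximal_cstar_seminorm X q \<longleftrightarrow>
     cstar_seminorm X q \<and> (\<forall>p. cstar_seminorm X p \<longrightarrow> (\<forall>x\<in>carr X. p x \<le> q x))"

definition star_alg_hom :: "'x star_alg \<Rightarrow> ('x \<Rightarrow> 'b::cstar_algebra) \<Rightarrow> bool" where
  "star_alg_hom X \<iota> \<longleftrightarrow>
     (\<forall>x\<in>carr X. \<forall>y\<in>carr X. \<iota> (add X x y) = \<iota> x + \<iota> y) \<and>
     (\<forall>c. \<forall>x\<in>carr X. \<iota> (scl X c x) = c *\<^sub>C \<iota> x) \<and>
     (\<forall>x\<in>carr X. \<forall>y\<in>carr X. \<iota> (mul X x y) = \<iota> x * \<iota> y) \<and>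
     (\<forall>x\<in>carr X. \<iota> (str X x) = star (\<iota> x)) \<and>
     \<iota> (unt X) = 1"

text \<open>The type \<open>'b\<close>, together with the canonical map \<open>\<iota>\<close>, is the completion of \<open>X\<close> in its
  maximal C*-seminorm.\<close>

definition maximal_completion :: "'x star_alg \<Rightarrow> ('x \<Rightarrow> 'b::cstar_algebra) \<Rightarrow> bool" where
  "maximal_completion X \<iota> \<longleftrightarrow>
     star_alg_hom X \<iota> \<and> maximal_cstar_seminorm X (\<lambda>x. norm (\<iota> x)) \<and> closure (\<iota> ` carr X) = UNIV"


section \<open>The (minimal) tensor product of C*-algebras\<close>

definition alg_tensor :: "('a::cstar_algebra \<Rightarrow> 'b::cstar_algebra \<Rightarrow> 'c::cstar_algebra) \<Rightarrow> 'c star_alg" where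
  "alg_tensor t = \<lparr>carr = cspan {t a b | a b. True}, add = (+), scl = scaleC, mul = (*), str = star, unt = 1\<rparr>"

text \<open>\<open>t a b\<close> is the elementary tensor of \<open>a\<close> and \<open>b\<close>. By the condition on independent sets, the
  span of the elementary tensors is the algebraic tensor product; the type \<open>'c\<close> is its
  completion in the least C*-norm, i.e. the spatial one (Takesaki).\<close>

definition cstar_tensor :: "('a::cstar_algebra \<Rightarrow> 'b::cstar_algebra \<Rightarrow> 'c::cstar_algebra) \<Rightarrow> bool" where
  "cstar_tensor t \<longleftrightarrow>
     (\<forall>b. clin (\<lambda>a. t a b)) \<and> (\<forall>a. clin (t a)) \<and>
     (\<forall>a b a' b'. t a b * t a' b' = t (a * a') (b * b')) \<and>
     (\<forall>a b. star (t a b) = t (star a) (star b)) \<and> t 1 1 = 1 \<and>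
     (\<forall>I f. finite I \<and> \<not> module.dependent scaleC I \<and> (\<Sum>a\<in>I. t a (f a)) = 0 \<longrightarrow> (\<forall>a\<in>I. f a = 0)) \<and>
     closure (carr (alg_tensor t)) = UNIV \<and>
     (\<forall>p. cstar_seminorm (alg_tensor t) p \<and> (\<forall>x\<in>carr (alg_tensor t). p x = 0 \<longrightarrow> x = 0)
        \<longrightarrow> (\<forall>x\<in>carr (alg_tensor t). norm x \<le> p x))"

text \<open>\<open>f \<otimes> g\<close>, between the tensor products given by \<open>t\<close> and \<open>t'\<close>\<close>

definition tensor_map ::
  "('a::cstar_algebra \<Rightarrow> 'b::cstar_algebra \<Rightarrow> 'c::cstar_algebra) \<Rightarrow>
   ('a'::cstar_algebra \<Rightarrow> 'b'::cstar_algebra \<Rightarrow> 'c'::cstar_algebra) \<Rightarrow>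
   ('a \<Rightarrow> 'a') \<Rightarrow> ('b \<Rightarrow> 'b') \<Rightarrow> 'c \<Rightarrow> 'c'" where
  "tensor_map t t' f g =
     (THE h. clin h \<and> continuous_on UNIV h \<and> (\<forall>a b. h (t a b) = t' (f a) (g b)))"


section \<open>Compact quantum groups\<close>

text \<open>\<open>t\<close> provides \<open>A \<otimes> A\<close>, while \<open>tL\<close> and \<open>tR\<close> provide \<open>A \<otimes> A \<otimes> A\<close>, as \<open>(A \<otimes> A) \<otimes> A\<close> and
  \<open>A \<otimes> (A \<otimes> A)\<close> respectively.\<close>

definition compact_quantum_group ::
  "('a::cstar_algebra \<Rightarrow> 'a \<Rightarrow> 'aa::cstar_algebra) \<Rightarrow> ('aa \<Rightarrow> 'a \<Rightarrow> 'aaa::cstar_algebra) \<Rightarrow>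
   ('a \<Rightarrow> 'aa \<Rightarrow> 'aaa) \<Rightarrow> ('a \<Rightarrow> 'aa) \<Rightarrow> bool" where
  "compact_quantum_group t tL tR \<Delta> \<longleftrightarrow>
     cstar_tensor t \<and> cstar_tensor tL \<and> cstar_tensor tR \<and>
     (\<forall>a b c. tL (t a b) c = tR a (t b c)) \<and>
     star_hom \<Delta> \<and>
     (\<forall>a. tensor_map t tL \<Delta> id (\<Delta> a) = tensor_map t tR id \<Delta> (\<Delta> a)) \<and>
     closure (cspan {t b 1 * \<Delta> c | b c. True}) = UNIV \<and>
     closure (cspan {t 1 b * \<Delta> c | b c. True}) = UNIV"


section \<open>A strict tensor category of Hilbert spaces\<close>

text \<open>A Hilbert space is given in coordinates, as \<open>\<ell>\<^sup>2(ix H)\<close> where the index set \<open>ix H\<close> is an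
  arbitrary set of lists of a fixed length \<open>ar H\<close>; the index type is arbitrary, so every
  Hilbert space is of this form up to a unitary. The tensor product concatenates indices, which
  makes it strictly associative, with strict unit \<open>\<complex> = \<ell>\<^sup>2({[]})\<close>.

  Operators are functions that are extended by zero outside their domain, so that equality
  of operators is equality of functions.\<close>

datatype 'i hilb = Hilb (ar: nat) (ix: "'i list set")

definition wf_hilb :: "'i hilb \<Rightarrow> bool" where
  "wf_hilb H \<longleftrightarrow> (\<forall>w\<in>ix H. length w = ar H)"

type_synonym 'i vct = "'i list \<Rightarrow> complex"

definition ell2 :: "'i hilb \<Rightarrow> 'i vct set" where
  "ell2 H = {f. (\<forall>w. w \<notin> ix H \<longrightarrow> f w = 0) \<and> (\<lambda>w. (cmod (f w))\<^sup>2) summable_on UNIV}"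

definition ip :: "'i vct \<Rightarrow> 'i vct \<Rightarrow> complex" where
  "ip f g = (\<Sum>\<^sub>\<infinity>w. cnj (f w) * g w)"

definition nrm :: "'i vct \<Rightarrow> real" where
  "nrm f = sqrt (\<Sum>\<^sub>\<infinity>w. (cmod (f w))\<^sup>2)"

definition ket :: "'i list \<Rightarrow> 'i vct" where
  "ket w = (\<lambda>v. if v = w then 1 else 0)"

type_synonym ('i, 'j) opr = "'i vct \<Rightarrow> 'j vct"

definition bop :: "'i hilb \<Rightarrow> 'j hilb \<Rightarrow> ('i, 'j) opr set" where
  "bop H K = {T.
     (\<forall>f\<in>ell2 H. \<forall>g\<in>ell2 H. T (\<lambda>w. f w + g w) = (\<lambda>w. T f w + T g w)) \<and>
     (\<forall>c. \<forall>f\<in>ell2 H. T (\<lambda>w. c * f w) = (\<lambda>w. c * T f w)) \<and>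
     (\<exists>C. \<forall>f\<in>ell2 H. T f \<in> ell2 K \<and> nrm (T f) \<le> C * nrm f) \<and>
     (\<forall>f. f \<notin> ell2 H \<longrightarrow> T f = (\<lambda>_. 0))}"

text \<open>Bounded antilinear operators.\<close>

definition abop :: "'i hilb \<Rightarrow> 'j hilb \<Rightarrow> ('i, 'j) opr set" where
  "abop H K = {T.
     (\<forall>f\<in>ell2 H. \<forall>g\<in>ell2 H. T (\<lambda>w. f w + g w) = (\<lambda>w. T f w + T g w)) \<and>
     (\<forall>c. \<forall>f\<in>ell2 H. T (\<lambda>w. c * f w) = (\<lambda>w. cnj c * T f w)) \<and>
     (\<exists>C. \<forall>f\<in>ell2 H. T f \<in> ell2 K \<and> nrm (T f) \<le> C * nrm f) \<and>
     (\<forall>f. f \<notin> ell2 H \<longrightarrow> T f = (\<lambda>_. 0))}"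

definition idop :: "'i hilb \<Rightarrow> ('i, 'i) opr" where
  "idop H = (\<lambda>f. if f \<in> ell2 H then f else (\<lambda>_. 0))"

definition adj :: "'i hilb \<Rightarrow> 'j hilb \<Rightarrow> ('i, 'j) opr \<Rightarrow> ('j, 'i) opr" where
  "adj H K T = (THE T'. T' \<in> bop K H \<and> (\<forall>f\<in>ell2 H. \<forall>g\<in>ell2 K. ip (T f) g = ip f (T' g)))"

definition aadj :: "'i hilb \<Rightarrow> 'j hilb \<Rightarrow> ('i, 'j) opr \<Rightarrow> ('j, 'i) opr" where
  "aadj H K T = (THE T'. T' \<in> abop K H \<and> (\<forall>f\<in>ell2 H. \<forall>g\<in>ell2 K. ip (T f) g = ip (T' g) f))"

definition isometric :: "'i hilb \<Rightarrow> 'j hilb \<Rightarrow> ('i, 'j) opr \<Rightarrow> bool" where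
  "isometric H K V \<longleftrightarrow> V \<in> bop H K \<and> adj H K V \<circ> V = idop H"

definition unitary_op :: "'i hilb \<Rightarrow> 'j hilb \<Rightarrow> ('i, 'j) opr \<Rightarrow> bool" where
  "unitary_op H K V \<longleftrightarrow> V \<in> bop H K \<and> adj H K V \<circ> V = idop H \<and> V \<circ> adj H K V = idop K"

definition op_le :: "'i hilb \<Rightarrow> ('i, 'i) opr \<Rightarrow> ('i, 'i) opr \<Rightarrow> bool" where
  "op_le H A B \<longleftrightarrow> (\<forall>f\<in>ell2 H. ip f (B f) - ip f (A f) \<in> \<real>\<^sub>\<ge>\<^sub>0)"

definition hunit :: "'i hilb" where
  "hunit = Hilb 0 {[]}"

definition htens :: "'i hilb \<Rightarrow> 'i hilb \<Rightarrow> 'i hilb" (infixr "\<otimes>\<^sub>h" 70) where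
  "H \<otimes>\<^sub>h K = Hilb (ar H + ar K) {x @ y | x y. x \<in> ix H \<and> y \<in> ix K}"

text \<open>The elementary tensor \<open>f \<otimes> g\<close>, where \<open>f\<close> lies in \<open>H\<close>.\<close>

definition vtens :: "'i hilb \<Rightarrow> 'i vct \<Rightarrow> 'i vct \<Rightarrow> 'i vct" where
  "vtens H f g = (\<lambda>w. f (take (ar H) w) * g (drop (ar H) w))"

text \<open>\<open>S \<otimes> T = (S \<otimes> 1)(1 \<otimes> T)\<close> for \<open>S\<close> from \<open>H\<close> to \<open>K\<close> and \<open>T\<close> from \<open>H'\<close> to \<open>K'\<close>: the operator \<open>T\<close>
  acts on each \<open>f (x @ _)\<close>, and then \<open>S\<close> acts on the first variable.\<close>

definition otens :: "'i hilb \<Rightarrow> 'j hilb \<Rightarrow> 'i hilb \<Rightarrow> 'j hilb \<Rightarrow> ('i, 'j) opr \<Rightarrow> ('i, 'j) opr \<Rightarrow> ('i, 'j) opr" where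
  "otens H K H' K' S T =
     (\<lambda>f w. if f \<in> ell2 (H \<otimes>\<^sub>h H') \<and> w \<in> ix (K \<otimes>\<^sub>h K')
            then S (\<lambda>x. if x \<in> ix H then T (\<lambda>y. f (x @ y)) (drop (ar K) w) else 0) (take (ar K) w)
            else 0)"


section \<open>The category of finite-dimensional unitary representations\<close>

text \<open>\<open>cf u i j\<close> is the coefficient \<open>u\<^sub>i\<^sub>j\<close> with respect to the canonical basis of \<open>sp u\<close>.\<close>

datatype 'a rep = Rep (sp: "nat hilb") (cf: "nat list \<Rightarrow> nat list \<Rightarrow> 'a")

definition unitary_rep ::
  "('a::cstar_algebra \<Rightarrow> 'a \<Rightarrow> 'aa::cstar_algebra) \<Rightarrow> ('a \<Rightarrow> 'aa) \<Rightarrow> 'a rep \<Rightarrow> bool" where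
  "unitary_rep t \<Delta> u \<longleftrightarrow>
     wf_hilb (sp u) \<and> finite (ix (sp u)) \<and>
     (\<forall>i j. i \<notin> ix (sp u) \<or> j \<notin> ix (sp u) \<longrightarrow> cf u i j = 0) \<and>
     (\<forall>i\<in>ix (sp u). \<forall>j\<in>ix (sp u).
        (\<Sum>k\<in>ix (sp u). star (cf u k i) * cf u k j) = (if i = j then 1 else 0) \<and>
        (\<Sum>k\<in>ix (sp u). cf u i k * star (cf u j k)) = (if i = j then 1 else 0) \<and>
        \<Delta> (cf u i j) = (\<Sum>k\<in>ix (sp u). t (cf u i k) (cf u k j)))"

text \<open>With \<open>T\<^sub>i\<^sub>j = T (ket j) i\<close>, the equation is \<open>(T \<otimes> I)u = vT\<close>.\<close>

definition arrows :: "'a::cstar_algebra rep \<Rightarrow> 'a rep \<Rightarrow> (nat, nat) opr set" where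
  "arrows u v = {T \<in> bop (sp u) (sp v). \<forall>i\<in>ix (sp v). \<forall>j\<in>ix (sp u).
     (\<Sum>k\<in>ix (sp u). T (ket k) i *\<^sub>C cf u k j) = (\<Sum>k\<in>ix (sp v). T (ket j) k *\<^sub>C cf v i k)}"

definition runit :: "'a::cstar_algebra rep" where
  "runit = Rep hunit (\<lambda>i j. if i = [] \<and> j = [] then 1 else 0)"

definition rtens :: "'a::cstar_algebra rep \<Rightarrow> 'a rep \<Rightarrow> 'a rep" (infixr "\<otimes>\<^sub>r" 70) where
  "u \<otimes>\<^sub>r v = Rep (sp u \<otimes>\<^sub>h sp v)
     (\<lambda>i j. if i \<in> ix (sp u \<otimes>\<^sub>h sp v) \<and> j \<in> ix (sp u \<otimes>\<^sub>h sp v)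
            then cf u (take (ar (sp u)) i) (take (ar (sp u)) j) * cf v (drop (ar (sp u)) i) (drop (ar (sp u)) j)
            else 0)"

definition irreducible_rep ::
  "('a::cstar_algebra \<Rightarrow> 'a \<Rightarrow> 'aa::cstar_algebra) \<Rightarrow> ('a \<Rightarrow> 'aa) \<Rightarrow> 'a rep \<Rightarrow> bool" where
  "irreducible_rep t \<Delta> u \<longleftrightarrow> unitary_rep t \<Delta> u \<and> ix (sp u) \<noteq> {} \<and>
     (\<forall>T\<in>arrows u u. \<exists>c. \<forall>f\<in>ell2 (sp u). T f = (\<lambda>w. c * f w))"

definition equivalent_rep :: "'a::cstar_algebra rep \<Rightarrow> 'a rep \<Rightarrow> bool" where
  "equivalent_rep u v \<longleftrightarrow> (\<exists>T\<in>arrows u v. unitary_op (sp u) (sp v) T)"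


section \<open>Quasitensor functors and transformations\<close>

record ('a, 'i) qfunctor =
  Fob :: "'a rep \<Rightarrow> 'i hilb"
  Fmor :: "'a rep \<Rightarrow> 'a rep \<Rightarrow> (nat, nat) opr \<Rightarrow> ('i, 'i) opr"
  Fs :: "'a rep \<Rightarrow> 'a rep \<Rightarrow> ('i, 'i) opr"

definition star_functor ::
  "('a::cstar_algebra \<Rightarrow> 'a \<Rightarrow> 'aa::cstar_algebra) \<Rightarrow> ('a \<Rightarrow> 'aa) \<Rightarrow> ('a, 'i) qfunctor \<Rightarrow> bool" where
  "star_functor t \<Delta> F \<longleftrightarrow>
     (\<forall>u. unitary_rep t \<Delta> u \<longrightarrow>
        wf_hilb (Fob F u) \<and> Fmor F u u (idop (sp u)) = idop (Fob F u)) \<and>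
     (\<forall>u v. unitary_rep t \<Delta> u \<and> unitary_rep t \<Delta> v \<longrightarrow>
        (\<forall>T\<in>arrows u v.
           Fmor F u v T \<in> bop (Fob F u) (Fob F v) \<and>
           Fmor F v u (adj (sp u) (sp v) T) = adj (Fob F u) (Fob F v) (Fmor F u v T) \<and>
           (\<forall>c. Fmor F u v (\<lambda>f w. c * T f w) = (\<lambda>f w. c * Fmor F u v T f w)) \<and>
           (\<forall>T'\<in>arrows u v. Fmor F u v (\<lambda>f w. T f w + T' f w) =
              (\<lambda>f w. Fmor F u v T f w + Fmor F u v T' f w)))) \<and>
     (\<forall>u v z. unitary_rep t \<Delta> u \<and> unitary_rep t \<Delta> v \<and> unitary_rep t \<Delta> z \<longrightarrow>
        (\<forall>T\<in>arrows u v. \<forall>T'\<in>arrows v z. Fmor F u z (T' \<circ> T) = Fmor F v z T' \<circ> Fmor F u v T))"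

definition Fs3 :: "('a::cstar_algebra, 'i) qfunctor \<Rightarrow> 'a rep \<Rightarrow> 'a rep \<Rightarrow> 'a rep \<Rightarrow> ('i, 'i) opr" where
  "Fs3 F u v z = Fs F (u \<otimes>\<^sub>r v) z \<circ>
     otens (Fob F u \<otimes>\<^sub>h Fob F v) (Fob F (u \<otimes>\<^sub>r v)) (Fob F z) (Fob F z) (Fs F u v) (idop (Fob F z))"

text \<open>The range projection of an isometry \<open>S\<close> is \<open>S S\<^sup>*\<close>.\<close>

definition Fe :: "('a::cstar_algebra, 'i) qfunctor \<Rightarrow> 'a rep \<Rightarrow> 'a rep \<Rightarrow> ('i, 'i) opr" where
  "Fe F u v = Fs F u v \<circ> adj (Fob F u \<otimes>\<^sub>h Fob F v) (Fob F (u \<otimes>\<^sub>r v)) (Fs F u v)"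

definition Fe3 :: "('a::cstar_algebra, 'i) qfunctor \<Rightarrow> 'a rep \<Rightarrow> 'a rep \<Rightarrow> 'a rep \<Rightarrow> ('i, 'i) opr" where
  "Fe3 F u v z = Fs3 F u v z \<circ>
     adj (Fob F u \<otimes>\<^sub>h Fob F v \<otimes>\<^sub>h Fob F z) (Fob F (u \<otimes>\<^sub>r v \<otimes>\<^sub>r z)) (Fs3 F u v z)"

definition quasitensor_functor ::
  "('a::cstar_algebra \<Rightarrow> 'a \<Rightarrow> 'aa::cstar_algebra) \<Rightarrow> ('a \<Rightarrow> 'aa) \<Rightarrow> ('a, 'i) qfunctor \<Rightarrow> bool" where
  "quasitensor_functor t \<Delta> F \<longleftrightarrow>
     star_functor t \<Delta> F \<and> Fob F runit = hunit \<and>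
     (\<forall>u. unitary_rep t \<Delta> u \<longrightarrow>
        Fs F u runit = idop (Fob F u) \<and> Fs F runit u = idop (Fob F u)) \<and>
     (\<forall>u v. unitary_rep t \<Delta> u \<and> unitary_rep t \<Delta> v \<longrightarrow>
        isometric (Fob F u \<otimes>\<^sub>h Fob F v) (Fob F (u \<otimes>\<^sub>r v)) (Fs F u v)) \<and>
     (\<forall>u v z. unitary_rep t \<Delta> u \<and> unitary_rep t \<Delta> v \<and> unitary_rep t \<Delta> z \<longrightarrow>
        Fs3 F u v z = Fs F u (v \<otimes>\<^sub>r z) \<circ>
          otens (Fob F u) (Fob F u) (Fob F v \<otimes>\<^sub>h Fob F z) (Fob F (v \<otimes>\<^sub>r z)) (idop (Fob F u)) (Fs F v z) \<and>
        op_le (Fob F (u \<otimes>\<^sub>r v \<otimes>\<^sub>r z)) (Fe F (u \<otimes>\<^sub>r v) z \<circ> Fe F u (v \<otimes>\<^sub>r z)) (Fe3 F u v z)) \<and>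
     (\<forall>u u' v v'. unitary_rep t \<Delta> u \<and> unitary_rep t \<Delta> u' \<and> unitary_rep t \<Delta> v \<and> unitary_rep t \<Delta> v' \<longrightarrow>
        (\<forall>S\<in>arrows u u'. \<forall>T\<in>arrows v v'.
           Fmor F (u \<otimes>\<^sub>r v) (u' \<otimes>\<^sub>r v') (otens (sp u) (sp u') (sp v) (sp v') S T) \<circ> Fs F u v =
           Fs F u' v' \<circ>
             otens (Fob F u) (Fob F u') (Fob F v) (Fob F v') (Fmor F u u' S) (Fmor F v v' T)))"

definition unitary_quasitensor_transformation ::
  "('a::cstar_algebra \<Rightarrow> 'a \<Rightarrow> 'aa::cstar_algebra) \<Rightarrow> ('a \<Rightarrow> 'aa) \<Rightarrow>
   ('a, 'i) qfunctor \<Rightarrow> ('a, 'j) qfunctor \<Rightarrow> ('a rep \<Rightarrow> ('i, 'j) opr) \<Rightarrow> bool" where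
  "unitary_quasitensor_transformation t \<Delta> F G U \<longleftrightarrow>
     (\<forall>u. unitary_rep t \<Delta> u \<longrightarrow> unitary_op (Fob F u) (Fob G u) (U u)) \<and>
     (\<forall>u v. unitary_rep t \<Delta> u \<and> unitary_rep t \<Delta> v \<longrightarrow>
        (\<forall>T\<in>arrows u v. Fmor G u v T \<circ> U u = U v \<circ> Fmor F u v T)) \<and>
     U runit (ket []) = ket [] \<and>
     (\<forall>u v. unitary_rep t \<Delta> u \<and> unitary_rep t \<Delta> v \<longrightarrow>
        U (u \<otimes>\<^sub>r v) \<circ> Fs F u v =
        Fs G u v \<circ> otens (Fob F u) (Fob G u) (Fob F v) (Fob G v) (U u) (U v))"


section \<open>The *-algebra of a quasitensor functor\<close>

text \<open>The auxiliary choices, none of which involves a functor: a complete set \<open>Irr\<close> of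
  irreducible representations, for each \<open>u\<close> in it a conjugate \<open>cj u\<close>, the arrows \<open>R\<close> and \<open>R\<close>-bar
  (\<open>cR u\<close>, \<open>cRb u\<close>) and the antilinear map \<open>j\<close> (\<open>cjm u\<close>), and for \<open>u\<close>, \<open>v\<close> in it the
  pairs \<open>(u\<^sub>r, s\<^sub>r)\<close> that decompose \<open>u \<otimes> v\<close>.\<close>

record 'a choices =
  Irr :: "'a rep set"
  cj :: "'a rep \<Rightarrow> 'a rep"
  cR :: "'a rep \<Rightarrow> (nat, nat) opr"
  cRb :: "'a rep \<Rightarrow> (nat, nat) opr"
  cjm :: "'a rep \<Rightarrow> (nat, nat) opr"
  dec :: "'a rep \<Rightarrow> 'a rep \<Rightarrow> ('a rep \<times> (nat, nat) opr) list"

definition complete_irreducibles ::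
  "('a::cstar_algebra \<Rightarrow> 'a \<Rightarrow> 'aa::cstar_algebra) \<Rightarrow> ('a \<Rightarrow> 'aa) \<Rightarrow> 'a rep set \<Rightarrow> bool" where
  "complete_irreducibles t \<Delta> I \<longleftrightarrow>
     runit \<in> I \<and> (\<forall>u\<in>I. irreducible_rep t \<Delta> u) \<and>
     (\<forall>u\<in>I. \<forall>v\<in>I. equivalent_rep u v \<longrightarrow> u = v) \<and>
     (\<forall>u. irreducible_rep t \<Delta> u \<longrightarrow> (\<exists>v\<in>I. equivalent_rep u v))"

definition conjugate_solution :: "'a::cstar_algebra rep \<Rightarrow> 'a rep \<Rightarrow> (nat, nat) opr \<Rightarrow> (nat, nat) opr \<Rightarrow> bool" where
  "conjugate_solution u ub R Rb \<longleftrightarrow>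
     R \<in> arrows runit (ub \<otimes>\<^sub>r u) \<and> Rb \<in> arrows runit (u \<otimes>\<^sub>r ub) \<and>
     otens (sp (u \<otimes>\<^sub>r ub)) hunit (sp u) (sp u) (adj hunit (sp (u \<otimes>\<^sub>r ub)) Rb) (idop (sp u)) \<circ>
       otens (sp u) (sp u) hunit (sp (ub \<otimes>\<^sub>r u)) (idop (sp u)) R = idop (sp u) \<and>
     otens (sp (ub \<otimes>\<^sub>r u)) hunit (sp ub) (sp ub) (adj hunit (sp (ub \<otimes>\<^sub>r u)) R) (idop (sp ub)) \<circ>
       otens (sp ub) (sp ub) hunit (sp (u \<otimes>\<^sub>r ub)) (idop (sp ub)) Rb = idop (sp ub)"

text \<open>\<open>J\<close> is an invertible antilinear map from \<open>H\<close> to \<open>K\<close> with \<open>\<zeta> = \<Sum>\<^sub>i J e\<^sub>i \<otimes> e\<^sub>i\<close>, where \<open>\<zeta>\<close> is in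
  \<open>K \<otimes> H\<close>. (At each \<open>w\<close> at most one term of the sum is nonzero.)\<close>

definition represents_vector :: "'i hilb \<Rightarrow> 'i hilb \<Rightarrow> ('i, 'i) opr \<Rightarrow> 'i vct \<Rightarrow> bool" where
  "represents_vector H K J \<zeta> \<longleftrightarrow>
     J \<in> abop H K \<and> bij_betw J (ell2 H) (ell2 K) \<and>
     \<zeta> = (\<lambda>w. \<Sum>\<^sub>\<infinity>i\<in>ix H. vtens K (J (ket i)) (ket i) w)"

definition valid_choices ::
  "('a::cstar_algebra \<Rightarrow> 'a \<Rightarrow> 'aa::cstar_algebra) \<Rightarrow> ('a \<Rightarrow> 'aa) \<Rightarrow> 'a choices \<Rightarrow> bool" where
  "valid_choices t \<Delta> ch \<longleftrightarrow>
     complete_irreducibles t \<Delta> (Irr ch) \<and>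
     (\<forall>u\<in>Irr ch. cj ch u \<in> Irr ch \<and>
        conjugate_solution u (cj ch u) (cR ch u) (cRb ch u) \<and>
        represents_vector (sp u) (sp (cj ch u)) (cjm ch u) (cR ch u (ket []))) \<and>
     (\<forall>u\<in>Irr ch. \<forall>v\<in>Irr ch.
        (\<forall>(z, s)\<in>set (dec ch u v). z \<in> Irr ch \<and> s \<in> arrows z (u \<otimes>\<^sub>r v) \<and>
           isometric (sp z) (sp (u \<otimes>\<^sub>r v)) s) \<and>
        (\<forall>f\<in>ell2 (sp (u \<otimes>\<^sub>r v)). \<forall>w.
           (\<Sum>(z, s)\<leftarrow>dec ch u v. s (adj (sp z) (sp (u \<otimes>\<^sub>r v)) s f) w) = f w))"

definition hat :: "'a choices \<Rightarrow> ('a, 'i) qfunctor \<Rightarrow> 'a rep set" where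
  "hat ch F = {u \<in> Irr ch. ix (Fob F u) \<noteq> {}}"

text \<open>The antilinear maps \<open>J\<close> from \<open>F(u)\<close> to \<open>F(cj u)\<close>.\<close>

definition functor_conjugation ::
  "'a::cstar_algebra choices \<Rightarrow> ('a, 'i) qfunctor \<Rightarrow> ('a rep \<Rightarrow> ('i, 'i) opr) \<Rightarrow> bool" where
  "functor_conjugation ch F J \<longleftrightarrow>
     (\<forall>u\<in>hat ch F. represents_vector (Fob F u) (Fob F (cj ch u)) (J u)
        (adj (Fob F (cj ch u) \<otimes>\<^sub>h Fob F u) (Fob F (cj ch u \<otimes>\<^sub>r u)) (Fs F (cj ch u) u)
          (Fmor F runit (cj ch u \<otimes>\<^sub>r u) (cR ch u) (ket []))))"

text \<open>The component of an element in \<open>F(u)\<close>-bar \<open>\<otimes> H\<^sub>u\<close> is represented by its matrix of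
  coordinates; the first factor being the conjugate space, the tensor of \<open>T\<close>-bar and \<open>\<phi>\<close>
  is \<open>kern T \<phi>\<close>.\<close>

type_synonym 'i kernel = "'i list \<Rightarrow> nat list \<Rightarrow> complex"

definition kern :: "'i vct \<Rightarrow> nat vct \<Rightarrow> 'i kernel" where
  "kern T \<phi> = (\<lambda>x y. cnj (T x) * \<phi> y)"

definition elt :: "'a rep \<Rightarrow> 'i vct \<Rightarrow> nat vct \<Rightarrow> 'a rep \<Rightarrow> 'i kernel" where
  "elt u T \<phi> = (\<lambda>z. if z = u then kern T \<phi> else (\<lambda>_ _. 0))"

text \<open>\<open>kern_map A B\<close> sends the tensor of \<open>T\<close>-bar and \<open>\<phi>\<close> to that of \<open>(A T)\<close>-bar and \<open>B \<phi>\<close>, and is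
  linear if \<open>A\<close> and \<open>B\<close> are, while \<open>kern_amap A B\<close> is its antilinear counterpart for
  antilinear \<open>A\<close> and \<open>B\<close>.\<close>

definition kern_map :: "('i, 'j) opr \<Rightarrow> (nat, nat) opr \<Rightarrow> 'i kernel \<Rightarrow> 'j kernel" where
  "kern_map A B k = (\<lambda>x. B (\<lambda>y. cnj (A (\<lambda>x'. cnj (k x' y)) x)))"

definition kern_amap :: "('i, 'j) opr \<Rightarrow> (nat, nat) opr \<Rightarrow> 'i kernel \<Rightarrow> 'j kernel" where
  "kern_amap A B k = (\<lambda>x. B (\<lambda>y. A (\<lambda>x'. cnj (k x' y)) x))"

definition kern_tens :: "nat \<Rightarrow> nat \<Rightarrow> 'i kernel \<Rightarrow> 'i kernel \<Rightarrow> 'i kernel" where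
  "kern_tens n m k k' = (\<lambda>x y. k (take n x) (take m y) * k' (drop n x) (drop m y))"

lemma kern_map_kern:
  assumes "\<And>c. A (\<lambda>x. c * T x) = (\<lambda>x. c * A T x)" "\<And>c. B (\<lambda>y. c * \<phi> y) = (\<lambda>y. c * B \<phi> y)"
  shows "kern_map A B (kern T \<phi>) = kern (A T) (B \<phi>)"
proof (intro ext)
  fix x z
  have "(\<lambda>y. cnj (A (\<lambda>x'. cnj (kern T \<phi> x' y)) x)) = (\<lambda>y. cnj (A T x) * \<phi> y)"
    using assms(1) by (simp add: kern_def mult.commute[of _ "cnj _"])
  then show "kern_map A B (kern T \<phi>) x z = kern (A T) (B \<phi>) x z"
    using assms(2) by (simp add: kern_map_def) (simp add: kern_def)
qed

lemma kern_amap_kern: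
  assumes "\<And>c. A (\<lambda>x. c * T x) = (\<lambda>x. cnj c * A T x)" "\<And>c. B (\<lambda>y. c * \<phi> y) = (\<lambda>y. cnj c * B \<phi> y)"
  shows "kern_amap A B (kern T \<phi>) = kern (A T) (B \<phi>)"
proof (intro ext)
  fix x z
  have "(\<lambda>y. A (\<lambda>x'. cnj (kern T \<phi> x' y)) x) = (\<lambda>y. A T x * \<phi> y)"
    using assms(1) by (simp add: kern_def mult.commute[of _ "cnj _"]) (simp add: mult.commute)
  then show "kern_amap A B (kern T \<phi>) x z = kern (A T) (B \<phi>) x z"
    using assms(2) by (simp add: kern_amap_def) (simp add: kern_def)
qed

lemma kern_tens_kern:
  "kern_tens (ar H) (ar K) (kern T \<phi>) (kern T' \<phi>') = kern (vtens H T T') (vtens K \<phi> \<phi>')"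
  by (simp add: kern_tens_def kern_def vtens_def fun_eq_iff)

text \<open>In the product, \<open>(z, s)\<close> runs over the pairs \<open>(u\<^sub>r, s\<^sub>r)\<close>. The sums over \<open>u\<close> and \<open>v\<close> extend
  the formulas for elementary tensors (bi)additively to the direct sum.\<close>

definition coef_mult :: "'a::cstar_algebra choices \<Rightarrow> ('a, 'i) qfunctor \<Rightarrow>
    ('a rep \<Rightarrow> 'i kernel) \<Rightarrow> ('a rep \<Rightarrow> 'i kernel) \<Rightarrow> ('a rep \<Rightarrow> 'i kernel)" where
  "coef_mult ch F c d = (\<lambda>w x y.
     \<Sum>u | c u \<noteq> (\<lambda>_ _. 0). \<Sum>v | d v \<noteq> (\<lambda>_ _. 0). \<Sum>(z, s)\<leftarrow>dec ch u v.
       if w = z then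
         kern_map (adj (Fob F z) (Fob F (u \<otimes>\<^sub>r v)) (Fmor F z (u \<otimes>\<^sub>r v) s) \<circ> Fs F u v)
           (adj (sp z) (sp (u \<otimes>\<^sub>r v)) s)
           (kern_tens (ar (Fob F u)) (ar (sp u)) (c u) (d v)) x y
       else 0)"

definition coef_star :: "'a::cstar_algebra choices \<Rightarrow> ('a rep \<Rightarrow> ('i, 'i) opr) \<Rightarrow>
    ('a rep \<Rightarrow> 'i kernel) \<Rightarrow> ('a rep \<Rightarrow> 'i kernel)" where
  "coef_star ch J c = (\<lambda>w x y.
     \<Sum>u | c u \<noteq> (\<lambda>_ _. 0).
       if w = cj ch u then
         kern_amap (J u)
           (aadj (sp (cj ch u)) (sp u) (the_inv_into (ell2 (sp u)) (cjm ch u))) (c u) x y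
       else 0)"

definition coef_alg :: "'a::cstar_algebra choices \<Rightarrow> ('a, 'i) qfunctor \<Rightarrow> ('a rep \<Rightarrow> ('i, 'i) opr) \<Rightarrow>
    ('a rep \<Rightarrow> 'i kernel) star_alg" where
  "coef_alg ch F J = \<lparr>
     carr = {(\<lambda>w x y. \<Sum>k<n. elt (u k) (T k) (\<phi> k) w x y) | (n::nat) u T \<phi>.
        \<forall>k<n. u k \<in> hat ch F \<and> T k \<in> ell2 (Fob F (u k)) \<and> \<phi> k \<in> ell2 (sp (u k))},
     add = (\<lambda>c d w x y. c w x y + d w x y),
     scl = (\<lambda>a c w x y. a * c w x y),
     mul = coef_mult ch F,
     str = coef_star ch J,
     unt = elt runit (ket []) (ket [])\<rparr>"

lemma bop_scale: "A \<in> bop H K \<Longrightarrow> f \<in> ell2 H \<Longrightarrow> A (\<lambda>w. c * f w) = (\<lambda>w. c * A f w)"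
  by (simp add: bop_def)

lemma abop_scale: "A \<in> abop H K \<Longrightarrow> f \<in> ell2 H \<Longrightarrow> A (\<lambda>w. c * f w) = (\<lambda>w. cnj c * A f w)"
  by (simp add: abop_def)

lemma bop_ell2: "A \<in> bop H K \<Longrightarrow> f \<in> ell2 H \<Longrightarrow> A f \<in> ell2 K"
  by (auto simp: bop_def)

lemma sum_elt:
  assumes "h u (\<lambda>_ _. 0) = (0::complex)"
  shows "(\<Sum>v | elt u T \<phi> v \<noteq> (\<lambda>_ _. 0). h v (elt u T \<phi> v)) = h u (kern T \<phi>)"
proof (cases "kern T \<phi> = (\<lambda>_ _. 0)")
  case True
  then have "{v. elt u T \<phi> v \<noteq> (\<lambda>_ _. 0)} = {}" by (auto simp: elt_def)
  then show ?thesis using True assms by (simp only: sum.empty)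
next
  case False
  then have "{v. elt u T \<phi> v \<noteq> (\<lambda>_ _. 0)} = {u}" by (auto simp: elt_def)
  then show ?thesis by (simp add: elt_def)
qed

text \<open>On elementary tensors, the operations are given by the expected formulas.\<close>

lemma coef_mult_elt:
  assumes A: "\<And>z s. (z, s) \<in> set (dec ch u v) \<Longrightarrow>
      adj (Fob F z) (Fob F (u \<otimes>\<^sub>r v)) (Fmor F z (u \<otimes>\<^sub>r v) s) \<in> bop (Fob F (u \<otimes>\<^sub>r v)) (Fob F z)"
    and B: "\<And>z s. (z, s) \<in> set (dec ch u v) \<Longrightarrow>
      adj (sp z) (sp (u \<otimes>\<^sub>r v)) s \<in> bop (sp (u \<otimes>\<^sub>r v)) (sp z)"
    and S: "Fs F u v \<in> bop (Fob F u \<otimes>\<^sub>h Fob F v) (Fob F (u \<otimes>\<^sub>r v))"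
    and T: "vtens (Fob F u) T T' \<in> ell2 (Fob F u \<otimes>\<^sub>h Fob F v)"
    and \<phi>: "vtens (sp u) \<phi> \<phi>' \<in> ell2 (sp (u \<otimes>\<^sub>r v))"
  shows "coef_mult ch F (elt u T \<phi>) (elt v T' \<phi>') = (\<lambda>w x y. \<Sum>(z, s)\<leftarrow>dec ch u v.
      elt z (adj (Fob F z) (Fob F (u \<otimes>\<^sub>r v)) (Fmor F z (u \<otimes>\<^sub>r v) s) (Fs F u v (vtens (Fob F u) T T')))
        (adj (sp z) (sp (u \<otimes>\<^sub>r v)) s (vtens (sp u) \<phi> \<phi>')) w x y)"
proof -
  let ?K = "\<lambda>z s. kern_map (adj (Fob F z) (Fob F (u \<otimes>\<^sub>r v)) (Fmor F z (u \<otimes>\<^sub>r v) s) \<circ> Fs F u v)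
           (adj (sp z) (sp (u \<otimes>\<^sub>r v)) s)"
  let ?f = "vtens (Fob F u) T T'" and ?g = "vtens (sp u) \<phi> \<phi>'"
  have Af: "(adj (Fob F z) (Fob F (u \<otimes>\<^sub>r v)) (Fmor F z (u \<otimes>\<^sub>r v) s) \<circ> Fs F u v) (\<lambda>x. c * ?f x)
      = (\<lambda>x. c * (adj (Fob F z) (Fob F (u \<otimes>\<^sub>r v)) (Fmor F z (u \<otimes>\<^sub>r v) s) \<circ> Fs F u v) ?f x)"
    if "(z, s) \<in> set (dec ch u v)" for z s c
    using bop_scale[OF S T] bop_scale[OF A[OF that] bop_ell2[OF S T]] by simp
  have Bg: "adj (sp z) (sp (u \<otimes>\<^sub>r v)) s (\<lambda>y. c * ?g y) = (\<lambda>y. c * adj (sp z) (sp (u \<otimes>\<^sub>r v)) s ?g y)"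
    if "(z, s) \<in> set (dec ch u v)" for z s c
    using bop_scale[OF B[OF that] \<phi>] by simp
  have K: "?K z s (kern ?f ?g) = kern ((adj (Fob F z) (Fob F (u \<otimes>\<^sub>r v)) (Fmor F z (u \<otimes>\<^sub>r v) s) \<circ> Fs F u v) ?f)
        (adj (sp z) (sp (u \<otimes>\<^sub>r v)) s ?g)" if "(z, s) \<in> set (dec ch u v)" for z s
    using Af[OF that] Bg[OF that] by (rule kern_map_kern)
  have K0: "?K z s (\<lambda>_ _. 0) = (\<lambda>_ _. 0)" if "(z, s) \<in> set (dec ch u v)" for z s
    using Af[OF that, of 0] Bg[OF that, of 0] by (simp add: kern_map_def)
  define h where "h = (\<lambda>w x y k k'. \<Sum>(z, s)\<leftarrow>dec ch u v. if w = z then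
      ?K z s (kern_tens (ar (Fob F u)) (ar (sp u)) k k') x y else 0)"
  have h0: "h w x y (\<lambda>_ _. 0) k = 0" "h w x y k (\<lambda>_ _. 0) = 0" for w x y k
  proof -
    have kt0: "kern_tens n m (\<lambda>_ _. 0) l = (\<lambda>_ _. 0)" "kern_tens n m l (\<lambda>_ _. 0) = (\<lambda>_ _. 0)"
      for n m and l :: "'b kernel"
      by (simp_all add: kern_tens_def)
    have "(\<Sum>(z, s)\<leftarrow>dec ch u v. if w = z then ?K z s (\<lambda>_ _. 0) x y else 0) = 0"
    proof -
      have "map (\<lambda>(z, s). if w = z then ?K z s (\<lambda>_ _. 0) x y else 0) (dec ch u v) = map (\<lambda>_. 0) (dec ch u v)"
        using K0 by (intro map_cong) auto
      then show ?thesis by (simp only: sum_list_0)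
    qed
    then show "h w x y (\<lambda>_ _. 0) k = 0" "h w x y k (\<lambda>_ _. 0) = 0"
      unfolding h_def kt0 by blast+
  qed
  show ?thesis
  proof (intro ext)
    fix w x y
    let ?H = "\<lambda>u v k k'. \<Sum>(z, s)\<leftarrow>dec ch u v. if w = z then
         kern_map (adj (Fob F z) (Fob F (u \<otimes>\<^sub>r v)) (Fmor F z (u \<otimes>\<^sub>r v) s) \<circ> Fs F u v)
           (adj (sp z) (sp (u \<otimes>\<^sub>r v)) s)
           (kern_tens (ar (Fob F u)) (ar (sp u)) k k') x y else 0"
    have H: "?H u v k k' = h w x y k k'" for k k' by (simp add: h_def)
    have "coef_mult ch F (elt u T \<phi>) (elt v T' \<phi>') w x y =
      (\<Sum>u' | elt u T \<phi> u' \<noteq> (\<lambda>_ _. 0). \<Sum>v' | elt v T' \<phi>' v' \<noteq> (\<lambda>_ _. 0).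
         ?H u' v' (elt u T \<phi> u') (elt v T' \<phi>' v'))"
      by (simp add: coef_mult_def)
    also have "\<dots> = (\<Sum>v' | elt v T' \<phi>' v' \<noteq> (\<lambda>_ _. 0). ?H u v' (kern T \<phi>) (elt v T' \<phi>' v'))"
    proof (rule sum_elt[where h = "\<lambda>u' k. \<Sum>v' | elt v T' \<phi>' v' \<noteq> (\<lambda>_ _. 0). ?H u' v' k (elt v T' \<phi>' v')"])
      have "?H u v' (\<lambda>_ _. 0) (elt v T' \<phi>' v') = 0" if "elt v T' \<phi>' v' \<noteq> (\<lambda>_ _. 0)" for v'
      proof -
        have "v' = v" using that by (auto simp: elt_def split: if_splits)
        show ?thesis by (simp only: \<open>v' = v\<close> H h0(1))
      qed
      then show "(\<Sum>v' | elt v T' \<phi>' v' \<noteq> (\<lambda>_ _. 0). ?H u v' (\<lambda>_ _. 0) (elt v T' \<phi>' v')) = 0"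
        by (intro sum.neutral) auto
    qed
    also have "\<dots> = ?H u v (kern T \<phi>) (kern T' \<phi>')"
      by (rule sum_elt[where h = "\<lambda>v' k. ?H u v' (kern T \<phi>) k"], subst H, rule h0(2))
    also have "\<dots> = (\<Sum>(z, s)\<leftarrow>dec ch u v.
      elt z (adj (Fob F z) (Fob F (u \<otimes>\<^sub>r v)) (Fmor F z (u \<otimes>\<^sub>r v) s) (Fs F u v ?f))
        (adj (sp z) (sp (u \<otimes>\<^sub>r v)) s ?g) w x y)"
      by (rule arg_cong[of _ _ sum_list], rule map_cong[OF refl])
         (auto simp: elt_def kern_tens_kern K)
    finally show "coef_mult ch F (elt u T \<phi>) (elt v T' \<phi>') w x y = (\<Sum>(z, s)\<leftarrow>dec ch u v.
      elt z (adj (Fob F z) (Fob F (u \<otimes>\<^sub>r v)) (Fmor F z (u \<otimes>\<^sub>r v) s) (Fs F u v ?f))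
        (adj (sp z) (sp (u \<otimes>\<^sub>r v)) s ?g) w x y)" .
  qed
qed

lemma coef_star_elt:
  assumes "J u \<in> abop H K" "T \<in> ell2 H"
    and "aadj (sp (cj ch u)) (sp u) (the_inv_into (ell2 (sp u)) (cjm ch u)) \<in> abop (sp u) (sp (cj ch u))"
    and "\<phi> \<in> ell2 (sp u)"
  shows "coef_star ch J (elt u T \<phi>) =
    elt (cj ch u) (J u T) (aadj (sp (cj ch u)) (sp u) (the_inv_into (ell2 (sp u)) (cjm ch u)) \<phi>)"
proof (intro ext)
  fix w x y
  let ?B = "\<lambda>u. aadj (sp (cj ch u)) (sp u) (the_inv_into (ell2 (sp u)) (cjm ch u))"
  have 1: "J u (\<lambda>x. c * T x) = (\<lambda>x. cnj c * J u T x)" for c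
    using assms(1,2) by (rule abop_scale)
  have 2: "?B u (\<lambda>y. c * \<phi> y) = (\<lambda>y. cnj c * ?B u \<phi> y)" for c
    using assms(3,4) by (rule abop_scale)
  have "kern_amap (J u) (?B u) (\<lambda>_ _. 0) = (\<lambda>_ _. 0)"
    using 1[of 0] 2[of 0] by (simp add: kern_amap_def)
  then have "coef_star ch J (elt u T \<phi>) w x y =
      (if w = cj ch u then kern_amap (J u) (?B u) (kern T \<phi>) x y else 0)"
    unfolding coef_star_def
    by (intro sum_elt[where h = "\<lambda>u k. if w = cj ch u then kern_amap (J u) (?B u) k x y else 0"]) simp
  then show "coef_star ch J (elt u T \<phi>) w x y = elt (cj ch u) (J u T) (?B u \<phi>) w x y"
    using kern_amap_kern[OF 1 2] by (simp add: elt_def)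
qed

lemma otens_vtens:
  assumes f: "f \<in> ell2 H" and g: "g \<in> ell2 H'" and fg: "vtens H f g \<in> ell2 (H \<otimes>\<^sub>h H')"
    and wf: "wf_hilb H" "wf_hilb K" "wf_hilb K'"
    and S: "S \<in> bop H K" and T: "T \<in> bop H' K'"
  shows "otens H K H' K' S T (vtens H f g) = vtens K (S f) (T g)"
proof (intro ext)
  fix w
  have f0: "f x = 0" if "x \<notin> ix H" for x using f that by (auto simp: ell2_def)
  have slice: "(\<lambda>y. vtens H f g (x @ y)) = (\<lambda>y. f x * g y)" if "x \<in> ix H" for x
    using wf(1) that by (auto simp: vtens_def wf_hilb_def)
  have Tx: "(\<lambda>x. if x \<in> ix H then T (\<lambda>y. vtens H f g (x @ y)) v else 0) = (\<lambda>x. T g v * f x)" for v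
    using bop_scale[OF T g] by (auto simp: slice f0 fun_eq_iff)
  have Sf: "S f \<in> ell2 K" and Tg: "T g \<in> ell2 K'" using bop_ell2 S T f g by blast+
  show "otens H K H' K' S T (vtens H f g) w = vtens K (S f) (T g) w"
  proof (cases "w \<in> ix (K \<otimes>\<^sub>h K')")
    case True
    then show ?thesis using fg bop_scale[OF S f] by (simp only: otens_def Tx if_True simp_thms) (simp add: vtens_def mult.commute)
  next
    case False
    then have "take (ar K) w \<notin> ix K \<or> drop (ar K) w \<notin> ix K'"
      by (auto simp: htens_def)
    then have "S f (take (ar K) w) = 0 \<or> T g (drop (ar K) w) = 0" using Sf Tg by (auto simp: ell2_def)
    then show ?thesis using False by (auto simp: otens_def vtens_def)
  qed
qed

text \<open>The action \<open>\<eta>\<close> is the continuous linear extension of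
  \<open>\<eta>(T\<close>-bar\<open> \<otimes> \<phi>) = T\<close>-bar\<open> \<otimes> u(\<phi>)\<close>, with \<open>u(\<phi>) = \<Sum>\<^sub>i e\<^sub>i \<otimes> \<Sum>\<^sub>j \<phi>\<^sub>j u\<^sub>i\<^sub>j\<close>.\<close>

definition canonical_action :: "'a::cstar_algebra choices \<Rightarrow> ('a, 'i) qfunctor \<Rightarrow>
    (('a rep \<Rightarrow> 'i kernel) \<Rightarrow> 'b::cstar_algebra) \<Rightarrow> ('b \<Rightarrow> 'a \<Rightarrow> 'ba::cstar_algebra) \<Rightarrow> ('b \<Rightarrow> 'ba) \<Rightarrow> bool" where
  "canonical_action ch F \<iota> tb \<eta> \<longleftrightarrow>
     clin \<eta> \<and> continuous_on UNIV \<eta> \<and>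
     (\<forall>u\<in>hat ch F. \<forall>T\<in>ell2 (Fob F u). \<forall>\<phi>\<in>ell2 (sp u).
        \<eta> (\<iota> (elt u T \<phi>)) =
          (\<Sum>i\<in>ix (sp u). tb (\<iota> (elt u T (ket i))) (\<Sum>j\<in>ix (sp u). \<phi> j *\<^sub>C cf u i j)))"

end

(* Transporting the F(u)-component of the coefficient algebra by U_u is a *-isomorphism of the
   coefficient algebras: compatibility with products is the quasitensor property, and compatibility
   with the involutions holds because J is determined by (xi (x) T, S* F(R)) = (xi, J T) and U carries
   S* F(R) to S* G(R). Pulling back the maximal C*-norm along this isomorphism and along its inverse
   shows that it is isometric, so it extends to the completions. It intertwines the actions because
   the minimality of the spatial norm makes alpha (x) id isometric on elementary tensors. Uniqueness
   uses that *-homomorphisms of C*-algebras are continuous. *)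

theory Submission
  imports Defs
begin

section \<open>Homomorphisms of C*-algebras\<close>

text \<open>\<open>tensor_map\<close> is a definite description, so \<alpha> \<otimes> id has to be
  built before anything can be said about it. The leastness clause of \<open>cstar_tensor\<close>
  compares the norm only with definite C*-seminorms; pulling back the other norm therefore needs
  \<alpha> \<otimes> id to be well defined and injective on algebraic tensors, and both follow from
  the clause on independent sets. Automatic continuity of *-homomorphisms is obtained without
  spectral theory, from a power series for the square root. On the algebraic side the spaces F(u)
  may be infinite-dimensional while every H_u is finite-dimensional. An element of the component at
  u is thus a finite family of vectors of F(u), the conjugated columns of a kernel, and the
  operations are expanded over the kets of the finite-dimensional factor. The choices of conjugates,
  arrows and decompositions are common to both functors, so the transport is the identity on H_u and
  acts column by column.\<close>

interpretation cstar_vec: vector_space "scaleC :: complex \<Rightarrow> 'a \<Rightarrow> 'a::cstar_algebra"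
proof
  \<comment> \<open>The unit law is not among the class axioms; it is inherited from the real
    scalars through \<open>scaleR_scaleC\<close>.\<close>
  show "(1::complex) *\<^sub>C x = x" for x :: 'a
    using scaleR_scaleC[of 1 x] by simp
qed (simp_all add: scaleC_add_right scaleC_add_left scaleC_scaleC)

lemma star_zero [simp]: "star (0::'a::cstar_algebra) = 0"
  using star_add[of "0::'a" 0] by simp

lemma star_minus: "star (- x) = - star (x::'a::cstar_algebra)"
  using star_add[of x "- x"] by (simp add: eq_neg_iff_add_eq_0 add.commute)

lemma star_one [simp]: "star (1::'a::cstar_algebra) = 1"
  by (metis mult_1 mult_1_right star_mult star_star)

lemma star_scaleR: "star (r *\<^sub>R x) = r *\<^sub>R star (x::'a::cstar_algebra)"
  by (simp add: scaleR_scaleC star_scaleC)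

lemma star_power: "star (x ^ n) = star (x::'a::cstar_algebra) ^ n"
  by (induction n) (simp_all add: star_mult power_commutes)

lemma norm_star: "norm (star x) = norm (x::'a::cstar_algebra)"
proof -
  have le: "norm y \<le> norm (star y)" for y :: 'a
  proof (cases "y = 0")
    case False
    have "norm y * norm y \<le> norm (star y) * norm y"
      using norm_mult_ineq[of "star y" y] by (simp add: norm_star_mult power2_eq_square)
    then show ?thesis using False by simp
  qed simp
  from le[of x] le[of "star x"] show ?thesis by (simp add: star_star)
qed

lemma bounded_linear_star: "bounded_linear (star :: 'a::cstar_algebra \<Rightarrow> 'a)"
  by (rule bounded_linear_intro[where K = 1]) (simp_all add: star_add star_scaleR norm_star)

lemma bounded_linear_scaleC: "bounded_linear (\<lambda>x::'a::cstar_algebra. c *\<^sub>C x)"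
  by (rule bounded_linear_intro[where K = "cmod c"])
     (simp_all add: scaleC_add_right scaleR_scaleC scaleC_scaleC mult.commute norm_scaleC)

section \<open>Complex-linear maps\<close>

lemma clin_add: "clin h \<Longrightarrow> h (x + y) = h x + h y"
  and clin_scale: "clin h \<Longrightarrow> h (c *\<^sub>C x) = c *\<^sub>C h x"
  by (simp_all add: clin_def)

lemma clin_zero: "clin h \<Longrightarrow> h 0 = 0"
  using clin_add[of h 0 0] by simp

lemma clin_diff: "clin h \<Longrightarrow> h (x - y) = h x - h y"
  using clin_add[of h "x - y" y] by simp

lemma clin_sum: "clin h \<Longrightarrow> h (sum f A) = (\<Sum>a\<in>A. h (f a))"
  by (induction A rule: infinite_finite_induct) (simp_all add: clin_zero clin_add)

lemma clin_comp: "clin g \<Longrightarrow> clin f \<Longrightarrow> clin (g \<circ> f)"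
  by (simp add: clin_def)

lemma star_hom_clin: "star_hom h \<Longrightarrow> clin h"
  by (simp add: star_hom_def)

text \<open>The density argument behind three facts: uniqueness of \<alpha> \<otimes> id, the
  intertwining of the two actions, and uniqueness of the final isomorphism.\<close>

lemma clin_continuous_eq:
  fixes f g :: "'a::cstar_algebra \<Rightarrow> 'b::cstar_algebra"
  assumes f: "clin f" "continuous_on UNIV f" and g: "clin g" "continuous_on UNIV g"
    and eq: "\<And>x. x \<in> S \<Longrightarrow> f x = g x" and dense: "closure (cspan S) = UNIV"
  shows "f = g"
proof
  fix x
  have "f y = g y" if "y \<in> cspan S" for y
    using that
  proof (induction rule: cstar_vec.span_induct_alt)
    case base
    show ?case using f(1) g(1) by (simp add: clin_zero)
  next
    case (step c x y)
    then show ?case using f(1) g(1) eq by (simp add: clin_add clin_scale)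
  qed
  then have "closure (cspan S) \<subseteq> {x. f x = g x}"
    using f(2) g(2) by (intro closure_minimal closed_Collect_eq) auto
  then show "f x = g x" using dense by auto
qed

section \<open>Square roots by the binomial series, and contractivity of *-homomorphisms\<close>

lemma sqrt_one_minus:
  fixes a :: "'a::cstar_algebra"
  assumes "norm a < 1" "star a = a"
  obtains b where "star b = b" "b * b = 1 - a" "\<And>d. d * a = a * d \<Longrightarrow> d * b = b * d"
proof -
  \<comment> \<open>The binomial series of (1 - a)^(1/2), absolutely convergent for
    \<open>norm a < 1\<close>. Its coefficients are real, so each term is self-adjoint when
    \<open>a\<close> is, and each term is a multiple of a power of \<open>a\<close>, hence commutes
    with whatever commutes with \<open>a\<close>.\<close>
  define c where "c n = ((1/2::real) gchoose n) *\<^sub>R (- a) ^ n" for n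
  have "summable (\<lambda>n. norm ((1/2::real) gchoose n) * norm a ^ n)"
    using abs_summable_in_conv_radius[of "norm a" "\<lambda>n. (1/2::real) gchoose n"] assms(1)
    by (simp add: conv_radius_gchoose abs_mult)
  then have sn: "summable (\<lambda>n. norm (c n))"
  proof (rule summable_comparison_test'[where N = 0])
    show "norm (norm (c n)) \<le> norm ((1/2::real) gchoose n) * norm a ^ n" for n
      using norm_power_ineq[of "- a" n] by (simp add: c_def mult_left_mono)
  qed
  then have s: "summable c" by (rule summable_norm_cancel)
  define b where "b = suminf c"
  have "star b = (\<Sum>n. star (c n))"
    unfolding b_def by (rule bounded_linear.suminf[OF bounded_linear_star s])
  also have "(\<lambda>n. star (c n)) = c"
    using assms(2) by (simp add: c_def fun_eq_iff star_scaleR star_power star_minus)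
  finally have "star b = b" by (simp add: b_def)
  moreover have "d * b = b * d" if d: "d * a = a * d" for d
  proof -
    have "d * (- a) ^ n = (- a) ^ n * d" for n
      by (induction n) (use d in \<open>simp_all add: mult.assoc[symmetric] power_Suc2 del: power_Suc, simp add: mult.assoc\<close>)
    then have "(\<Sum>n. d * c n) = (\<Sum>n. c n * d)" by (simp add: c_def)
    then show ?thesis
      unfolding b_def using bounded_linear.suminf[OF bounded_linear_mult_right s, of d]
        bounded_linear.suminf[OF bounded_linear_mult_left s, of d] by simp
  qed
  moreover have "b * b = 1 - a"
  proof -
    \<comment> \<open>The Cauchy product of the series with itself collapses, by Vandermonde's
      identity, to the binomial series of exponent 1/2 + 1/2 = 1.\<close>
    have "(\<lambda>k. \<Sum>i\<le>k. c i * c (k - i)) sums (b * b)"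
      unfolding b_def by (rule Cauchy_product_sums[OF sn sn])
    moreover have "(\<Sum>i\<le>k. c i * c (k - i)) = ((1::real) gchoose k) *\<^sub>R (- a) ^ k" for k
    proof -
      have "(\<Sum>i\<le>k. c i * c (k - i)) =
          (\<Sum>i\<le>k. (((1/2::real) gchoose i) * ((1/2) gchoose (k - i))) *\<^sub>R (- a) ^ k)"
        by (rule sum.cong) (auto simp: c_def power_add[symmetric])
      also have "\<dots> = (\<Sum>i\<le>k. ((1/2::real) gchoose i) * ((1/2) gchoose (k - i))) *\<^sub>R (- a) ^ k"
        by (simp only: scaleR_left.sum)
      also have "(\<Sum>i\<le>k. ((1/2::real) gchoose i) * ((1/2) gchoose (k - i))) = 1 gchoose k"
        using gbinomial_Vandermonde[of "1/2::real" "1/2" k] by (simp add: atLeast0AtMost)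
      finally show ?thesis .
    qed
    ultimately have "(\<lambda>k. ((1::real) gchoose k) *\<^sub>R (- a) ^ k) sums (b * b)" by simp
    \<comment> \<open>With exponent 1 all coefficients beyond k = 1 vanish, which leaves 1 -
      a.\<close>
    moreover have "(\<lambda>k. ((1::real) gchoose k) *\<^sub>R (- a) ^ k) sums
        (\<Sum>k\<in>{..1}. ((1::real) gchoose k) *\<^sub>R (- a) ^ k)"
    proof (rule sums_finite)
      fix k :: nat assume "k \<notin> {..1}"
      then have "(1::real) gchoose k = 0"
        using binomial_eq_0[of 1 k] by (metis atMost_iff binomial_gbinomial leI of_nat_0 of_nat_1)
      then show "((1::real) gchoose k) *\<^sub>R (- a) ^ k = 0" by simp
    qed simp
    ultimately show ?thesis using sums_unique2 by fastforce
  qed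
  ultimately show thesis using that by blast
qed

text \<open>For self-adjoint \<open>a\<close> with \<open>\<parallel>a\<parallel> < 1\<close>, write \<open>1 - a\<^sup>2 = b\<^sup>2\<close> with \<open>b\<close> self-adjoint and commuting
  with \<open>a\<close>. Then \<open>h a + i h b\<close> is unitary, and \<open>h a\<close> is its real part.\<close>

lemma star_hom_norm_le:
  fixes h :: "'a::cstar_algebra \<Rightarrow> 'b::cstar_algebra"
  assumes h: "star_hom h"
  shows "norm (h x) \<le> norm x"
proof -
  note lin = star_hom_clin[OF h]
  have mult: "h (x * y) = h x * h y" and st: "h (star x) = star (h x)" and one: "h 1 = 1" for x y
    using h by (auto simp: star_hom_def)
  have unit: "norm (h a) \<le> 1" if a: "norm a < 1" "star a = a" for a
  proof -
    have "norm (a * a) < 1"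
      using norm_star_mult[of a] a by (simp add: power_less_one_iff)
    moreover have "star (a * a) = a * a" using a by (simp add: star_mult)
    ultimately obtain b where b: "star b = b" "b * b = 1 - a * a" "a * b = b * a"
      by (rule sqrt_one_minus) (simp add: mult.assoc)
    define u where "u = h a + \<i> *\<^sub>C h b"
    have ha: "star (h a) = h a" and hb: "star (h b) = h b" using a b st by metis+
    have su: "star u = h a - \<i> *\<^sub>C h b"
      by (simp add: u_def star_add star_scaleC ha hb)
    have "star u * u = h a * h a - \<i> *\<^sub>C \<i> *\<^sub>C (h b * h b) + \<i> *\<^sub>C (h a * h b - h b * h a)"
      unfolding su by (simp add: u_def algebra_simps mult_scaleC_left mult_scaleC_right
          cstar_vec.scale_right_diff_distrib)
    also have "\<dots> = h (a * a) + h (b * b)"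
      using b(3) mult[of a b] mult[of b a] by (simp add: mult)
    also have "\<dots> = 1" by (simp add: b clin_diff[OF lin] one)
    finally have "norm u ^ 2 = 1" by (simp flip: norm_star_mult)
    then have nu: "norm u = 1" by (metis abs_norm_cancel abs_square_eq_1)
    have "2 *\<^sub>R h a = u + star u" by (simp add: su) (simp add: u_def scaleR_2)
    then have "2 * norm (h a) \<le> norm u + norm (star u)"
      by (metis norm_triangle_ineq norm_scaleR abs_numeral)
    then show ?thesis using nu by (simp add: norm_star)
  qed
  have sa: "norm (h a) \<le> norm a" if "star a = a" for a
  proof (rule field_le_epsilon)
    fix e :: real assume e: "e > 0"
    \<comment> \<open>The square root requires a norm strictly below 1, so \<open>a\<close> is
      divided by slightly more than its norm; the margin \<open>e\<close> also covers a = 0.\<close>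
    define r where "r = norm a + e"
    have r: "r > 0" using e by (simp add: r_def add_nonneg_pos)
    have "norm (h ((1 / r) *\<^sub>R a)) \<le> 1"
      using r e that by (intro unit) (simp_all add: star_scaleR r_def)
    then show "norm (h a) \<le> norm a + e"
      using r by (simp add: scaleR_scaleC clin_scale[OF lin] norm_scaleC norm_divide divide_le_eq flip: r_def)
  qed
  \<comment> \<open>The C*-identity on both sides reduces a general \<open>x\<close> to the
    self-adjoint element \<open>star x * x\<close>.\<close>
  have "norm (h x) ^ 2 = norm (h (star x * x))"
    by (simp add: mult st norm_star_mult)
  also have "\<dots> \<le> norm (star x * x)"
    by (rule sa) (simp add: star_mult star_star)
  finally have "norm (h x) ^ 2 \<le> norm x ^ 2" by (simp add: norm_star_mult)
  then show ?thesis by (rule power2_le_imp_le) simp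
qed

lemma star_hom_continuous: "star_hom h \<Longrightarrow> continuous_on S h"
proof -
  assume h: "star_hom h"
  have "dist (h x) (h y) \<le> dist x y" for x y
    using star_hom_norm_le[OF h, of "x - y"] by (simp add: dist_norm clin_diff[OF star_hom_clin[OF h]])
  then show ?thesis
    by (meson continuous_on_iff order_le_less_trans)
qed

lemma star_iso_inv:
  assumes "star_iso h" shows "star_iso (inv h)"
proof -
  have b: "bij h" and h: "star_hom h" using assms by (simp_all add: star_iso_def)
  have 1: "inv h x = y \<longleftrightarrow> x = h y" for x y
    using b by (metis bij_inv_eq_iff)
  have 2: "h (inv h x) = x" for x using b by (simp add: bij_is_surj surj_f_inv_f)
  show ?thesis
    using h b by (simp add: star_iso_def star_hom_def clin_def 1 2 bij_imp_bij_inv)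
qed

section \<open>Extension of isometric *-homomorphisms by density\<close>

definition closed_star_alg :: "'x star_alg \<Rightarrow> bool" where
  "closed_star_alg X \<longleftrightarrow> unt X \<in> carr X \<and>
     (\<forall>x\<in>carr X. str X x \<in> carr X \<and> (\<forall>c. scl X c x \<in> carr X) \<and>
        (\<forall>y\<in>carr X. add X x y \<in> carr X \<and> mul X x y \<in> carr X))"

text \<open>The record \<open>star_alg\<close> has no subtraction, so a difference is formed as x +
  (-1) y; closure keeps (-1) y in the carrier, where the laws of \<open>star_alg_hom\<close>
  apply.\<close>

lemma star_alg_hom_diff:
  assumes "star_alg_hom X p" "closed_star_alg X" "x \<in> carr X" "y \<in> carr X"
  shows "p (add X x (scl X (- 1) y)) = p x - p y"
proof -
  have "(-1::complex) *\<^sub>C p y = - p y"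
    by (simp add: cstar_vec.scale_minus_left)
  then show ?thesis using assms by (simp add: star_alg_hom_def closed_star_alg_def)
qed

text \<open>Supplies the competitors in the definition of the maximal norm: every *-homomorphism
  into a C*-algebra yields one.\<close>

lemma cstar_seminorm_hom:
  assumes p: "star_alg_hom X p" and X: "closed_star_alg X"
  shows "cstar_seminorm X (\<lambda>x. norm (p x))"
  using assms
  by (auto simp: cstar_seminorm_def star_alg_hom_def closed_star_alg_def norm_scaleC
      norm_triangle_ineq norm_mult_ineq norm_star_mult)

text \<open>Equal distances make \<open>q\<close> constant on the fibres of \<open>p\<close>, so the
  choice in \<open>f\<close> is harmless, and make \<open>f\<close> an isometry on the dense image
  of \<open>p\<close>; completeness of the target then extends it. Neither \<open>p\<close> nor
  \<open>q\<close> has to be injective.\<close>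

lemma isometric_extension:
  fixes p :: "'x \<Rightarrow> 'b::metric_space" and q :: "'x \<Rightarrow> 'c::complete_space"
  assumes iso: "\<And>x y. x \<in> S \<Longrightarrow> y \<in> S \<Longrightarrow> dist (p x) (p y) = dist (q x) (q y)"
    and dense: "closure (p ` S) = UNIV"
  obtains g where "continuous_on UNIV g" "\<And>x. x \<in> S \<Longrightarrow> g (p x) = q x"
proof -
  define f where "f b = q (SOME x. x \<in> S \<and> p x = b)" for b
  have f: "f (p x) = q x" if "x \<in> S" for x
  proof -
    have "\<exists>y. y \<in> S \<and> p y = p x" using that by blast
    then have "(SOME y. y \<in> S \<and> p y = p x) \<in> S \<and> p (SOME y. y \<in> S \<and> p y = p x) = p x"
      by (rule someI_ex)
    then show ?thesis using iso[OF _ that] by (metis dist_eq_0_iff f_def)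
  qed
  have "uniformly_continuous_on (p ` S) f"
    using iso by (auto simp: uniformly_continuous_on_def f)
  then obtain g where "uniformly_continuous_on (closure (p ` S)) g" "\<And>x. x \<in> p ` S \<Longrightarrow> f x = g x"
    by (rule uniformly_continuous_on_extension_on_closure) blast
  then show thesis
    using that[of g] f dense by (simp add: uniformly_continuous_imp_continuous)
qed

text \<open>The two-variable version of density, by which additivity and multiplicativity of an
  extension are checked on pairs from a dense set.\<close>

lemma dense_product_eq:
  fixes f g :: "'a::topological_space \<times> 'b::topological_space \<Rightarrow> 'c::t2_space"
  assumes "closure D = UNIV" "closure E = UNIV" "continuous_on UNIV f" "continuous_on UNIV g"
    and "\<And>x y. x \<in> D \<Longrightarrow> y \<in> E \<Longrightarrow> f (x, y) = g (x, y)"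
  shows "f z = g z"
proof -
  have "closure (D \<times> E) \<subseteq> {z. f z = g z}"
    using assms by (intro closure_minimal closed_Collect_eq) auto
  then show ?thesis using assms by (auto simp: closure_Times)
qed

text \<open>Extending in both directions gives continuous maps that are mutually inverse on dense
  sets, hence everywhere, and each algebraic law is a closed condition verified on the image of
  \<open>p\<close>. It applies both to the coefficient algebras and to formal sums of elementary
  tensors.\<close>

lemma isometric_star_iso:
  fixes p :: "'x \<Rightarrow> 'b::cstar_algebra" and q :: "'x \<Rightarrow> 'c::cstar_algebra"
  assumes X: "closed_star_alg X" and p: "star_alg_hom X p" and q: "star_alg_hom X q"
    and iso: "\<And>x. x \<in> carr X \<Longrightarrow> norm (p x) = norm (q x)"
    and pd: "closure (p ` carr X) = UNIV" and qd: "closure (q ` carr X) = UNIV"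
  obtains \<alpha> where "star_iso \<alpha>" "\<And>x. x \<in> carr X \<Longrightarrow> \<alpha> (p x) = q x"
proof -
  have in_carr: "add X x y \<in> carr X" "mul X x y \<in> carr X" "scl X c x \<in> carr X" "str X x \<in> carr X" "unt X \<in> carr X"
    if "x \<in> carr X" "y \<in> carr X" for c x y
    using X that by (auto simp: closed_star_alg_def)
  have ph: "p (add X x y) = p x + p y" "p (mul X x y) = p x * p y" "p (scl X c x) = c *\<^sub>C p x" "p (str X x) = star (p x)"
    and qh: "q (add X x y) = q x + q y" "q (mul X x y) = q x * q y" "q (scl X c x) = c *\<^sub>C q x" "q (str X x) = star (q x)"
    if "x \<in> carr X" "y \<in> carr X" for c x y
    using p q that by (auto simp: star_alg_hom_def)
  have dist: "dist (p x) (p y) = dist (q x) (q y)" if "x \<in> carr X" "y \<in> carr X" for x y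
  proof -
    have "add X x (scl X (- 1) y) \<in> carr X" using X that by (simp add: closed_star_alg_def)
    from iso[OF this] show ?thesis
      by (simp add: dist_norm star_alg_hom_diff[OF p X that] star_alg_hom_diff[OF q X that])
  qed
  obtain \<alpha> where \<alpha>: "continuous_on UNIV \<alpha>" "\<And>x. x \<in> carr X \<Longrightarrow> \<alpha> (p x) = q x"
    using isometric_extension[OF dist pd] by blast
  obtain \<beta> where \<beta>: "continuous_on UNIV \<beta>" "\<And>x. x \<in> carr X \<Longrightarrow> \<beta> (q x) = p x"
    using isometric_extension[OF dist[symmetric] qd] by blast
  have comp: "continuous_on UNIV (\<lambda>x. \<alpha> (f x))" if "continuous_on UNIV f" for f :: "'z::topological_space \<Rightarrow> 'b"
    using continuous_on_compose2[OF \<alpha>(1) that] by simp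
  have comp': "continuous_on UNIV (\<lambda>x. \<beta> (f x))" if "continuous_on UNIV f" for f :: "'z::topological_space \<Rightarrow> 'c"
    using continuous_on_compose2[OF \<beta>(1) that] by simp
  have single: "f b = g b" if "continuous_on UNIV f" "continuous_on UNIV g" "\<And>x. x \<in> carr X \<Longrightarrow> f (p x) = g (p x)"
    for f g :: "'b \<Rightarrow> 'z::t2_space" and b
  proof -
    have "closure (p ` carr X) \<subseteq> {b. f b = g b}"
      using that by (intro closure_minimal closed_Collect_eq) auto
    then show ?thesis using pd by auto
  qed
  have "\<beta> (\<alpha> b) = b" for b
    by (rule single[of "\<lambda>b. \<beta> (\<alpha> b)" "\<lambda>b. b"]) (auto simp: \<alpha>(2) \<beta>(2) intro!: comp' \<alpha>(1) continuous_intros)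
  moreover have "\<alpha> (\<beta> c) = c" for c
  proof -
    have "closure (q ` carr X) \<subseteq> {c. \<alpha> (\<beta> c) = c}"
      by (intro closure_minimal closed_Collect_eq) (auto simp: \<alpha>(2) \<beta>(2) intro!: comp \<beta>(1) continuous_intros)
    then show ?thesis using qd by auto
  qed
  ultimately have "bij \<alpha>" by (metis bijI')
  moreover have "\<alpha> (a + b) = \<alpha> a + \<alpha> b" for a b
  proof -
    have "\<alpha> (x + y) = \<alpha> x + \<alpha> y" if xy: "x \<in> p ` carr X" "y \<in> p ` carr X" for x y
    proof -
      obtain x' y' where xy': "x' \<in> carr X" "y' \<in> carr X" "x = p x'" "y = p y'" using xy by blast
      show ?thesis
        using \<alpha>(2)[OF in_carr(1)[OF xy'(1,2)]] by (simp add: xy' ph(1) qh(1) \<alpha>(2))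
    qed
    moreover have "continuous_on UNIV (\<lambda>z. \<alpha> (fst z + snd z))" "continuous_on UNIV (\<lambda>z. \<alpha> (fst z) + \<alpha> (snd z))"
      by (intro comp continuous_intros)+
    ultimately show ?thesis
      using dense_product_eq[OF pd pd, of "\<lambda>z. \<alpha> (fst z + snd z)" "\<lambda>z. \<alpha> (fst z) + \<alpha> (snd z)" "(a, b)"] by simp
  qed
  moreover have "\<alpha> (a * b) = \<alpha> a * \<alpha> b" for a b
  proof -
    have "\<alpha> (x * y) = \<alpha> x * \<alpha> y" if xy: "x \<in> p ` carr X" "y \<in> p ` carr X" for x y
    proof -
      obtain x' y' where xy': "x' \<in> carr X" "y' \<in> carr X" "x = p x'" "y = p y'" using xy by blast
      show ?thesis
        using \<alpha>(2)[OF in_carr(2)[OF xy'(1,2)]] by (simp add: xy' ph(2) qh(2) \<alpha>(2))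
    qed
    moreover have "continuous_on UNIV (\<lambda>z. \<alpha> (fst z * snd z))" "continuous_on UNIV (\<lambda>z. \<alpha> (fst z) * \<alpha> (snd z))"
      by (intro comp continuous_intros)+
    ultimately show ?thesis
      using dense_product_eq[OF pd pd, of "\<lambda>z. \<alpha> (fst z * snd z)" "\<lambda>z. \<alpha> (fst z) * \<alpha> (snd z)" "(a, b)"] by simp
  qed
  moreover have "\<alpha> (c *\<^sub>C a) = c *\<^sub>C \<alpha> a" for a c
  proof (rule single)
    note sc = bounded_linear.continuous_on[OF bounded_linear_scaleC]
    show "continuous_on UNIV (\<lambda>a. \<alpha> (c *\<^sub>C a))" "continuous_on UNIV (\<lambda>a. c *\<^sub>C \<alpha> a)"
      by (intro comp sc continuous_intros \<alpha>(1))+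
    fix x assume x: "x \<in> carr X"
    show "\<alpha> (c *\<^sub>C p x) = c *\<^sub>C \<alpha> (p x)"
      using \<alpha>(2)[OF in_carr(3)[OF x x]] by (simp add: x ph(3)[OF x x] qh(3)[OF x x] \<alpha>(2))
  qed
  moreover have "\<alpha> (star a) = star (\<alpha> a)" for a
  proof (rule single)
    note sc = bounded_linear.continuous_on[OF bounded_linear_star]
    show "continuous_on UNIV (\<lambda>a. \<alpha> (star a))" "continuous_on UNIV (\<lambda>a. star (\<alpha> a))"
      by (intro comp sc continuous_intros \<alpha>(1))+
    fix x assume x: "x \<in> carr X"
    show "\<alpha> (star (p x)) = star (\<alpha> (p x))"
      using \<alpha>(2)[OF in_carr(4)[OF x x]] by (simp add: x ph(4)[OF x x] qh(4)[OF x x] \<alpha>(2))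
  qed
  moreover have "\<alpha> 1 = 1"
    using p q X \<alpha>(2)[of "unt X"] by (simp add: star_alg_hom_def closed_star_alg_def)
  ultimately have "star_iso \<alpha>"
    by (simp add: star_iso_def star_hom_def clin_def)
  then show thesis using that \<alpha>(2) by blast
qed

section \<open>Isomorphisms of tensor products\<close>

text \<open>Formal sums map to both tensor products without a choice of representatives.\<close>

definition tensor_sums :: "('a::cstar_algebra \<times> 'b::cstar_algebra) list star_alg" where
  "tensor_sums = \<lparr>carr = UNIV, add = (@), scl = (\<lambda>c. map (\<lambda>(a, b). (c *\<^sub>C a, b))),
     mul = (\<lambda>xs ys. concat (map (\<lambda>(a, b). map (\<lambda>(a', b'). (a * a', b * b')) ys) xs)),
     str = map (\<lambda>(a, b). (star a, star b)), unt = [(1, 1)]\<rparr>"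

definition tensor_sum :: "('a::cstar_algebra \<Rightarrow> 'b::cstar_algebra \<Rightarrow> 'c::cstar_algebra) \<Rightarrow> ('a \<times> 'b) list \<Rightarrow> 'c" where
  "tensor_sum t xs = (\<Sum>(a, b)\<leftarrow>xs. t a b)"

lemma closed_tensor_sums: "closed_star_alg tensor_sums"
  by (simp add: closed_star_alg_def tensor_sums_def)

lemma tensor_sum_simps [simp]:
  "tensor_sum t [] = 0"
  "tensor_sum t (x # xs) = t (fst x) (snd x) + tensor_sum t xs"
  "tensor_sum t (xs @ ys) = tensor_sum t xs + tensor_sum t ys"
  by (simp_all add: tensor_sum_def case_prod_beta)

lemma cstar_tensorD:
  assumes "cstar_tensor t"
  shows "clin (\<lambda>a. t a b)" "clin (t a)" "t a b * t a' b' = t (a * a') (b * b')"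
    "star (t a b) = t (star a) (star b)" "t 1 1 = 1"
  using assms by (auto simp: cstar_tensor_def)

lemma cstar_tensor_least:
  assumes "cstar_tensor t" "cstar_seminorm (alg_tensor t) p" "\<forall>x\<in>carr (alg_tensor t). p x = 0 \<longrightarrow> x = 0"
  shows "\<forall>x\<in>carr (alg_tensor t). norm x \<le> p x"
  using assms unfolding cstar_tensor_def by simp

text \<open>The map \<open>\<alpha>\<close> is built into the evaluation so that the same formal
  sums can be read in two tensor products with different left factors; \<open>\<alpha> = id\<close>
  gives the plain evaluation.\<close>

lemma star_alg_hom_tensor_sum:
  assumes t: "cstar_tensor t" and \<alpha>: "star_hom \<alpha>"
  shows "star_alg_hom tensor_sums (tensor_sum (\<lambda>a. t (\<alpha> a)))"
proof -
  let ?q = "tensor_sum (\<lambda>a. t (\<alpha> a))"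
  have lin: "clin \<alpha>" and mult: "\<alpha> (x * y) = \<alpha> x * \<alpha> y" and st: "\<alpha> (star x) = star (\<alpha> x)" and one: "\<alpha> 1 = 1" for x y
    using \<alpha> by (auto simp: star_hom_def)
  note T = cstar_tensorD[OF t]
  have "?q (map (\<lambda>(a, b). (c *\<^sub>C a, b)) xs) = c *\<^sub>C ?q xs" for c xs
    by (induction xs) (auto simp: clin_scale[OF lin] clin_scale[OF T(1)] scaleC_add_right)
  moreover have "?q (map (\<lambda>(a, b). (star a, star b)) xs) = star (?q xs)" for xs
    by (induction xs) (auto simp: st T(4) star_add)
  moreover have "?q (concat (map (\<lambda>(a, b). map (\<lambda>(a', b'). (a * a', b * b')) ys) xs)) = ?q xs * ?q ys" for xs ys
  proof (induction xs)
    case (Cons x xs)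
    have "?q (map (\<lambda>y. (a * fst y, b * snd y)) ys) = t (\<alpha> a) b * ?q ys" for a b
      by (induction ys) (auto simp: mult T(3) algebra_simps)
    then show ?case using Cons by (simp add: case_prod_beta algebra_simps)
  qed simp
  ultimately show ?thesis
    by (simp add: star_alg_hom_def tensor_sums_def one T(5))
qed

lemma range_tensor_sum:
  assumes "cstar_tensor t"
  shows "range (tensor_sum t) = carr (alg_tensor t)"
proof (intro set_eqI iffI)
  fix x assume "x \<in> range (tensor_sum t)"
  then obtain xs where "x = tensor_sum t xs" by blast
  then show "x \<in> carr (alg_tensor t)"
  proof (induction xs arbitrary: x)
    case Nil
    then show ?case by (simp add: alg_tensor_def cstar_vec.span_zero)
  next
    case (Cons p xs)
    have "t (fst p) (snd p) \<in> cspan {t a b |a b. True}"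
      by (rule cstar_vec.span_base) blast
    then show ?case using Cons by (auto simp: alg_tensor_def intro!: cstar_vec.span_add)
  qed
next
  fix x assume "x \<in> carr (alg_tensor t)"
  then have "x \<in> cspan {t a b |a b. True}" by (simp add: alg_tensor_def)
  then show "x \<in> range (tensor_sum t)"
  proof (induction rule: cstar_vec.span_induct_alt)
    case base
    show ?case using tensor_sum_simps(1)[of t] by (metis rangeI)
  next
    case (step c x y)
    then obtain a b xs where "x = t a b" "y = tensor_sum t xs" by blast
    \<comment> \<open>The scalar is absorbed into the left factor, so lists without coefficients
      already exhaust the span.\<close>
    then have "c *\<^sub>C x + y = tensor_sum t ((c *\<^sub>C a, b) # xs)"
      by (simp add: clin_scale[OF cstar_tensorD(1)[OF assms]])
    then show ?case by (metis rangeI)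
  qed
qed

text \<open>Expanding the left factors in a basis of their span reduces every relation between
  elementary tensors to the bilinearity relations, which any bilinear map respects.\<close>

lemma tensor_sum_eq_0:
  assumes t: "cstar_tensor t" and s: "\<And>b. clin (\<lambda>a. s a b)" "\<And>a. clin (s a)"
    and 0: "tensor_sum t xs = 0"
  shows "tensor_sum s xs = 0"
proof -
  obtain B where B: "B \<subseteq> fst ` set xs" "\<not> module.dependent scaleC B" "fst ` set xs \<subseteq> cspan B"
    using cstar_vec.maximal_independent_subset[of "fst ` set xs"] by blast
  have fin: "finite B" using B(1) by (rule finite_subset) simp
  define R where "R = module.representation scaleC B"
  have R: "(\<Sum>e\<in>B. R a e *\<^sub>C e) = a" if "a \<in> fst ` set xs" for a
    unfolding R_def using B fin that by (intro cstar_vec.sum_representation_eq) auto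
  \<comment> \<open>\<open>g ys e\<close> is the total right factor standing at the basis vector
    \<open>e\<close> once every left factor is expanded. It depends on the list alone, so every
    bilinear \<open>r\<close> evaluates \<open>ys\<close> through the same \<open>g\<close>.\<close>
  define g where "g ys e = (\<Sum>(a, b)\<leftarrow>ys. R a e *\<^sub>C b)" for ys :: "('a \<times> 'b) list" and e
  have expand: "tensor_sum r ys = (\<Sum>e\<in>B. r e (g ys e))"
    if r: "\<And>b. clin (\<lambda>a. r a b)" "\<And>a. clin (r a)" and "set ys \<subseteq> set xs"
    for r :: "'a \<Rightarrow> 'b \<Rightarrow> 'z::cstar_algebra" and ys :: "('a \<times> 'b) list"
    using \<open>set ys \<subseteq> set xs\<close>
  proof (induction ys)
    case Nil
    then show ?case by (simp add: g_def clin_zero[OF r(2)])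
  next
    case (Cons y ys)
    have y: "fst y \<in> fst ` set xs" using Cons.prems by simp
    have "r (fst y) (snd y) = r (\<Sum>e\<in>B. R (fst y) e *\<^sub>C e) (snd y)" by (simp only: R[OF y])
    also have "\<dots> = (\<Sum>e\<in>B. r e (R (fst y) e *\<^sub>C snd y))"
      by (simp add: clin_sum[OF r(1)] clin_scale[OF r(1)] clin_scale[OF r(2)])
    finally show ?case using Cons by (simp add: g_def case_prod_beta clin_add[OF r(2)] sum.distrib)
  qed
  \<comment> \<open>For \<open>t\<close>, independence of \<open>B\<close> turns the vanishing sum
    into the vanishing of each \<open>g xs e\<close>; inserting this in the expansion for
    \<open>s\<close> finishes the argument.\<close>
  have "(\<Sum>e\<in>B. t e (g xs e)) = 0"
    using expand[OF cstar_tensorD(1,2)[OF t], of xs] 0 by simp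
  moreover have "\<forall>I f. finite I \<and> \<not> module.dependent scaleC I \<and> (\<Sum>a\<in>I. t a (f a)) = 0 \<longrightarrow> (\<forall>a\<in>I. f a = 0)"
    using t unfolding cstar_tensor_def by blast
  ultimately have "\<forall>e\<in>B. g xs e = 0" using fin B(2) by blast
  then show ?thesis using expand[OF s, of xs] by (simp add: clin_zero[OF s(2)])
qed

section \<open>Isometry of \<alpha> \<otimes> id for the spatial norm\<close>

lemma tensor_sum_map: "tensor_sum t (map (\<lambda>(a, b). (\<alpha> a, b)) xs) = tensor_sum (\<lambda>a. t (\<alpha> a)) xs"
  by (induction xs) auto

lemma clin_precomp: "clin \<alpha> \<Longrightarrow> cstar_tensor t \<Longrightarrow> clin (\<lambda>a. t (\<alpha> a) b)"
  using clin_comp[of "\<lambda>a. t a b" \<alpha>] by (simp add: cstar_tensorD o_def)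

text \<open>The norm of the second tensor product, pulled back along \<alpha> \<otimes> id, is a
  C*-norm on the first algebraic tensor product, so it dominates the least one. The reverse
  inequality is the same statement for the inverse of \<open>\<alpha>\<close>.\<close>

lemma tensor_sum_norm_le:
  fixes t :: "'a::cstar_algebra \<Rightarrow> 'b::cstar_algebra \<Rightarrow> 'c::cstar_algebra"
    and t' :: "'a'::cstar_algebra \<Rightarrow> 'b \<Rightarrow> 'c'::cstar_algebra"
  assumes t: "cstar_tensor t" and t': "cstar_tensor t'" and \<alpha>: "star_iso \<alpha>"
  shows "norm (tensor_sum t xs) \<le> norm (tensor_sum (\<lambda>a. t' (\<alpha> a)) xs)"
proof -
  let ?q = "tensor_sum (\<lambda>a. t' (\<alpha> a))"
  have hom: "star_hom \<alpha>" and b: "bij \<alpha>" using \<alpha> by (auto simp: star_iso_def)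
  note lin = star_hom_clin[OF hom]
  have p: "star_alg_hom tensor_sums (tensor_sum t)"
    using star_alg_hom_tensor_sum[OF t, of id] by (simp add: star_hom_def clin_def)
  have q: "star_alg_hom tensor_sums ?q"
    by (rule star_alg_hom_tensor_sum[OF t' hom])
  \<comment> \<open>Formal differences are needed because \<open>tensor_sum_eq_0\<close> speaks of
    vanishing sums, while well-definedness concerns two sums with equal value.\<close>
  have pd: "tensor_sum t (add tensor_sums xs (scl tensor_sums (- 1) ys)) = tensor_sum t xs - tensor_sum t ys" for xs ys
    by (rule star_alg_hom_diff[OF p closed_tensor_sums]) (simp_all add: tensor_sums_def)
  have qd: "?q (add tensor_sums xs (scl tensor_sums (- 1) ys)) = ?q xs - ?q ys" for xs ys
    by (rule star_alg_hom_diff[OF q closed_tensor_sums]) (simp_all add: tensor_sums_def)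
  have p0q0: "?q xs = 0" if "tensor_sum t xs = 0" for xs
    using t clin_precomp[OF lin t'] cstar_tensorD(2)[OF t'] that by (rule tensor_sum_eq_0)
  \<comment> \<open>Injectivity of \<alpha> \<otimes> id: the relation is moved to the other tensor
    product and \<open>tensor_sum_eq_0\<close> is applied there, with \<open>inv \<alpha>\<close>
    leading back. It makes the pulled-back seminorm definite.\<close>
  have q0p0: "tensor_sum t xs = 0" if "?q xs = 0" for xs
  proof -
    have "clin (inv \<alpha>)" using star_iso_inv[OF \<alpha>] by (simp add: star_iso_def star_hom_def)
    note inv = clin_precomp[OF this t]
    have "tensor_sum t' (map (\<lambda>(a, b). (\<alpha> a, b)) xs) = 0" using that by (simp add: tensor_sum_map)
    then have "tensor_sum (\<lambda>a. t (inv \<alpha> a)) (map (\<lambda>(a, b). (\<alpha> a, b)) xs) = 0"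
      by (rule tensor_sum_eq_0[OF t' inv cstar_tensorD(2)[OF t]])
    then show ?thesis using b by (simp add: tensor_sum_map bij_is_inj)
  qed
  \<comment> \<open>\<alpha> \<otimes> id on the algebraic tensor product, through a chosen
    presentation; \<open>p0q0\<close> makes the value independent of the choice.\<close>
  define h where "h x = ?q (SOME xs. tensor_sum t xs = x)" for x
  have eq: "?q xs = ?q ys" if "tensor_sum t xs = tensor_sum t ys" for xs ys
    using p0q0[of "add tensor_sums xs (scl tensor_sums (- 1) ys)"] that by (simp add: pd qd)
  have h: "h (tensor_sum t xs) = ?q xs" for xs
    unfolding h_def by (rule eq, rule someI[of "\<lambda>ys. tensor_sum t ys = tensor_sum t xs"]) simp
  have carr: "carr (alg_tensor t) = range (tensor_sum t)" using range_tensor_sum[OF t] by simp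
  have P: "tensor_sum t (scl tensor_sums c xs) = c *\<^sub>C tensor_sum t xs"
    "tensor_sum t (mul tensor_sums xs ys) = tensor_sum t xs * tensor_sum t ys"
    "tensor_sum t (str tensor_sums xs) = star (tensor_sum t xs)" for c xs ys
    using p by (auto simp: star_alg_hom_def tensor_sums_def)
  have Q: "?q (scl tensor_sums c xs) = c *\<^sub>C ?q xs" "?q (mul tensor_sums xs ys) = ?q xs * ?q ys"
    "?q (str tensor_sums xs) = star (?q xs)" for c xs ys
    using q by (auto simp: star_alg_hom_def tensor_sums_def)
  have H: "h (tensor_sum t xs + tensor_sum t ys) = ?q xs + ?q ys"
    "h (c *\<^sub>C tensor_sum t xs) = c *\<^sub>C ?q xs"
    "h (tensor_sum t xs * tensor_sum t ys) = ?q xs * ?q ys"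
    "h (star (tensor_sum t xs) * tensor_sum t xs) = star (?q xs) * ?q xs" for c xs ys
    using h[of "xs @ ys"] h[of "scl tensor_sums c xs"] h[of "mul tensor_sums xs ys"]
      h[of "mul tensor_sums (str tensor_sums xs) xs"]
    by (simp_all only: P Q tensor_sum_simps(3))
  have "cstar_seminorm (alg_tensor t) (\<lambda>x. norm (h x))"
    unfolding cstar_seminorm_def carr ball_simps
    by (simp only: alg_tensor_def star_alg.simps H h norm_ge_zero norm_triangle_ineq norm_mult_ineq
        norm_star_mult norm_scaleC) simp
  moreover have "\<forall>x\<in>carr (alg_tensor t). norm (h x) = 0 \<longrightarrow> x = 0"
    unfolding carr using q0p0 by (auto simp: h)
  ultimately have "\<forall>x\<in>carr (alg_tensor t). norm x \<le> norm (h x)"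
    using cstar_tensor_least[OF t] by blast
  then show ?thesis by (metis carr h rangeI)
qed

text \<open>A definite description has the expected properties only once existence and uniqueness
  are known. Minimality used in both directions makes the two evaluations of formal sums equal in
  norm, hence the extension exists; density of elementary tensors makes it unique.\<close>

lemma tensor_map_star_iso:
  fixes t :: "'a::cstar_algebra \<Rightarrow> 'b::cstar_algebra \<Rightarrow> 'c::cstar_algebra"
    and t' :: "'a'::cstar_algebra \<Rightarrow> 'b \<Rightarrow> 'c'::cstar_algebra"
  assumes t: "cstar_tensor t" and t': "cstar_tensor t'" and \<alpha>: "star_iso \<alpha>"
  shows "clin (tensor_map t t' \<alpha> id)" (is ?lin)
    and "continuous_on UNIV (tensor_map t t' \<alpha> id)" (is ?cont)
    and "tensor_map t t' \<alpha> id (t a b) = t' (\<alpha> a) b" (is ?val)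
proof -
  let ?q = "tensor_sum (\<lambda>a. t' (\<alpha> a))"
  have hom: "star_hom \<alpha>" and b: "bij \<alpha>" using \<alpha> by (auto simp: star_iso_def)
  have p: "star_alg_hom tensor_sums (tensor_sum t)"
    using star_alg_hom_tensor_sum[OF t, of id] by (simp add: star_hom_def clin_def)
  have q: "star_alg_hom tensor_sums ?q"
    by (rule star_alg_hom_tensor_sum[OF t' hom])
  have carr: "carr tensor_sums = UNIV" by (simp add: tensor_sums_def)
  have "norm (tensor_sum t xs) = norm (?q xs)" for xs
  proof (rule antisym)
    have "norm (tensor_sum t' (map (\<lambda>(a, b). (\<alpha> a, b)) xs)) \<le>
        norm (tensor_sum (\<lambda>a. t (inv \<alpha> a)) (map (\<lambda>(a, b). (\<alpha> a, b)) xs))"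
      by (rule tensor_sum_norm_le[OF t' t star_iso_inv[OF \<alpha>]])
    then show "norm (?q xs) \<le> norm (tensor_sum t xs)"
      using b by (simp add: tensor_sum_map bij_is_inj)
  qed (rule tensor_sum_norm_le[OF t t' \<alpha>])
  moreover have dense: "closure (range (tensor_sum t)) = UNIV"
    using t by (simp add: range_tensor_sum cstar_tensor_def)
  moreover have "closure (range ?q) = UNIV"
  proof -
    \<comment> \<open>Surjectivity of \<open>\<alpha>\<close> enters here: left factors are lifted
      through \<open>inv \<alpha>\<close>.\<close>
    have "tensor_sum t' xs \<in> range ?q" for xs
    proof -
      have "?q (map (\<lambda>(a, b). (inv \<alpha> a, b)) xs) = tensor_sum t' xs"
        using b by (simp add: tensor_sum_map bij_is_surj surj_f_inv_f)
      then show ?thesis by (metis rangeI)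
    qed
    then have "range (tensor_sum t') \<subseteq> range ?q" by blast
    moreover have "closure (range (tensor_sum t')) = UNIV"
      using t' by (simp add: range_tensor_sum cstar_tensor_def)
    ultimately show ?thesis by (metis closure_mono top.extremum_uniqueI)
  qed
  ultimately obtain h where h: "star_iso h" "\<And>xs. h (tensor_sum t xs) = ?q xs"
    using isometric_star_iso[OF closed_tensor_sums p q] carr by (metis UNIV_I)
  \<comment> \<open>A one-entry list is an elementary tensor.\<close>
  have hp: "clin h \<and> continuous_on UNIV h \<and> (\<forall>a b. h (t a b) = t' (\<alpha> a) (id b))"
    using h(1) h(2)[of "[(_, _)]"] by (auto simp: star_iso_def star_hom_clin star_hom_continuous)
  have "tensor_map t t' \<alpha> id = h"
    unfolding tensor_map_def
  proof (rule the_equality[where P = "\<lambda>h. clin h \<and> continuous_on UNIV h \<and> (\<forall>a b. h (t a b) = t' (\<alpha> a) (id b))", OF hp])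
    fix g assume g: "clin g \<and> continuous_on UNIV g \<and> (\<forall>a b. g (t a b) = t' (\<alpha> a) (id b))"
    show "g = h"
    proof (rule clin_continuous_eq)
      show "closure (cspan {t a b |a b. True}) = UNIV"
        using dense by (simp add: range_tensor_sum[OF t] alg_tensor_def)
    qed (use g hp in auto)
  qed
  then show ?lin ?cont ?val using hp by auto
qed

section \<open>Operators on sequence spaces\<close>

lemma ell2_supp: "f \<in> ell2 H \<Longrightarrow> w \<notin> ix H \<Longrightarrow> f w = 0"
  by (simp add: ell2_def)

lemma ell2_summable: "f \<in> ell2 H \<Longrightarrow> (\<lambda>w. (cmod (f w))\<^sup>2) summable_on UNIV"
  by (simp add: ell2_def)

lemma nrm_nonneg [simp]: "0 \<le> nrm f"
  by (simp add: nrm_def infsum_nonneg)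

lemma ell2_L2_set_le:
  assumes "f \<in> ell2 H" "finite A"
  shows "L2_set (\<lambda>w. cmod (f w)) A \<le> nrm f"
  unfolding L2_set_def nrm_def
  using finite_sum_le_infsum[OF ell2_summable[OF assms(1)] assms(2)] by simp

text \<open>Square-summability and norm bounds are tested on finite index sets, where
  \<open>L2_set\<close> provides the triangle and Cauchy-Schwarz inequalities.\<close>

lemma ell2_L2_setI:
  assumes supp: "\<And>w. w \<notin> ix H \<Longrightarrow> f w = 0"
    and le: "\<And>A. finite A \<Longrightarrow> L2_set (\<lambda>w. cmod (f w)) A \<le> B"
  shows "f \<in> ell2 H" "nrm f \<le> B"
proof -
  have B: "0 \<le> B" using le[of "{}"] by simp
  have *: "(\<Sum>w\<in>A. (cmod (f w))\<^sup>2) \<le> B\<^sup>2" if "finite A" for A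
    using le[OF that] unfolding L2_set_def by (metis B real_sqrt_le_iff real_sqrt_abs abs_of_nonneg)
  then have s: "(\<lambda>w. (cmod (f w))\<^sup>2) summable_on UNIV"
    by (intro nonneg_bdd_above_summable_on bdd_aboveI2) auto
  then show "f \<in> ell2 H" using supp by (simp add: ell2_def)
  have "(\<Sum>\<^sub>\<infinity>w. (cmod (f w))\<^sup>2) \<le> B\<^sup>2"
    using * by (intro infsum_le_finite_sums[OF s]) auto
  then show "nrm f \<le> B" using B by (simp add: nrm_def real_le_lsqrt)
qed

lemma ell2_zero [simp]: "(\<lambda>_. 0) \<in> ell2 H"
  by (simp add: ell2_def)

lemma ell2_add:
  assumes f: "f \<in> ell2 H" and g: "g \<in> ell2 H"
  shows "(\<lambda>w. f w + g w) \<in> ell2 H" "nrm (\<lambda>w. f w + g w) \<le> nrm f + nrm g"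
proof -
  have "L2_set (\<lambda>w. cmod (f w + g w)) A \<le> nrm f + nrm g" if "finite A" for A
  proof -
    have "L2_set (\<lambda>w. cmod (f w + g w)) A \<le> L2_set (\<lambda>w. cmod (f w) + cmod (g w)) A"
      by (intro L2_set_mono norm_triangle_ineq) simp_all
    also have "\<dots> \<le> L2_set (\<lambda>w. cmod (f w)) A + L2_set (\<lambda>w. cmod (g w)) A"
      by (rule L2_set_triangle_ineq)
    also have "\<dots> \<le> nrm f + nrm g"
      by (intro add_mono ell2_L2_set_le[OF f that] ell2_L2_set_le[OF g that])
    finally show ?thesis .
  qed
  moreover have "f w + g w = 0" if "w \<notin> ix H" for w
    using that f g by (simp add: ell2_supp)
  ultimately show "(\<lambda>w. f w + g w) \<in> ell2 H" "nrm (\<lambda>w. f w + g w) \<le> nrm f + nrm g"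
    by (intro ell2_L2_setI; blast)+
qed

lemma ell2_scale:
  assumes "f \<in> ell2 H"
  shows "(\<lambda>w. c * f w) \<in> ell2 H"
  using assms by (auto simp: ell2_def norm_mult power_mult_distrib intro: summable_on_cmult_right)

lemma nrm_scale: "nrm (\<lambda>w. c * f w) = cmod c * nrm f"
  by (simp add: nrm_def norm_mult power_mult_distrib infsum_cmult_right' real_sqrt_mult)

lemma ell2_diff: "f \<in> ell2 H \<Longrightarrow> g \<in> ell2 H \<Longrightarrow> (\<lambda>w. f w - g w) \<in> ell2 H"
  using ell2_add(1)[OF _ ell2_scale[of g H "- 1"], of f] by simp

lemma ell2_sum: "(\<And>a. a \<in> A \<Longrightarrow> f a \<in> ell2 H) \<Longrightarrow> (\<lambda>w. \<Sum>a\<in>A. f a w) \<in> ell2 H"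
  by (induction A rule: infinite_finite_induct) (auto intro: ell2_add(1))

lemma ell2_cnj: "f \<in> ell2 H \<Longrightarrow> (\<lambda>w. cnj (f w)) \<in> ell2 H"
  by (simp add: ell2_def)

lemma nrm_cnj [simp]: "nrm (\<lambda>w. cnj (f w)) = nrm f"
  by (simp add: nrm_def)

lemma ket_ell2: "w \<in> ix H \<Longrightarrow> ket w \<in> ell2 H"
  by (auto simp: ell2_def ket_def intro!: finite_nonzero_values_imp_summable_on)

lemma ell2_restrict:
  assumes "finite A" "A \<subseteq> ix H"
  shows "(\<lambda>w. if w \<in> A then f w else 0) \<in> ell2 H"
    "(\<lambda>w. if w \<in> A then f w else 0) = (\<lambda>w. \<Sum>v\<in>A. f v * ket v w)"
    "nrm (\<lambda>w. if w \<in> A then f w else 0) = L2_set (\<lambda>w. cmod (f w)) A"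
proof -
  show *: "(\<lambda>w. if w \<in> A then f w else 0) = (\<lambda>w. \<Sum>v\<in>A. f v * ket v w)"
    using assms(1) by (auto simp: ket_def fun_eq_iff if_distrib sum.delta cong: if_cong)
  show "(\<lambda>w. if w \<in> A then f w else 0) \<in> ell2 H"
    unfolding * using assms by (intro ell2_sum ell2_scale ket_ell2) auto
  have "(\<Sum>\<^sub>\<infinity>w. (cmod (if w \<in> A then f w else 0))\<^sup>2) = (\<Sum>\<^sub>\<infinity>w\<in>A. (cmod (f w))\<^sup>2)"
    by (rule infsum_cong_neutral) auto
  then show "nrm (\<lambda>w. if w \<in> A then f w else 0) = L2_set (\<lambda>w. cmod (f w)) A"
    using assms(1) by (simp add: nrm_def L2_set_def)
qed

section \<open>Inner products of square-summable functions\<close>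

lemma ip_summable:
  assumes f: "f \<in> ell2 H" and g: "g \<in> ell2 H"
  shows "(\<lambda>w. cmod (cnj (f w) * g w)) summable_on A" "cmod (ip f g) \<le> nrm f * nrm g"
proof -
  have *: "(\<Sum>w\<in>A. cmod (cnj (f w) * g w)) \<le> nrm f * nrm g" if "finite A" for A
  proof -
    have "(\<Sum>w\<in>A. cmod (cnj (f w) * g w)) \<le> L2_set (\<lambda>w. cmod (f w)) A * L2_set (\<lambda>w. cmod (g w)) A"
      using L2_set_mult_ineq[of "\<lambda>w. cmod (f w)" "\<lambda>w. cmod (g w)" A] by (simp add: norm_mult)
    also have "\<dots> \<le> nrm f * nrm g"
      by (intro mult_mono ell2_L2_set_le[OF f that] ell2_L2_set_le[OF g that]) simp_all
    finally show ?thesis .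
  qed
  then show s: "(\<lambda>w. cmod (cnj (f w) * g w)) summable_on A" for A
    by (intro nonneg_bdd_above_summable_on bdd_aboveI2) auto
  have "cmod (ip f g) \<le> (\<Sum>\<^sub>\<infinity>w. cmod (cnj (f w) * g w))"
    unfolding ip_def by (rule norm_infsum_bound[OF s])
  also have "\<dots> \<le> nrm f * nrm g"
    using * by (intro infsum_le_finite_sums[OF s]) auto
  finally show "cmod (ip f g) \<le> nrm f * nrm g" .
qed

lemma ip_add_left:
  assumes "f \<in> ell2 H" "g \<in> ell2 H" "h \<in> ell2 H"
  shows "ip (\<lambda>w. f w + g w) h = ip f h + ip g h"
  using infsum_add[OF abs_summable_summable[OF ip_summable(1)[OF assms(1,3)]]
      abs_summable_summable[OF ip_summable(1)[OF assms(2,3)]], of UNIV]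
  by (simp add: ip_def distrib_right)

lemma ip_scale_left: "ip (\<lambda>w. c * f w) g = cnj c * ip f g"
  by (simp add: ip_def mult.assoc infsum_cmult_right')

lemma ip_diff_left:
  assumes "f \<in> ell2 H" "g \<in> ell2 H" "h \<in> ell2 H"
  shows "ip (\<lambda>w. f w - g w) h = ip f h - ip g h"
  using ip_add_left[OF assms(1) ell2_scale[OF assms(2)] assms(3), of "- 1"] ip_scale_left[of "- 1" g h]
  by simp

lemma ip_zero_left [simp]: "ip (\<lambda>_. 0) g = 0"
  by (simp add: ip_def)

lemma ip_sum_left:
  assumes "\<And>a. a \<in> A \<Longrightarrow> f a \<in> ell2 H" "h \<in> ell2 H"
  shows "ip (\<lambda>w. \<Sum>a\<in>A. f a w) h = (\<Sum>a\<in>A. ip (f a) h)"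
  using assms(1)
  by (induction A rule: infinite_finite_induct) (auto simp: ip_add_left[where H = H] ell2_sum assms(2))

lemma ip_cnj: "ip (\<lambda>w. cnj (f w)) (\<lambda>w. cnj (g w)) = ip g f"
  by (simp add: ip_def mult.commute)

lemma cnj_ip: "cnj (ip f g) = ip g f"
  by (simp add: ip_def mult.commute flip: infsum_cnj)

lemma ip_ket [simp]: "ip (ket w) f = f w"
proof -
  have "ip (ket w) f = (\<Sum>\<^sub>\<infinity>v\<in>{w}. f v)"
    unfolding ip_def by (rule infsum_cong_neutral) (auto simp: ket_def)
  then show ?thesis by simp
qed

section \<open>Bounded operators and their adjoints\<close>

lemma bop_add: "T \<in> bop H K \<Longrightarrow> f \<in> ell2 H \<Longrightarrow> g \<in> ell2 H \<Longrightarrow> T (\<lambda>w. f w + g w) = (\<lambda>w. T f w + T g w)"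
  by (simp add: bop_def)

lemma bop_zero: "T \<in> bop H K \<Longrightarrow> T (\<lambda>_. 0) = (\<lambda>_. 0)"
  using bop_scale[of T H K "\<lambda>_. 0" 0] by simp

lemma bop_outside: "T \<in> bop H K \<Longrightarrow> f \<notin> ell2 H \<Longrightarrow> T f = (\<lambda>_. 0)"
  by (simp add: bop_def)

lemma bop_in_ell2: "T \<in> bop H K \<Longrightarrow> T f \<in> ell2 K"
  by (cases "f \<in> ell2 H") (simp_all add: bop_ell2 bop_outside)

lemma bop_diff:
  assumes "T \<in> bop H K" "f \<in> ell2 H" "g \<in> ell2 H"
  shows "T (\<lambda>w. f w - g w) = (\<lambda>w. T f w - T g w)"
  using bop_add[OF assms(1,2) ell2_scale[OF assms(3), of "- 1"]] bop_scale[OF assms(1,3), of "- 1"]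
  by simp

lemma bop_sum:
  assumes "T \<in> bop H K" "\<And>a. a \<in> A \<Longrightarrow> f a \<in> ell2 H"
  shows "T (\<lambda>w. \<Sum>a\<in>A. f a w) = (\<lambda>w. \<Sum>a\<in>A. T (f a) w)"
  using assms(2)
  by (induction A rule: infinite_finite_induct)
     (auto simp: bop_zero[OF assms(1)] bop_add[OF assms(1)] ell2_sum)

lemma bop_bound:
  assumes "T \<in> bop H K"
  obtains C where "0 \<le> C" "\<And>f. f \<in> ell2 H \<Longrightarrow> nrm (T f) \<le> C * nrm f"
proof -
  obtain C where C: "\<And>f. f \<in> ell2 H \<Longrightarrow> nrm (T f) \<le> C * nrm f"
    using assms unfolding bop_def by blast
  \<comment> \<open>The constant in \<open>bop\<close> is allowed to be negative when the space is
    zero, hence the absolute value.\<close>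
  have "nrm (T f) \<le> \<bar>C\<bar> * nrm f" if "f \<in> ell2 H" for f
    using C[OF that] mult_right_mono[OF abs_ge_self[of C] nrm_nonneg[of f]] by linarith
  then show thesis using that[of "\<bar>C\<bar>"] by simp
qed

lemma bop_comp:
  assumes T: "T \<in> bop H K" and S: "S \<in> bop K L"
  shows "S \<circ> T \<in> bop H L"
proof -
  obtain C where C: "0 \<le> C" "\<And>f. f \<in> ell2 H \<Longrightarrow> nrm (T f) \<le> C * nrm f"
    by (rule bop_bound[OF T]) iprover
  obtain D where D: "0 \<le> D" "\<And>f. f \<in> ell2 K \<Longrightarrow> nrm (S f) \<le> D * nrm f"
    by (rule bop_bound[OF S]) iprover
  have bound: "nrm (S (T f)) \<le> D * C * nrm f" if "f \<in> ell2 H" for f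
    using D(2)[OF bop_ell2[OF T that]] mult_left_mono[OF C(2)[OF that] D(1)] by (simp add: mult.assoc)
  show ?thesis
    unfolding bop_def o_def
  proof (intro CollectI conjI allI ballI impI)
    show "\<exists>C. \<forall>f\<in>ell2 H. S (T f) \<in> ell2 L \<and> nrm (S (T f)) \<le> C * nrm f"
      using bound bop_in_ell2[OF S] by blast
  qed (simp_all only: bop_add[OF T] bop_scale[OF T] bop_in_ell2[OF T] bop_add[OF S] bop_scale[OF S]
      bop_outside[OF T] bop_zero[OF S] not_False_eq_True)
qed

text \<open>A bounded operator is determined by its values on kets: truncations of \<open>f\<close>
  to finite sets converge to \<open>f\<close> in norm, and boundedness controls the error in the
  inner product by the norm of the tail.\<close>

lemma bop_ip_has_sum:
  assumes T: "T \<in> bop H K" and f: "f \<in> ell2 H" and g: "g \<in> ell2 K"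
  shows "((\<lambda>w. cnj (f w) * ip (T (ket w)) g) has_sum ip (T f) g) (ix H)"
proof -
  obtain C where C: "0 \<le> C" "\<And>f. f \<in> ell2 H \<Longrightarrow> nrm (T f) \<le> C * nrm f"
    by (rule bop_bound[OF T]) iprover
  let ?S = "\<lambda>A. \<Sum>w\<in>A. cnj (f w) * ip (T (ket w)) g"
  \<comment> \<open>The squared norm of the part of \<open>f\<close> outside
    \<open>A\<close>.\<close>
  let ?N = "\<lambda>A. (\<Sum>\<^sub>\<infinity>w. (cmod (f w))\<^sup>2) - (\<Sum>w\<in>A. (cmod (f w))\<^sup>2)"
  have bound: "cmod (?S A - ip (T f) g) \<le> C * sqrt (?N A) * nrm g" if A: "finite A" "A \<subseteq> ix H" for A
  proof -
    define fA where "fA w = (if w \<in> A then f w else 0)" for w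
    have fA: "fA \<in> ell2 H" "fA = (\<lambda>w. \<Sum>v\<in>A. f v * ket v w)"
      unfolding fA_def using ell2_restrict(1,2)[OF A] by blast+
    have kets: "ket v \<in> ell2 H" if "v \<in> A" for v using that A by (auto intro: ket_ell2)
    have "T fA = (\<lambda>w. \<Sum>v\<in>A. f v * T (ket v) w)"
      unfolding fA(2) using kets by (subst bop_sum[OF T]) (auto intro: ell2_scale simp: bop_scale[OF T])
    then have "ip (T fA) g = ?S A"
      using kets by (simp add: ip_sum_left[OF _ g] ell2_scale bop_in_ell2[OF T] ip_scale_left)
    then have "cmod (?S A - ip (T f) g) = cmod (ip (T (\<lambda>w. fA w - f w)) g)"
      using T f fA(1) g by (simp add: bop_diff ip_diff_left[where H = K] bop_in_ell2)
    also have "\<dots> \<le> nrm (T (\<lambda>w. fA w - f w)) * nrm g"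
      by (rule ip_summable(2)[OF bop_in_ell2[OF T] g])
    also have "\<dots> \<le> C * nrm (\<lambda>w. fA w - f w) * nrm g"
      by (intro mult_right_mono C(2)[OF ell2_diff[OF fA(1) f]]) simp
    also have "nrm (\<lambda>w. fA w - f w) = sqrt (?N A)"
    proof -
      have "(\<Sum>\<^sub>\<infinity>w. (cmod (fA w - f w))\<^sup>2) = (\<Sum>\<^sub>\<infinity>w\<in>UNIV - A. (cmod (f w))\<^sup>2)"
        by (rule infsum_cong_neutral) (auto simp: fA_def)
      also have "\<dots> = ?N A"
        using infsum_Diff[OF ell2_summable[OF f], of A] A(1) by simp
      finally show ?thesis by (simp add: nrm_def)
    qed
    finally show ?thesis .
  qed
  have "((\<lambda>w. (cmod (f w))\<^sup>2) has_sum (\<Sum>\<^sub>\<infinity>w. (cmod (f w))\<^sup>2)) (ix H)"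
  proof -
    have "((\<lambda>w. (cmod (f w))\<^sup>2) has_sum (\<Sum>\<^sub>\<infinity>w. (cmod (f w))\<^sup>2)) UNIV"
      using ell2_summable[OF f] by simp
    then show ?thesis
      by (subst has_sum_cong_neutral[where T = UNIV and g = "\<lambda>w. (cmod (f w))\<^sup>2"]) (auto simp: ell2_supp[OF f])
  qed
  then have "(?N \<longlongrightarrow> (\<Sum>\<^sub>\<infinity>w. (cmod (f w))\<^sup>2) - (\<Sum>\<^sub>\<infinity>w. (cmod (f w))\<^sup>2)) (finite_subsets_at_top (ix H))"
    unfolding has_sum_def by (rule tendsto_diff[OF tendsto_const])
  then have "((\<lambda>A. C * sqrt (?N A) * nrm g) \<longlongrightarrow> C * sqrt 0 * nrm g) (finite_subsets_at_top (ix H))"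
    by (intro tendsto_intros) simp
  then have "((\<lambda>A. C * sqrt (?N A) * nrm g) \<longlongrightarrow> 0) (finite_subsets_at_top (ix H))" by simp
  then have "((\<lambda>A. ?S A - ip (T f) g) \<longlongrightarrow> 0) (finite_subsets_at_top (ix H))"
    by (rule Lim_null_comparison[rotated]) (auto intro!: eventually_finite_subsets_at_top_weakI bound)
  then show ?thesis unfolding has_sum_def by (simp add: LIM_zero_iff)
qed

text \<open>The adjoint is written down by coordinates, the one of \<open>T' g\<close> at
  \<open>w\<close> being the inner product of \<open>T (ket w)\<close> with \<open>g\<close>. What
  needs proof is that these coordinates are square-summable with a bound linear in the norm of
  \<open>g\<close>.\<close>

lemma adj_exists:
  assumes T: "T \<in> bop H K"
  obtains T' where "T' \<in> bop K H" "\<And>f g. f \<in> ell2 H \<Longrightarrow> g \<in> ell2 K \<Longrightarrow> ip (T f) g = ip f (T' g)"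
proof -
  obtain C where C: "0 \<le> C" "\<And>f. f \<in> ell2 H \<Longrightarrow> nrm (T f) \<le> C * nrm f"
    by (rule bop_bound[OF T]) iprover
  define T' where "T' g = (if g \<in> ell2 K then \<lambda>w. if w \<in> ix H then ip (T (ket w)) g else 0 else (\<lambda>_. 0))" for g
  have val: "T' g w = ip (T (ket w)) g" if "g \<in> ell2 K" "w \<in> ix H" for g w
    using that by (simp add: T'_def)
  have supp: "T' g w = 0" if "w \<notin> ix H" for g w using that by (simp add: T'_def)
  have "L2_set (\<lambda>w. cmod (T' g w)) A \<le> C * nrm g" if g: "g \<in> ell2 K" and A: "finite A" for g A
  proof -
    \<comment> \<open>\<open>?f\<close> is \<open>T' g\<close> truncated to a finite set and
      \<open>?L\<close> its norm. Testing \<open>T\<close> on \<open>?f\<close> gives exactly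
      \<open>?L\<close> squared, which boundedness estimates by C ?L times the norm of
      \<open>g\<close>; one factor \<open>?L\<close> cancels.\<close>
    let ?A = "A \<inter> ix H" and ?f = "\<lambda>w. if w \<in> A \<inter> ix H then T' g w else 0"
    let ?L = "L2_set (\<lambda>w. cmod (T' g w)) ?A"
    have eq: "L2_set (\<lambda>w. cmod (T' g w)) A = ?L"
      unfolding L2_set_def using A supp by (intro arg_cong[of _ _ sqrt] sum.mono_neutral_right) auto
    have f: "?f \<in> ell2 H" "nrm ?f = ?L"
      using A ell2_restrict(1,3)[of ?A H "T' g"] by simp_all
    have "((\<lambda>w. cnj (?f w) * ip (T (ket w)) g) has_sum ip (T ?f) g) (ix H)"
      by (rule bop_ip_has_sum[OF T f(1) g])
    moreover have "((\<lambda>w. cnj (T' g w) * T' g w) has_sum (\<Sum>w\<in>?A. cnj (T' g w) * T' g w)) ?A"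
      using A by (intro has_sum_finite) simp
    then have "((\<lambda>w. cnj (?f w) * ip (T (ket w)) g) has_sum (\<Sum>w\<in>?A. cnj (T' g w) * T' g w)) (ix H)"
      by (rule has_sum_cong_neutral[THEN iffD1, rotated 3]) (auto simp: val[OF g])
    ultimately have "ip (T ?f) g = (\<Sum>w\<in>?A. cnj (T' g w) * T' g w)" by (rule has_sum_unique)
    also have "\<dots> = complex_of_real (?L\<^sup>2)"
    proof -
      have "cnj z * z = complex_of_real ((cmod z)\<^sup>2)" for z
        using complex_norm_square[of z] by (simp add: mult.commute)
      then show ?thesis by (simp add: L2_set_def sum_nonneg del: of_real_power)
    qed
    finally have "?L\<^sup>2 = cmod (ip (T ?f) g)" by (simp only: norm_of_real) simp
    also have "\<dots> \<le> nrm (T ?f) * nrm g" by (rule ip_summable(2)[OF bop_in_ell2[OF T] g])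
    also have "\<dots> \<le> C * ?L * nrm g" using C(2)[OF f(1)] f(2) by (intro mult_right_mono) simp_all
    finally have "?L * ?L \<le> (C * nrm g) * ?L" by (simp add: power2_eq_square mult_ac)
    then have "?L \<le> C * nrm g"
      using C(1) by (cases "?L = 0") (auto dest: mult_right_le_imp_le simp: less_le)
    then show ?thesis by (simp add: eq)
  qed
  then have bound: "T' g \<in> ell2 H" "nrm (T' g) \<le> C * nrm g" if "g \<in> ell2 K" for g
    using that supp by (intro ell2_L2_setI[where B = "C * nrm g"]; blast)+
  have add: "T' (\<lambda>w. f w + g w) = (\<lambda>w. T' f w + T' g w)" if "f \<in> ell2 K" "g \<in> ell2 K" for f g
  proof -
    have "ip (T (ket w)) (\<lambda>w. f w + g w) = ip (T (ket w)) f + ip (T (ket w)) g" for w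
      using ip_add_left[OF that bop_in_ell2[OF T], of "ket w"] cnj_ip by (metis complex_cnj_add)
    then show ?thesis using that ell2_add(1)[OF that] by (auto simp: T'_def)
  qed
  have scale: "T' (\<lambda>w. c * g w) = (\<lambda>w. c * T' g w)" if "g \<in> ell2 K" for c g
  proof -
    have "ip (T (ket w)) (\<lambda>w. c * g w) = c * ip (T (ket w)) g" for w
      using ip_scale_left[of c g "T (ket w)"] cnj_ip by (metis complex_cnj_mult complex_cnj_cnj)
    then show ?thesis using that ell2_scale[OF that] by (auto simp: T'_def)
  qed
  have outside: "T' g = (\<lambda>_. 0)" if "g \<notin> ell2 K" for g using that by (simp add: T'_def)
  have "T' \<in> bop K H" unfolding bop_def using add scale bound outside by blast
  moreover have "ip (T f) g = ip f (T' g)" if "f \<in> ell2 H" "g \<in> ell2 K" for f g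
  proof -
    have "ip (T f) g = (\<Sum>\<^sub>\<infinity>w\<in>ix H. cnj (f w) * ip (T (ket w)) g)"
      using bop_ip_has_sum[OF T that] by (simp add: infsumI)
    also have "\<dots> = ip f (T' g)"
      unfolding ip_def[of f] using that by (intro infsum_cong_neutral) (auto simp: ell2_supp val)
    finally show ?thesis .
  qed
  ultimately show thesis using that by blast
qed

lemma ell2_eqI:
  assumes "f \<in> ell2 H" "g \<in> ell2 H" "\<And>w. w \<in> ix H \<Longrightarrow> f w = g w"
  shows "f = g"
  using assms by (metis ell2_supp ext)

text \<open>For the definite description \<open>adj\<close>, kets determine a candidate on
  \<open>ell2 K\<close> coordinate by coordinate, and the convention of extension by zero fixes it
  elsewhere.\<close>

lemma
  assumes T: "T \<in> bop H K"
  shows adj_bop: "adj H K T \<in> bop K H"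
    and ip_adj: "f \<in> ell2 H \<Longrightarrow> g \<in> ell2 K \<Longrightarrow> ip (T f) g = ip f (adj H K T g)"
proof -
  let ?P = "\<lambda>T'. T' \<in> bop K H \<and> (\<forall>f\<in>ell2 H. \<forall>g\<in>ell2 K. ip (T f) g = ip f (T' g))"
  obtain T' where T': "?P T'" using adj_exists[OF T] by metis
  have "?P (adj H K T)"
    unfolding adj_def
  proof (rule theI[of ?P, OF T'])
    fix S assume S: "?P S"
    show "S = T'"
    proof
      fix g
      show "S g = T' g"
      proof (cases "g \<in> ell2 K")
        case True
        have "S g w = T' g w" if "w \<in> ix H" for w
          using S T' True ket_ell2[OF that] ip_ket[of w] by metis
        then show ?thesis using S T' by (intro ell2_eqI bop_in_ell2) auto
      next
        case False
        then show ?thesis using S T' bop_outside[of S K H g] bop_outside[of T' K H g] by simp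
      qed
    qed
  qed
  then show "adj H K T \<in> bop K H" "f \<in> ell2 H \<Longrightarrow> g \<in> ell2 K \<Longrightarrow> ip (T f) g = ip f (adj H K T g)"
    by auto
qed

lemma unitary_opD:
  assumes "unitary_op H K V"
  shows "V \<in> bop H K" "f \<in> ell2 H \<Longrightarrow> adj H K V (V f) = f" "g \<in> ell2 K \<Longrightarrow> V (adj H K V g) = g"
  using assms by (auto simp: unitary_op_def fun_eq_iff idop_def)

lemma unitary_op_ip:
  assumes "unitary_op H K V" "f \<in> ell2 H" "g \<in> ell2 H"
  shows "ip (V f) (V g) = ip f g"
  using ip_adj[OF unitary_opD(1)[OF assms(1)] assms(2), of "V g"] assms
  by (simp add: unitary_opD bop_in_ell2[OF unitary_opD(1)])

lemma isometricD:
  assumes "isometric H K V"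
  shows "V \<in> bop H K" "f \<in> ell2 H \<Longrightarrow> adj H K V (V f) = f"
  using assms by (auto simp: isometric_def fun_eq_iff idop_def)

text \<open>Conjugating the values of an operator exchanges linear and antilinear without changing
  norms, so facts about \<open>bop\<close> carry over to \<open>abop\<close>.\<close>

lemma abop_iff_bop: "T \<in> abop H K \<longleftrightarrow> (\<lambda>f w. cnj (T f w)) \<in> bop H K"
proof -
  have add: "((\<lambda>w. cnj (p w)) = (\<lambda>w. cnj (q w) + cnj (r w))) = (p = (\<lambda>w. q w + r w))" for p q r :: "'b vct"
    unfolding fun_eq_iff complex_cnj_add[symmetric] complex_cnj_cancel_iff ..
  have "cnj x = c * cnj y \<longleftrightarrow> x = cnj c * y" for c x y
    by (metis complex_cnj_cnj complex_cnj_mult)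
  then have scale: "((\<lambda>w. cnj (p w)) = (\<lambda>w. c * cnj (q w))) = (p = (\<lambda>w. cnj c * q w))" for c and p q :: "'b vct"
    unfolding fun_eq_iff by simp
  have zero: "((\<lambda>w. cnj (p w)) = (\<lambda>_. 0)) = (p = (\<lambda>_. 0))" for p :: "'b vct"
    by (simp add: fun_eq_iff)
  have ell2: "((\<lambda>w. cnj (f w)) \<in> ell2 L) = (f \<in> ell2 L)" for f :: "'b vct" and L
    using ell2_cnj[of f L] ell2_cnj[of "\<lambda>w. cnj (f w)" L] by auto
  show ?thesis
    unfolding abop_def bop_def mem_Collect_eq ell2 nrm_cnj add scale zero ..
qed

lemma abop_in_ell2: "T \<in> abop H K \<Longrightarrow> T f \<in> ell2 K"
  using bop_in_ell2[of "\<lambda>f w. cnj (T f w)" H K f] ell2_cnj[of "\<lambda>w. cnj (T f w)" K]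
  by (simp add: abop_iff_bop)

lemma abop_add: "T \<in> abop H K \<Longrightarrow> f \<in> ell2 H \<Longrightarrow> g \<in> ell2 H \<Longrightarrow> T (\<lambda>w. f w + g w) = (\<lambda>w. T f w + T g w)"
  by (simp add: abop_def)

lemma abop_sum:
  assumes "T \<in> abop H K" "\<And>a. a \<in> A \<Longrightarrow> f a \<in> ell2 H"
  shows "T (\<lambda>w. \<Sum>a\<in>A. f a w) = (\<lambda>w. \<Sum>a\<in>A. T (f a) w)"
proof -
  have "(\<lambda>w. cnj (T (\<lambda>w. \<Sum>a\<in>A. f a w) w)) = (\<lambda>w. \<Sum>a\<in>A. cnj (T (f a) w))"
    using assms bop_sum[of "\<lambda>f w. cnj (T f w)" H K A f] by (simp add: abop_iff_bop)
  then show ?thesis by (simp add: fun_eq_iff flip: cnj_sum)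
qed

text \<open>\<open>S\<close> is only required to agree with a member of \<open>abop\<close> on
  \<open>ell2 H\<close>, because it will be an inverse given by \<open>the_inv_into\<close>, which
  is unspecified elsewhere. The antilinear adjoint is the linear adjoint of the conjugated operator,
  applied to conjugated vectors.\<close>

lemma aadj_abop:
  fixes T :: "('i, 'j) opr"
  assumes T: "T \<in> abop H K" and eq: "\<And>f. f \<in> ell2 H \<Longrightarrow> S f = T f"
  shows "aadj H K S \<in> abop K H"
proof -
  let ?B = "\<lambda>f w. cnj (T f w)"
  let ?P = "\<lambda>T'. T' \<in> abop K H \<and> (\<forall>f\<in>ell2 H. \<forall>g\<in>ell2 K. ip (S f) g = ip (T' g) f)"
  have B: "?B \<in> bop H K" using T by (simp add: abop_iff_bop)
  define T' where "T' g = adj H K ?B (\<lambda>w. cnj (g w))" for g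
  have cnj_iff: "(\<lambda>w. cnj (f w)) \<in> ell2 L \<longleftrightarrow> f \<in> ell2 L" for f :: "'z vct" and L
    using ell2_cnj[of f L] ell2_cnj[of "\<lambda>w. cnj (f w)" L] by auto
  note A = adj_bop[OF B]
  obtain C where C: "0 \<le> C" "\<And>f. f \<in> ell2 K \<Longrightarrow> nrm (adj H K ?B f) \<le> C * nrm f"
    by (rule bop_bound[OF A]) iprover
  have "T' \<in> abop K H"
    unfolding abop_def T'_def
  proof (intro CollectI conjI allI ballI impI)
    show "\<exists>C. \<forall>f\<in>ell2 K. adj H K ?B (\<lambda>w. cnj (f w)) \<in> ell2 H \<and> nrm (adj H K ?B (\<lambda>w. cnj (f w))) \<le> C * nrm f"
      using C(2)[OF ell2_cnj] bop_in_ell2[OF A] by (intro exI[of _ C]) simp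
  qed (simp_all add: bop_add[OF A ell2_cnj ell2_cnj] bop_scale[OF A ell2_cnj] bop_outside[OF A] cnj_iff)
  moreover have "ip (S f) g = ip (T' g) f" if "f \<in> ell2 H" "g \<in> ell2 K" for f g
  proof -
    have "ip (S f) g = cnj (ip (?B f) (\<lambda>w. cnj (g w)))"
      by (simp add: eq[OF that(1)] ip_cnj cnj_ip)
    also have "\<dots> = ip (T' g) f"
      using ip_adj[OF B that(1) ell2_cnj[OF that(2)]] by (simp add: T'_def cnj_ip)
    finally show ?thesis .
  qed
  ultimately have T': "?P T'" by blast
  have "?P (aadj H K S)"
    unfolding aadj_def
  proof (rule theI[of ?P, OF T'])
    fix R assume R: "?P R"
    show "R = T'"
    proof
      fix g
      show "R g = T' g"
      proof (cases "g \<in> ell2 K")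
        case True
        have "R g w = T' g w" if "w \<in> ix H" for w
        proof -
          have "ip (R g) (ket w) = ip (T' g) (ket w)" using R T' True ket_ell2[OF that] by metis
          then show ?thesis by (metis ip_ket cnj_ip)
        qed
        then show ?thesis using R T' by (intro ell2_eqI abop_in_ell2) auto
      next
        case False
        then show ?thesis using R T' by (simp add: abop_def)
      qed
    qed
  qed
  then show ?thesis by blast
qed

lemma ell2_finite_expand:
  assumes "finite (ix H)" "f \<in> ell2 H"
  shows "f = (\<lambda>w. \<Sum>v\<in>ix H. f v * ket v w)"
  using ell2_restrict(2)[OF assms(1), of H f] assms(2) by (simp add: ell2_supp cong: if_cong) (metis ell2_supp)

lemma bop_finite:
  assumes "T \<in> bop H K" "finite (ix H)" "f \<in> ell2 H"
  shows "T f w = (\<Sum>v\<in>ix H. f v * T (ket v) w)"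
  by (subst ell2_finite_expand[OF assms(2,3)], subst bop_sum[OF assms(1)])
     (auto simp: bop_scale[OF assms(1)] ket_ell2 ell2_scale)

lemma abop_finite:
  assumes "T \<in> abop H K" "finite (ix H)" "f \<in> ell2 H"
  shows "T f w = (\<Sum>v\<in>ix H. cnj (f v) * T (ket v) w)"
  by (subst ell2_finite_expand[OF assms(2,3)], subst abop_sum[OF assms(1)])
     (auto simp: abop_scale[OF assms(1)] ket_ell2 ell2_scale)

text \<open>In finite dimension boundedness is automatic: every coordinate of \<open>f\<close> is at
  most its norm, so the sum of the norms of the images of the kets is a bound. The inverse of j is
  treated in this way.\<close>

lemma antilinear_finite_abop:
  fixes T :: "('i, 'j) opr"
  assumes fin: "finite (ix H)"
    and add: "\<And>f g. f \<in> ell2 H \<Longrightarrow> g \<in> ell2 H \<Longrightarrow> T (\<lambda>w. f w + g w) = (\<lambda>w. T f w + T g w)"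
    and scale: "\<And>c f. f \<in> ell2 H \<Longrightarrow> T (\<lambda>w. c * f w) = (\<lambda>w. cnj c * T f w)"
    and maps: "\<And>f. f \<in> ell2 H \<Longrightarrow> T f \<in> ell2 K"
  shows "(\<lambda>f. if f \<in> ell2 H then T f else (\<lambda>_. 0)) \<in> abop H K"
proof -
  have T0: "T (\<lambda>_. 0) = (\<lambda>_. 0)" using scale[of "\<lambda>_. 0" 0] by simp
  have nrm_sum: "nrm (T (\<lambda>w. \<Sum>v\<in>A. f v * ket v w)) \<le> (\<Sum>v\<in>A. cmod (f v) * nrm (T (ket v)))"
    if "finite A" "A \<subseteq> ix H" for A f
    using that
  proof (induction A)
    case empty
    then show ?case by (simp add: T0 nrm_def)
  next
    case (insert a A)
    have a: "ket a \<in> ell2 H" using insert by (simp add: ket_ell2)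
    have s: "(\<lambda>w. \<Sum>v\<in>A. f v * ket v w) \<in> ell2 H"
      using insert by (intro ell2_sum ell2_scale ket_ell2) auto
    have "T (\<lambda>w. \<Sum>v\<in>insert a A. f v * ket v w) = (\<lambda>w. cnj (f a) * T (ket a) w + T (\<lambda>w. \<Sum>v\<in>A. f v * ket v w) w)"
      using insert add[OF ell2_scale[OF a, of "f a"] s] by (simp add: scale[OF a])
    then show ?case
      using ell2_add(2)[OF ell2_scale[OF maps[OF a], of "cnj (f a)"] maps[OF s]] insert
      by (simp add: nrm_scale)
  qed
  have "nrm (T f) \<le> (\<Sum>v\<in>ix H. nrm (T (ket v))) * nrm f" if f: "f \<in> ell2 H" for f
  proof -
    have "cmod (f v) \<le> nrm f" for v
      using ell2_L2_set_le[OF f, of "{v}"] by (simp add: L2_set_def)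
    then have "(\<Sum>v\<in>ix H. cmod (f v) * nrm (T (ket v))) \<le> (\<Sum>v\<in>ix H. nrm f * nrm (T (ket v)))"
      by (intro sum_mono mult_right_mono) simp_all
    then show ?thesis
      using nrm_sum[OF fin subset_refl, of f] ell2_finite_expand[OF fin f]
      by (simp add: sum_distrib_left mult.commute)
  qed
  note bound = this
  show ?thesis
    unfolding abop_def
  proof (intro CollectI conjI allI ballI impI)
    show "\<exists>C. \<forall>f\<in>ell2 H. (if f \<in> ell2 H then T f else (\<lambda>_. 0)) \<in> ell2 K \<and>
        nrm (if f \<in> ell2 H then T f else (\<lambda>_. 0)) \<le> C * nrm f"
      using maps bound by (intro exI[of _ "\<Sum>v\<in>ix H. nrm (T (ket v))"]) simp
  qed (simp_all add: ell2_add(1) ell2_scale add scale)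
qed

section \<open>Tensor products of vectors\<close>

lemma htens_ix: "x \<in> ix H \<Longrightarrow> y \<in> ix K \<Longrightarrow> x @ y \<in> ix (H \<otimes>\<^sub>h K)"
  by (auto simp: htens_def)

lemma wf_htens: "wf_hilb H \<Longrightarrow> wf_hilb K \<Longrightarrow> wf_hilb (H \<otimes>\<^sub>h K)"
  by (auto simp: wf_hilb_def htens_def)

lemma vtens_append: "wf_hilb H \<Longrightarrow> x \<in> ix H \<Longrightarrow> vtens H f g (x @ y) = f x * g y"
  by (simp add: vtens_def wf_hilb_def)

text \<open>Splitting indices at \<open>ar H\<close> embeds a finite index set in a finite
  rectangle, over which the sum of squares factorises.\<close>

lemma vtens_ell2:
  assumes f: "f \<in> ell2 H" and g: "g \<in> ell2 K"
  shows "vtens H f g \<in> ell2 (H \<otimes>\<^sub>h K)"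
proof (rule ell2_L2_setI)
  fix w assume w: "w \<notin> ix (H \<otimes>\<^sub>h K)"
  have "take (ar H) w \<notin> ix H \<or> drop (ar H) w \<notin> ix K"
    using w htens_ix[of "take (ar H) w" H "drop (ar H) w" K] by auto
  then show "vtens H f g w = 0" using f g by (auto simp: vtens_def ell2_supp)
next
  fix A :: "'a list set" assume A: "finite A"
  let ?h = "\<lambda>w. (take (ar H) w, drop (ar H) w)" and ?P = "take (ar H) ` A" and ?Q = "drop (ar H) ` A"
  have inj: "inj_on ?h A" by (rule inj_onI) (metis append_take_drop_id prod.inject)
  have "(\<Sum>w\<in>A. (cmod (vtens H f g w))\<^sup>2) = (\<Sum>p\<in>?h ` A. (cmod (f (fst p)))\<^sup>2 * (cmod (g (snd p)))\<^sup>2)"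
    by (simp add: sum.reindex[OF inj] vtens_def norm_mult power_mult_distrib)
  also have "\<dots> \<le> (\<Sum>p\<in>?P \<times> ?Q. (cmod (f (fst p)))\<^sup>2 * (cmod (g (snd p)))\<^sup>2)"
    using A by (intro sum_mono2) auto
  also have "\<dots> = (\<Sum>x\<in>?P. (cmod (f x))\<^sup>2) * (\<Sum>y\<in>?Q. (cmod (g y))\<^sup>2)"
    by (simp add: sum_product sum.cartesian_product case_prod_beta)
  finally have "L2_set (\<lambda>w. cmod (vtens H f g w)) A \<le> L2_set (\<lambda>x. cmod (f x)) ?P * L2_set (\<lambda>y. cmod (g y)) ?Q"
    by (simp add: L2_set_def flip: real_sqrt_mult)
  also have "\<dots> \<le> nrm f * nrm g"
    using A by (intro mult_mono ell2_L2_set_le[OF f] ell2_L2_set_le[OF g]) simp_all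
  finally show "L2_set (\<lambda>w. cmod (vtens H f g w)) A \<le> nrm f * nrm g" .
qed

text \<open>The basis-free form of the definition of \<open>J\<close>, in which unitaries can be
  applied. At most one term of the sum defining \<open>\<zeta>\<close> is nonzero at each index, so
  \<open>\<zeta>\<close> has the value \<open>J (ket y) x\<close> at \<open>x @ y\<close>; summing
  over \<open>x\<close> and then over \<open>y\<close> rebuilds the inner product with
  \<open>J T\<close>.\<close>

lemma represents_vector_ip:
  assumes J: "represents_vector H K J \<zeta>" and \<zeta>: "\<zeta> \<in> ell2 (K \<otimes>\<^sub>h H)"
    and wf: "wf_hilb H" "wf_hilb K" and x: "\<xi> \<in> ell2 K" and T: "T \<in> ell2 H"
  shows "ip (vtens K \<xi> T) \<zeta> = ip \<xi> (J T)"
proof -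
  have Jb: "J \<in> abop H K" and \<zeta>_def: "\<zeta> = (\<lambda>w. \<Sum>\<^sub>\<infinity>i\<in>ix H. vtens K (J (ket i)) (ket i) w)"
    using J by (auto simp: represents_vector_def)
  have \<zeta>_val: "\<zeta> (x @ y) = J (ket y) x" if "x \<in> ix K" "y \<in> ix H" for x y
  proof -
    have "\<zeta> (x @ y) = (\<Sum>\<^sub>\<infinity>i\<in>ix H. J (ket i) x * ket i y)"
      using that wf by (simp add: \<zeta>_def vtens_append)
    also have "\<dots> = (\<Sum>\<^sub>\<infinity>i\<in>{y}. J (ket i) x)"
      using that by (intro infsum_cong_neutral) (auto simp: ket_def)
    finally show ?thesis by simp
  qed
  let ?a = "\<lambda>(y, x). x @ y"
  have inj: "inj_on ?a (ix H \<times> ix K)"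
    using wf by (auto simp: inj_on_def wf_hilb_def)
  have im: "?a ` (ix H \<times> ix K) = ix (K \<otimes>\<^sub>h H)" by (auto simp: htens_def)
  let ?F = "\<lambda>y x. cnj (\<xi> x) * cnj (T y) * J (ket y) x"
  have F: "cnj (vtens K \<xi> T (x @ y)) * \<zeta> (x @ y) = ?F y x" if "x \<in> ix K" "y \<in> ix H" for x y
    using that wf by (simp add: vtens_append \<zeta>_val)
  \<comment> \<open>The Cauchy-Schwarz summability of an inner product justifies passing to an
    iterated sum.\<close>
  have "(\<lambda>w. cnj (vtens K \<xi> T w) * \<zeta> w) summable_on ?a ` (ix H \<times> ix K)"
    using ip_summable(1)[OF vtens_ell2[OF x T] \<zeta>] by (rule abs_summable_summable)
  then have "((\<lambda>w. cnj (vtens K \<xi> T w) * \<zeta> w) \<circ> ?a) summable_on ix H \<times> ix K"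
    by (simp only: summable_on_reindex[OF inj])
  then have summable: "(\<lambda>(y, x). ?F y x) summable_on ix H \<times> ix K"
    by (rule summable_on_cong[THEN iffD1, rotated]) (auto simp: F)
  have "ip (vtens K \<xi> T) \<zeta> = infsum (\<lambda>w. cnj (vtens K \<xi> T w) * \<zeta> w) (?a ` (ix H \<times> ix K))"
    unfolding ip_def im by (intro infsum_cong_neutral) (auto simp: ell2_supp[OF \<zeta>])
  also have "\<dots> = infsum (\<lambda>(y, x). ?F y x) (ix H \<times> ix K)"
    unfolding infsum_reindex[OF inj] by (intro infsum_cong) (auto simp: F)
  also have "\<dots> = (\<Sum>\<^sub>\<infinity>y\<in>ix H. \<Sum>\<^sub>\<infinity>x\<in>ix K. ?F y x)"
    using infsum_Sigma'_banach[OF summable] by simp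
  also have "\<dots> = (\<Sum>\<^sub>\<infinity>y\<in>ix H. cnj (T y) * ip \<xi> (J (ket y)))"
  proof (rule infsum_cong)
    fix y
    have "(\<Sum>\<^sub>\<infinity>x\<in>ix K. ?F y x) = (\<Sum>\<^sub>\<infinity>x. cnj (T y) * (cnj (\<xi> x) * J (ket y) x))"
      by (intro infsum_cong_neutral) (auto simp: ell2_supp[OF x])
    then show "(\<Sum>\<^sub>\<infinity>x\<in>ix K. ?F y x) = cnj (T y) * ip \<xi> (J (ket y))"
      by (simp add: infsum_cmult_right' ip_def)
  qed
  \<comment> \<open>Boundedness of \<open>J\<close> recombines its values on kets into
    \<open>J T\<close>, through the linear operator obtained by conjugating values.\<close>
  also have "\<dots> = ip (\<lambda>w. cnj (J T w)) (\<lambda>w. cnj (\<xi> w))"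
    using bop_ip_has_sum[OF Jb[unfolded abop_iff_bop] T ell2_cnj[OF x]]
    by (simp add: ip_cnj infsumI)
  finally show ?thesis by (simp add: ip_cnj)
qed

section \<open>Tensor products of representations\<close>

lemma sum_htens:
  assumes "wf_hilb H"
  shows "sum f (ix (H \<otimes>\<^sub>h K)) = (\<Sum>x\<in>ix H. \<Sum>y\<in>ix K. f (x @ y))"
proof -
  have inj: "inj_on (\<lambda>(x, y). x @ y) (ix H \<times> ix K)"
    using assms by (auto simp: inj_on_def wf_hilb_def)
  have "ix (H \<otimes>\<^sub>h K) = (\<lambda>(x, y). x @ y) ` (ix H \<times> ix K)" by (auto simp: htens_def)
  then have "sum f (ix (H \<otimes>\<^sub>h K)) = (\<Sum>p\<in>ix H \<times> ix K. f (case p of (x, y) \<Rightarrow> x @ y))"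
    by (simp only: sum.reindex[OF inj] o_def)
  then show ?thesis by (simp add: sum.cartesian_product case_prod_beta)
qed

lemma finite_htens: "finite (ix H) \<Longrightarrow> finite (ix K) \<Longrightarrow> finite (ix (H \<otimes>\<^sub>h K))"
  by (simp add: htens_def finite_image_set2)

lemma sp_rtens [simp]: "sp (u \<otimes>\<^sub>r v) = sp u \<otimes>\<^sub>h sp v"
  by (simp add: rtens_def)

lemma cf_rtens:
  assumes "wf_hilb (sp u)" "x \<in> ix (sp u)" "y \<in> ix (sp u)" "p \<in> ix (sp v)" "q \<in> ix (sp v)"
  shows "cf (u \<otimes>\<^sub>r v) (x @ p) (y @ q) = cf u x y * cf v p q"
  using assms by (simp add: rtens_def htens_ix wf_hilb_def)

lemma unitary_rep_runit:
  assumes "cstar_tensor t" "star_hom \<Delta>"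
  shows "unitary_rep t \<Delta> runit"
  using assms cstar_tensorD(5)[OF assms(1)]
  by (simp add: unitary_rep_def runit_def hunit_def wf_hilb_def star_hom_def)

text \<open>Functors and transformations are controlled on unitary representations, so u \<otimes> v
  must be one. The coefficients of u and v need not commute: in the relation with the star on the
  left the sum over u is innermost and is contracted first, in the other one the sum over v.\<close>

lemma unitary_rep_rtens:
  assumes t: "cstar_tensor t" and \<Delta>: "star_hom \<Delta>" and u: "unitary_rep t \<Delta> u" and v: "unitary_rep t \<Delta> v"
  shows "unitary_rep t \<Delta> (u \<otimes>\<^sub>r v)"
proof -
  let ?U = "ix (sp u)" and ?V = "ix (sp v)"
  have wf: "wf_hilb (sp u)" "wf_hilb (sp v)" "finite ?U" "finite ?V"
    using u v by (auto simp: unitary_rep_def)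
  have mult: "\<Delta> (a * b) = \<Delta> a * \<Delta> b" for a b using \<Delta> by (simp add: star_hom_def)
  have u1: "(\<Sum>k\<in>?U. star (cf u k i) * cf u k j) = (if i = j then 1 else 0)"
    and u2: "(\<Sum>k\<in>?U. cf u i k * star (cf u j k)) = (if i = j then 1 else 0)"
    and u3: "\<Delta> (cf u i j) = (\<Sum>k\<in>?U. t (cf u i k) (cf u k j))" if "i \<in> ?U" "j \<in> ?U" for i j
    using u that by (auto simp: unitary_rep_def)
  have v1: "(\<Sum>k\<in>?V. star (cf v k i) * cf v k j) = (if i = j then 1 else 0)"
    and v2: "(\<Sum>k\<in>?V. cf v i k * star (cf v j k)) = (if i = j then 1 else 0)"
    and v3: "\<Delta> (cf v i j) = (\<Sum>k\<in>?V. t (cf v i k) (cf v k j))" if "i \<in> ?V" "j \<in> ?V" for i j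
    using v that by (auto simp: unitary_rep_def)
  note cf = cf_rtens[OF wf(1)]
  have "(\<Sum>k\<in>ix (sp u \<otimes>\<^sub>h sp v). star (cf (u \<otimes>\<^sub>r v) k i) * cf (u \<otimes>\<^sub>r v) k j) = (if i = j then 1 else 0) \<and>
      (\<Sum>k\<in>ix (sp u \<otimes>\<^sub>h sp v). cf (u \<otimes>\<^sub>r v) i k * star (cf (u \<otimes>\<^sub>r v) j k)) = (if i = j then 1 else 0) \<and>
      \<Delta> (cf (u \<otimes>\<^sub>r v) i j) = (\<Sum>k\<in>ix (sp u \<otimes>\<^sub>h sp v). t (cf (u \<otimes>\<^sub>r v) i k) (cf (u \<otimes>\<^sub>r v) k j))"
    if "i \<in> ix (sp u \<otimes>\<^sub>h sp v)" "j \<in> ix (sp u \<otimes>\<^sub>h sp v)" for i j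
  proof -
    obtain x p where i: "i = x @ p" "x \<in> ?U" "p \<in> ?V" using \<open>i \<in> _\<close> by (auto simp: htens_def)
    obtain y q where j: "j = y @ q" "y \<in> ?U" "q \<in> ?V" using \<open>j \<in> _\<close> by (auto simp: htens_def)
    have eq: "i = j \<longleftrightarrow> x = y \<and> p = q"
      using i j wf(1) by (auto simp: wf_hilb_def)
    have "(\<Sum>k\<in>ix (sp u \<otimes>\<^sub>h sp v). star (cf (u \<otimes>\<^sub>r v) k i) * cf (u \<otimes>\<^sub>r v) k j) =
        (\<Sum>a\<in>?U. \<Sum>b\<in>?V. star (cf v b p) * (star (cf u a x) * cf u a y) * cf v b q)"
      unfolding sum_htens[OF wf(1)] i j
      by (intro sum.cong refl) (simp add: cf i j star_mult mult.assoc)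
    also have "\<dots> = (\<Sum>b\<in>?V. star (cf v b p) * (\<Sum>a\<in>?U. star (cf u a x) * cf u a y) * cf v b q)"
      by (subst sum.swap) (simp add: sum_distrib_left sum_distrib_right)
    also have "\<dots> = (if i = j then 1 else 0)"
      using v1[OF i(3) j(3)] by (cases "p = q") (auto simp: u1 i(2) j(2) eq)
    finally have 1: "(\<Sum>k\<in>ix (sp u \<otimes>\<^sub>h sp v). star (cf (u \<otimes>\<^sub>r v) k i) * cf (u \<otimes>\<^sub>r v) k j) = (if i = j then 1 else 0)" .
    have "(\<Sum>k\<in>ix (sp u \<otimes>\<^sub>h sp v). cf (u \<otimes>\<^sub>r v) i k * star (cf (u \<otimes>\<^sub>r v) j k)) =
        (\<Sum>a\<in>?U. \<Sum>b\<in>?V. cf u x a * (cf v p b * star (cf v q b)) * star (cf u y a))"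
      unfolding sum_htens[OF wf(1)] i j
      by (intro sum.cong refl) (simp add: cf i j star_mult mult.assoc)
    also have "\<dots> = (\<Sum>a\<in>?U. cf u x a * (\<Sum>b\<in>?V. cf v p b * star (cf v q b)) * star (cf u y a))"
      by (simp add: sum_distrib_left sum_distrib_right)
    also have "\<dots> = (if i = j then 1 else 0)"
      using u2[OF i(2) j(2)] by (cases "x = y") (auto simp: v2 i(3) j(3) eq)
    finally have 2: "(\<Sum>k\<in>ix (sp u \<otimes>\<^sub>h sp v). cf (u \<otimes>\<^sub>r v) i k * star (cf (u \<otimes>\<^sub>r v) j k)) = (if i = j then 1 else 0)" .
    have "\<Delta> (cf (u \<otimes>\<^sub>r v) i j) = (\<Sum>a\<in>?U. t (cf u x a) (cf u a y)) * (\<Sum>b\<in>?V. t (cf v p b) (cf v b q))"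
      by (simp add: i j cf mult u3 v3)
    also have "\<dots> = (\<Sum>a\<in>?U. \<Sum>b\<in>?V. t (cf u x a * cf v p b) (cf u a y * cf v b q))"
      by (simp add: sum_product cstar_tensorD(3)[OF t])
    also have "\<dots> = (\<Sum>k\<in>ix (sp u \<otimes>\<^sub>h sp v). t (cf (u \<otimes>\<^sub>r v) i k) (cf (u \<otimes>\<^sub>r v) k j))"
      unfolding sum_htens[OF wf(1)] i j by (intro sum.cong refl) (simp add: cf i j)
    finally show ?thesis using 1 2 by blast
  qed
  moreover have "cf (u \<otimes>\<^sub>r v) i j = 0" if "i \<notin> ix (sp u \<otimes>\<^sub>h sp v) \<or> j \<notin> ix (sp u \<otimes>\<^sub>h sp v)" for i j
    using that by (auto simp: rtens_def)
  ultimately show ?thesis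
    unfolding unitary_rep_def sp_rtens using wf by (simp add: wf_htens finite_htens)
qed

section \<open>Kernels and the coefficient algebra\<close>

text \<open>A kernel represents an element of \<open>H\<close>-bar \<open>\<otimes> K\<close>. Its columns are conjugated, so that
  they are vectors of \<open>H\<close> rather than of its conjugate space.\<close>

abbreviation col :: "'i kernel \<Rightarrow> nat list \<Rightarrow> 'i vct" where
  "col k y \<equiv> (\<lambda>x. cnj (k x y))"

text \<open>When \<open>ix K\<close> is finite this is the whole tensor product: finitely many
  square-summable columns impose no further joint summability.\<close>

definition kspace :: "'i hilb \<Rightarrow> nat hilb \<Rightarrow> 'i kernel set" where
  "kspace H K = {k. (\<forall>y. col k y \<in> ell2 H) \<and> (\<forall>y. y \<notin> ix K \<longrightarrow> (\<forall>x. k x y = 0))}"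

lemma kspace_col: "k \<in> kspace H K \<Longrightarrow> col k y \<in> ell2 H"
  and kspace_supp: "k \<in> kspace H K \<Longrightarrow> y \<notin> ix K \<Longrightarrow> k x y = 0"
  by (simp_all add: kspace_def)

lemma kspace_zero: "(\<lambda>_ _. 0) \<in> kspace H K"
  by (simp add: kspace_def)

lemma kspace_supp_left: "k \<in> kspace H K \<Longrightarrow> x \<notin> ix H \<Longrightarrow> k x y = 0"
  using ell2_supp[OF kspace_col, of k H K x y] by simp

lemma kspace_add: "k \<in> kspace H K \<Longrightarrow> l \<in> kspace H K \<Longrightarrow> (\<lambda>x y. k x y + l x y) \<in> kspace H K"
  by (simp add: kspace_def ell2_add(1))

lemma kspace_scale: "k \<in> kspace H K \<Longrightarrow> (\<lambda>x y. c * k x y) \<in> kspace H K"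
  by (simp add: kspace_def ell2_scale)

lemma kspace_sum: "(\<And>p. p \<in> P \<Longrightarrow> k p \<in> kspace H K) \<Longrightarrow> (\<lambda>x y. \<Sum>p\<in>P. k p x y) \<in> kspace H K"
  by (induction P rule: infinite_finite_induct) (auto intro: kspace_zero kspace_add)

lemma kern_kspace: "T \<in> ell2 H \<Longrightarrow> \<phi> \<in> ell2 K \<Longrightarrow> kern T \<phi> \<in> kspace H K"
  by (simp add: kspace_def kern_def ell2_supp mult.commute[of _ "cnj _"] ell2_scale)

section \<open>Operators on kernels, expanded over the finite-dimensional factor\<close>

lemma ell2_finiteI:
  assumes "finite (ix K)" "\<And>y. y \<notin> ix K \<Longrightarrow> f y = 0"
  shows "f \<in> ell2 K"
proof -
  have "{w. (cmod (f w))\<^sup>2 \<noteq> 0} \<subseteq> ix K" using assms(2) by auto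
  then have "finite {w. (cmod (f w))\<^sup>2 \<noteq> 0}" using assms(1) by (rule finite_subset)
  then have "(\<lambda>w. (cmod (f w))\<^sup>2) summable_on UNIV"
    by (intro finite_nonzero_values_imp_summable_on) simp
  then show ?thesis using assms(2) by (simp add: ell2_def)
qed

text \<open>Finiteness of \<open>ix K\<close> replaces a Hilbert tensor product of operators by a
  finite sum: \<open>A\<close> acts on each conjugated column, \<open>B\<close> on the matching
  ket.\<close>

lemma kern_map_expand:
  assumes A: "A \<in> bop H H'" and B: "B \<in> bop K K'" and K: "finite (ix K)" and k: "k \<in> kspace H K"
  shows "kern_map A B k x y' = (\<Sum>y\<in>ix K. cnj (A (col k y) x) * B (ket y) y')"
  unfolding kern_map_def
proof (rule bop_finite[OF B K])
  show "(\<lambda>y. cnj (A (\<lambda>x'. cnj (k x' y)) x)) \<in> ell2 K"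
    using K by (rule ell2_finiteI) (simp add: kspace_supp[OF k] bop_zero[OF A])
qed

lemma kern_amap_expand:
  assumes A: "A \<in> abop H H'" and B: "B \<in> abop K K'" and K: "finite (ix K)" and k: "k \<in> kspace H K"
  shows "kern_amap A B k x y' = (\<Sum>y\<in>ix K. cnj (A (col k y) x) * B (ket y) y')"
  unfolding kern_amap_def
proof (rule abop_finite[OF B K])
  have "A (\<lambda>_. 0) = (\<lambda>_. 0)" using abop_scale[OF A ell2_zero, of 0] by simp
  then show "(\<lambda>y. A (\<lambda>x'. cnj (k x' y)) x) \<in> ell2 K"
    using K by (intro ell2_finiteI) (simp_all add: kspace_supp[OF k])
qed

lemma expansion_kspace:
  assumes "\<And>y. y \<in> Y \<Longrightarrow> f y \<in> ell2 H" "\<And>y. g y \<in> ell2 K"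
  shows "(\<lambda>x y'. \<Sum>y\<in>Y. cnj (f y x) * g y y') \<in> kspace H K"
proof -
  have "(\<lambda>x. \<Sum>y\<in>Y. cnj (g y y') * f y x) \<in> ell2 H" for y'
    using assms(1) by (intro ell2_sum ell2_scale)
  moreover have "(\<Sum>y\<in>Y. cnj (f y x) * g y y') = 0" if "y' \<notin> ix K" for x y'
    using ell2_supp[OF assms(2) that] by simp
  ultimately show ?thesis by (simp add: kspace_def mult.commute)
qed

lemma kern_map_kspace:
  assumes A: "A \<in> bop H H'" and B: "B \<in> bop K K'" and K: "finite (ix K)" and k: "k \<in> kspace H K"
  shows "kern_map A B k \<in> kspace H' K'"
  using expansion_kspace[of "ix K" "\<lambda>y. A (col k y)" H' "\<lambda>y. B (ket y)" K']
  by (simp add: kern_map_expand[OF assms, abs_def] bop_in_ell2[OF A] bop_in_ell2[OF B])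

lemma kern_amap_kspace:
  assumes A: "A \<in> abop H H'" and B: "B \<in> abop K K'" and K: "finite (ix K)" and k: "k \<in> kspace H K"
  shows "kern_amap A B k \<in> kspace H' K'"
  using expansion_kspace[of "ix K" "\<lambda>y. A (col k y)" H' "\<lambda>y. B (ket y)" K']
  by (simp add: kern_amap_expand[OF assms, abs_def] abop_in_ell2[OF A] abop_in_ell2[OF B])

lemma col_kern_tens:
  "col (kern_tens (ar H) (ar K) k l) y = vtens H (col k (take (ar K) y)) (col l (drop (ar K) y))"
  by (simp add: kern_tens_def vtens_def)

lemma kern_tens_kspace:
  assumes k: "k \<in> kspace H K" and l: "l \<in> kspace H' K'"
  shows "kern_tens (ar H) (ar K) k l \<in> kspace (H \<otimes>\<^sub>h H') (K \<otimes>\<^sub>h K')"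
proof -
  have "kern_tens (ar H) (ar K) k l x y = 0" if "y \<notin> ix (K \<otimes>\<^sub>h K')" for x y
    using that htens_ix[of "take (ar K) y" K "drop (ar K) y" K'] kspace_supp[OF k] kspace_supp[OF l]
    by (auto simp: kern_tens_def)
  then show ?thesis
    unfolding kspace_def mem_Collect_eq col_kern_tens using vtens_ell2 kspace_col k l by blast
qed

text \<open>With \<open>id\<close> instead of \<open>idop\<close> as second operator the formula
  holds for every kernel, free of membership conditions.\<close>

lemma kern_map_id: "kern_map V id k x y = cnj (V (col k y) x)"
  by (simp add: kern_map_def)

lemma col_kern_map_id: "col (kern_map V id k) y = V (col k y)"
  by (simp add: kern_map_id)

lemma kern_map_id_kspace:
  assumes "V \<in> bop H H'" "k \<in> kspace H K"
  shows "kern_map V id k \<in> kspace H' K"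
proof -
  have "kern_map V id k x y = 0" if "y \<notin> ix K" for x y
    using that kspace_supp[OF assms(2)] by (simp add: kern_map_id bop_zero[OF assms(1)])
  then show ?thesis
    unfolding kspace_def mem_Collect_eq col_kern_map_id using bop_in_ell2[OF assms(1)] by blast
qed

lemma kern_map_id_zero: "V \<in> bop H H' \<Longrightarrow> kern_map V id (\<lambda>_ _. 0) = (\<lambda>_ _. 0)"
  by (simp add: kern_map_id fun_eq_iff bop_zero)

lemma kern_map_id_sum:
  assumes "V \<in> bop H H'" "\<And>p. p \<in> P \<Longrightarrow> k p \<in> kspace H K"
  shows "kern_map V id (\<lambda>x y. \<Sum>p\<in>P. k p x y) = (\<lambda>x y. \<Sum>p\<in>P. kern_map V id (k p) x y)"
  using bop_sum[OF assms(1), of P "\<lambda>p. col (k p) _"] kspace_col[OF assms(2)]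
  by (simp add: kern_map_id fun_eq_iff)

text \<open>The form in which \<open>U\<close> is pushed through the finite expansions of products
  and of adjoints.\<close>

lemma kern_map_id_expand:
  assumes "V \<in> bop H H'" "\<And>y. y \<in> Y \<Longrightarrow> f y \<in> ell2 H"
    and "\<And>x y'. k x y' = (\<Sum>y\<in>Y. cnj (f y x) * g y y')"
  shows "kern_map V id k x y' = (\<Sum>y\<in>Y. cnj (V (f y) x) * g y y')"
proof -
  have "col k y' = (\<lambda>x. \<Sum>y\<in>Y. cnj (g y y') * f y x)"
    by (simp add: assms(3) mult.commute)
  then have "V (col k y') = (\<lambda>x. \<Sum>y\<in>Y. cnj (g y y') * V (f y) x)"
    using assms(2) by (simp add: bop_sum[OF assms(1)] ell2_scale bop_scale[OF assms(1)])
  then show ?thesis by (simp add: kern_map_id mult.commute)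
qed

text \<open>Since \<open>kspace H K\<close> is trivial if \<open>H\<close> is, the condition \<open>F(u) \<noteq> 0\<close> is automatic where a
  family does not vanish.\<close>

definition coefs :: "'a::cstar_algebra choices \<Rightarrow> ('a, 'i) qfunctor \<Rightarrow> ('a rep \<Rightarrow> 'i kernel) set" where
  "coefs ch F = {c. finite {u. c u \<noteq> (\<lambda>_ _. 0)} \<and> (\<forall>u. c u \<in> kspace (Fob F u) (sp u)) \<and>
     (\<forall>u. c u \<noteq> (\<lambda>_ _. 0) \<longrightarrow> u \<in> Irr ch)}"

lemma coefs_hat:
  assumes "c \<in> coefs ch F" "c u \<noteq> (\<lambda>_ _. 0)"
  shows "u \<in> hat ch F"
proof -
  have "c u \<in> kspace (Fob F u) (sp u)" using assms by (simp add: coefs_def)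
  then have "ix (Fob F u) \<noteq> {}" using kspace_supp_left assms(2) by fastforce
  then show ?thesis using assms by (simp add: coefs_def hat_def)
qed

lemma sum_coefs:
  assumes "finite P" "\<And>p. p \<in> P \<Longrightarrow> c p \<in> coefs ch F"
  shows "(\<lambda>w x y. \<Sum>p\<in>P. c p w x y) \<in> coefs ch F"
proof -
  have supp: "{u. (\<lambda>x y. \<Sum>p\<in>P. c p u x y) \<noteq> (\<lambda>_ _. 0)} \<subseteq> (\<Union>p\<in>P. {u. c p u \<noteq> (\<lambda>_ _. 0)})"
    by (auto simp: fun_eq_iff intro!: sum.neutral)
  have "finite (\<Union>p\<in>P. {u. c p u \<noteq> (\<lambda>_ _. 0)})"
    using assms by (auto simp: coefs_def)
  then have "finite {u. (\<lambda>x y. \<Sum>p\<in>P. c p u x y) \<noteq> (\<lambda>_ _. 0)}" using supp by (rule finite_subset[rotated])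
  moreover have "(\<lambda>x y. \<Sum>p\<in>P. c p u x y) \<in> kspace (Fob F u) (sp u)" for u
    using assms(2) by (intro kspace_sum) (auto simp: coefs_def)
  moreover have "u \<in> Irr ch" if "(\<lambda>x y. \<Sum>p\<in>P. c p u x y) \<noteq> (\<lambda>_ _. 0)" for u
    using that supp assms(2) by (auto simp: coefs_def)
  ultimately show ?thesis by (simp add: coefs_def)
qed

lemma single_coefs:
  assumes "z \<in> Irr ch" "k \<in> kspace (Fob F z) (sp z)"
  shows "(\<lambda>w x y. if w = z then k x y else 0) \<in> coefs ch F"
proof -
  have "{u. (\<lambda>x y. if u = z then k x y else 0) \<noteq> (\<lambda>_ _. 0)} \<subseteq> {z}" by auto
  then have "finite {u. (\<lambda>x y. if u = z then k x y else 0) \<noteq> (\<lambda>_ _. 0)}" by (rule finite_subset) simp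
  moreover have "(\<lambda>x y. if u = z then k x y else 0) \<in> kspace (Fob F u) (sp u) \<and>
      ((\<lambda>x y. if u = z then k x y else 0) \<noteq> (\<lambda>_ _. 0) \<longrightarrow> u \<in> Irr ch)" for u
    using assms by (cases "u = z") (simp_all add: kspace_zero)
  ultimately show ?thesis by (simp add: coefs_def)
qed

lemma elt_coefs:
  assumes "u \<in> Irr ch" "T \<in> ell2 (Fob F u)" "\<phi> \<in> ell2 (sp u)"
  shows "elt u T \<phi> \<in> coefs ch F"
proof -
  have "elt u T \<phi> = (\<lambda>w x y. if w = u then kern T \<phi> x y else 0)" by (auto simp: elt_def)
  then show ?thesis using single_coefs[OF assms(1) kern_kspace[OF assms(2,3)]] by simp
qed

text \<open>A kernel is the sum of its columns tensored with kets, finitely many as H_u is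
  finite-dimensional. The carrier of finite sums of elementary tensors thereby becomes a set given
  by conditions on each component, which the operations visibly preserve.\<close>

lemma carr_coef_alg:
  fixes J :: "'a::cstar_algebra rep \<Rightarrow> ('i, 'i) opr"
  assumes fin: "\<And>u. u \<in> Irr ch \<Longrightarrow> finite (ix (sp u))"
  shows "carr (coef_alg ch F J) = coefs ch F"
proof (intro set_eqI iffI)
  fix c assume "c \<in> carr (coef_alg ch F J)"
  then obtain n u T \<phi> where c: "c = (\<lambda>w x y. \<Sum>k<(n::nat). elt (u k) (T k) (\<phi> k) w x y)"
    and k: "\<forall>k<n. u k \<in> hat ch F \<and> T k \<in> ell2 (Fob F (u k)) \<and> \<phi> k \<in> ell2 (sp (u k))"
    by (auto simp: coef_alg_def)
  show "c \<in> coefs ch F"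
    unfolding c using k by (intro sum_coefs elt_coefs) (auto simp: hat_def)
next
  fix c assume c: "c \<in> coefs ch F"
  define S where "S = {u. c u \<noteq> (\<lambda>_ _. 0)}"
  let ?P = "SIGMA u:S. ix (sp u)"
  have S: "finite S" "\<And>u. u \<in> S \<Longrightarrow> u \<in> Irr ch" "\<And>u. c u \<in> kspace (Fob F u) (sp u)"
    using c by (auto simp: coefs_def S_def)
  have finP: "finite ?P" using S fin by auto
  have elt_val: "elt u (col (c u) y) (ket y) w x z = (if w = u \<and> z = y then c u x z else 0)" for u y w x z
    by (auto simp: elt_def kern_def ket_def)
  have sum_c: "c w x z = (\<Sum>p\<in>?P. elt (fst p) (col (c (fst p)) (snd p)) (ket (snd p)) w x z)" for w x z
  proof -
    have "(\<Sum>p\<in>?P. elt (fst p) (col (c (fst p)) (snd p)) (ket (snd p)) w x z) =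
        (\<Sum>p\<in>?P. if (w, z) = p then c w x z else 0)"
      by (intro sum.cong) (auto simp: elt_val)
    also have "\<dots> = (if (w, z) \<in> ?P then c w x z else 0)" using finP by simp
    also have "\<dots> = c w x z" using kspace_supp[OF S(3)] by (auto simp: S_def)
    finally show ?thesis by simp
  qed
  \<comment> \<open>The carrier indexes its sums by an initial segment of the naturals.\<close>
  obtain h where h: "bij_betw h {0..<card ?P} ?P" using ex_bij_betw_nat_finite[OF finP] by blast
  have "c = (\<lambda>w x z. \<Sum>k<card ?P. elt (fst (h k)) (col (c (fst (h k))) (snd (h k))) (ket (snd (h k))) w x z)"
    by (intro ext trans[OF sum_c], subst sum.reindex_bij_betw[OF h, symmetric]) (simp add: lessThan_atLeast0)
  moreover have "fst (h k) \<in> hat ch F \<and> col (c (fst (h k))) (snd (h k)) \<in> ell2 (Fob F (fst (h k))) \<and>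
      ket (snd (h k)) \<in> ell2 (sp (fst (h k)))" if "k < card ?P" for k
  proof -
    have "h k \<in> ?P" using bij_betwE[OF h] that by simp
    then show ?thesis
      using coefs_hat[OF c] kspace_col[OF S(3)] by (auto simp: S_def intro: ket_ell2)
  qed
  ultimately show "c \<in> carr (coef_alg ch F J)"
    unfolding coef_alg_def star_alg.simps mem_Collect_eq
    by (intro exI[of _ "card ?P"] exI[of _ "\<lambda>k. fst (h k)"] exI[of _ "\<lambda>k. col (c (fst (h k))) (snd (h k))"]
        exI[of _ "\<lambda>k. ket (snd (h k))"]) blast
qed

section \<open>Product and involution as finite sums of singly supported families\<close>

definition mul_op :: "('a::cstar_algebra, 'i) qfunctor \<Rightarrow> 'a rep \<Rightarrow> 'a rep \<Rightarrow> 'a rep \<Rightarrow> (nat, nat) opr \<Rightarrow> ('i, 'i) opr" where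
  "mul_op F u v z s = adj (Fob F z) (Fob F (u \<otimes>\<^sub>r v)) (Fmor F z (u \<otimes>\<^sub>r v) s) \<circ> Fs F u v"

definition star_op :: "'a choices \<Rightarrow> 'a rep \<Rightarrow> (nat, nat) opr" where
  "star_op ch u = aadj (sp (cj ch u)) (sp u) (the_inv_into (ell2 (sp u)) (cjm ch u))"

text \<open>Terms are indexed by positions in the list \<open>dec ch u v\<close>, not by its
  entries, so that repeated entries keep their multiplicity.\<close>

definition mul_ix :: "'a choices \<Rightarrow> ('a rep \<Rightarrow> 'i kernel) \<Rightarrow> ('a rep \<Rightarrow> 'i kernel) \<Rightarrow> ('a rep \<times> 'a rep \<times> nat) set" where
  "mul_ix ch c d = (SIGMA u:{u. c u \<noteq> (\<lambda>_ _. 0)}. SIGMA v:{v. d v \<noteq> (\<lambda>_ _. 0)}. {..<length (dec ch u v)})"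

definition mul_tgt :: "'a choices \<Rightarrow> 'a rep \<times> 'a rep \<times> nat \<Rightarrow> 'a rep" where
  "mul_tgt ch = (\<lambda>(u, v, i). fst (dec ch u v ! i))"

definition mul_term :: "'a::cstar_algebra choices \<Rightarrow> ('a, 'i) qfunctor \<Rightarrow> ('a rep \<Rightarrow> 'i kernel) \<Rightarrow> ('a rep \<Rightarrow> 'i kernel) \<Rightarrow>
    'a rep \<times> 'a rep \<times> nat \<Rightarrow> 'i kernel" where
  "mul_term ch F c d = (\<lambda>(u, v, i). let (z, s) = dec ch u v ! i in
     kern_map (mul_op F u v z s) (adj (sp z) (sp (u \<otimes>\<^sub>r v)) s)
       (kern_tens (ar (Fob F u)) (ar (sp u)) (c u) (d v)))"

lemma coef_mult_eq:
  assumes "finite {u. c u \<noteq> (\<lambda>_ _. 0)}" "finite {u. d u \<noteq> (\<lambda>_ _. 0)}"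
  shows "coef_mult ch F c d = (\<lambda>w x y. \<Sum>p\<in>mul_ix ch c d. if w = mul_tgt ch p then mul_term ch F c d p x y else 0)"
proof (intro ext)
  fix w x y
  let ?f = "\<lambda>p. if w = mul_tgt ch p then mul_term ch F c d p x y else 0"
  have "coef_mult ch F c d w x y =
      (\<Sum>u | c u \<noteq> (\<lambda>_ _. 0). \<Sum>v | d v \<noteq> (\<lambda>_ _. 0). \<Sum>i<length (dec ch u v). ?f (u, v, i))"
    unfolding coef_mult_def
    by (intro sum.cong refl)
       (auto simp: sum_list_sum_nth lessThan_atLeast0 mul_tgt_def mul_term_def mul_op_def Let_def case_prod_beta
         intro!: sum.cong)
  also have "\<dots> = (\<Sum>p\<in>mul_ix ch c d. ?f p)"
    unfolding mul_ix_def using assms by (simp add: sum.Sigma case_prod_beta cong: if_cong)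
  finally show "coef_mult ch F c d w x y = (\<Sum>p\<in>mul_ix ch c d. ?f p)" .
qed

text \<open>Isolates what the operations need, boundedness of the operators involved and closure of
  \<open>Irr ch\<close> under the choices, so that the algebra can be handled apart from the quantum
  group.\<close>

locale coef_data =
  fixes ch :: "'a::cstar_algebra choices" and F :: "('a, 'i) qfunctor" and J :: "'a rep \<Rightarrow> ('i, 'i) opr"
  assumes fin: "u \<in> Irr ch \<Longrightarrow> finite (ix (sp u))"
    and dec_Irr: "u \<in> Irr ch \<Longrightarrow> v \<in> Irr ch \<Longrightarrow> (z, s) \<in> set (dec ch u v) \<Longrightarrow> z \<in> Irr ch"
    and mul_op_bop: "u \<in> Irr ch \<Longrightarrow> v \<in> Irr ch \<Longrightarrow> (z, s) \<in> set (dec ch u v) \<Longrightarrow>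
      mul_op F u v z s \<in> bop (Fob F u \<otimes>\<^sub>h Fob F v) (Fob F z)"
    and dec_bop: "u \<in> Irr ch \<Longrightarrow> v \<in> Irr ch \<Longrightarrow> (z, s) \<in> set (dec ch u v) \<Longrightarrow>
      adj (sp z) (sp (u \<otimes>\<^sub>r v)) s \<in> bop (sp u \<otimes>\<^sub>h sp v) (sp z)"
    and cj_Irr: "u \<in> Irr ch \<Longrightarrow> cj ch u \<in> Irr ch"
    and J_abop: "u \<in> hat ch F \<Longrightarrow> J u \<in> abop (Fob F u) (Fob F (cj ch u))"
    and star_op_abop: "u \<in> Irr ch \<Longrightarrow> star_op ch u \<in> abop (sp u) (sp (cj ch u))"
    and runit_Irr: "runit \<in> Irr ch"
    and Fob_runit: "Fob F runit = hunit"
begin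

abbreviation "alg \<equiv> coef_alg ch F J"

lemma carr: "carr alg = coefs ch F"
  using carr_coef_alg fin .

lemma coefsD:
  assumes "c \<in> coefs ch F"
  shows "finite {u. c u \<noteq> (\<lambda>_ _. 0)}" "c u \<in> kspace (Fob F u) (sp u)" "c u \<noteq> (\<lambda>_ _. 0) \<Longrightarrow> u \<in> Irr ch"
  using assms by (auto simp: coefs_def)

lemma mul_ix_cases:
  assumes "c \<in> coefs ch F" "d \<in> coefs ch F" "p \<in> mul_ix ch c d"
  obtains u v i z s where "p = (u, v, i)" "u \<in> Irr ch" "v \<in> Irr ch" "dec ch u v ! i = (z, s)"
    "(z, s) \<in> set (dec ch u v)" "mul_tgt ch p = z"
    "mul_term ch F c d p = kern_map (mul_op F u v z s) (adj (sp z) (sp (u \<otimes>\<^sub>r v)) s)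
       (kern_tens (ar (Fob F u)) (ar (sp u)) (c u) (d v))"
proof -
  obtain u v i where p: "p = (u, v, i)" by (cases p)
  obtain z s where zs: "dec ch u v ! i = (z, s)" by (cases "dec ch u v ! i")
  have "i < length (dec ch u v)" using assms(3) by (simp add: mul_ix_def p)
  then have "(z, s) \<in> set (dec ch u v)" using zs nth_mem by metis
  moreover have "u \<in> Irr ch" "v \<in> Irr ch"
    using assms coefsD(3) by (auto simp: mul_ix_def p)
  ultimately show thesis
    using that[OF p] zs by (simp add: p mul_tgt_def mul_term_def)
qed

lemma kern_tens_coefs:
  assumes "c \<in> coefs ch F" "d \<in> coefs ch F"
  shows "kern_tens (ar (Fob F u)) (ar (sp u)) (c u) (d v) \<in> kspace (Fob F u \<otimes>\<^sub>h Fob F v) (sp u \<otimes>\<^sub>h sp v)"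
  by (rule kern_tens_kspace[OF coefsD(2)[OF assms(1)] coefsD(2)[OF assms(2)]])

lemma mul_term_kspace:
  assumes c: "c \<in> coefs ch F" and d: "d \<in> coefs ch F" and p: "p \<in> mul_ix ch c d"
  shows "mul_tgt ch p \<in> Irr ch" "mul_term ch F c d p \<in> kspace (Fob F (mul_tgt ch p)) (sp (mul_tgt ch p))"
proof -
  obtain u v i z s where uv: "u \<in> Irr ch" "v \<in> Irr ch" "(z, s) \<in> set (dec ch u v)" "mul_tgt ch p = z"
    and t: "mul_term ch F c d p = kern_map (mul_op F u v z s) (adj (sp z) (sp (u \<otimes>\<^sub>r v)) s)
       (kern_tens (ar (Fob F u)) (ar (sp u)) (c u) (d v))"
    by (rule mul_ix_cases[OF c d p]) iprover
  show "mul_tgt ch p \<in> Irr ch" unfolding uv(4) by (rule dec_Irr[OF uv(1-3)])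
  show "mul_term ch F c d p \<in> kspace (Fob F (mul_tgt ch p)) (sp (mul_tgt ch p))"
    unfolding t uv(4)
    by (rule kern_map_kspace[OF mul_op_bop[OF uv(1-3)] dec_bop[OF uv(1-3)]
          finite_htens[OF fin[OF uv(1)] fin[OF uv(2)]] kern_tens_coefs[OF c d]])
qed

lemma finite_mul_ix:
  assumes "c \<in> coefs ch F" "d \<in> coefs ch F"
  shows "finite (mul_ix ch c d)"
  using assms coefsD(1) by (simp add: mul_ix_def)

lemma coef_mult_coefs:
  assumes c: "c \<in> coefs ch F" and d: "d \<in> coefs ch F"
  shows "coef_mult ch F c d \<in> coefs ch F"
  unfolding coef_mult_eq[OF coefsD(1)[OF c] coefsD(1)[OF d]]
  by (intro sum_coefs finite_mul_ix[OF c d] single_coefs mul_term_kspace[OF c d])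

lemma coef_star_eq:
  "coef_star ch J c = (\<lambda>w x y. \<Sum>u | c u \<noteq> (\<lambda>_ _. 0).
     if w = cj ch u then kern_amap (J u) (star_op ch u) (c u) x y else 0)"
  unfolding coef_star_def star_op_def ..

lemma star_term_kspace:
  assumes c: "c \<in> coefs ch F" and u: "c u \<noteq> (\<lambda>_ _. 0)"
  shows "kern_amap (J u) (star_op ch u) (c u) \<in> kspace (Fob F (cj ch u)) (sp (cj ch u))"
  using coefsD(3)[OF c u] coefs_hat[OF c u]
  by (intro kern_amap_kspace[OF J_abop star_op_abop fin coefsD(2)[OF c]])

lemma coef_star_coefs:
  assumes c: "c \<in> coefs ch F"
  shows "coef_star ch J c \<in> coefs ch F"
  unfolding coef_star_eq
  using coefsD(1)[OF c]
  by (intro sum_coefs single_coefs) (auto intro: star_term_kspace[OF c] cj_Irr coefsD(3)[OF c])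

lemma add_coefs:
  assumes "c \<in> coefs ch F" "d \<in> coefs ch F"
  shows "(\<lambda>w x y. c w x y + d w x y) \<in> coefs ch F"
  using sum_coefs[of "UNIV :: bool set" "\<lambda>b. if b then c else d" ch F] assms
  by (simp add: UNIV_bool add.commute)

lemma scale_coefs:
  assumes c: "c \<in> coefs ch F"
  shows "(\<lambda>w x y. a * c w x y) \<in> coefs ch F"
proof -
  have "{u. (\<lambda>x y. a * c u x y) \<noteq> (\<lambda>_ _. 0)} \<subseteq> {u. c u \<noteq> (\<lambda>_ _. 0)}" by auto
  then show ?thesis
    using coefsD[OF c] finite_subset unfolding coefs_def by (auto intro!: kspace_scale)
qed

lemma unit_coefs: "elt runit (ket []) (ket []) \<in> coefs ch F"
  using runit_Irr Fob_runit
  by (intro elt_coefs ket_ell2) (simp_all add: hunit_def runit_def)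

lemma alg_simps:
  "add alg c d = (\<lambda>w x y. c w x y + d w x y)" "scl alg a c = (\<lambda>w x y. a * c w x y)"
  "mul alg c d = coef_mult ch F c d" "str alg c = coef_star ch J c" "unt alg = elt runit (ket []) (ket [])"
  by (simp_all add: coef_alg_def)

lemma closed_alg: "closed_star_alg alg"
  unfolding closed_star_alg_def carr alg_simps
  by (intro conjI ballI allI add_coefs scale_coefs coef_mult_coefs coef_star_coefs unit_coefs)

end

section \<open>Transport of coefficients along the natural transformation\<close>

locale coef_map = F: coef_data ch F JF + G: coef_data ch G JG
  for ch :: "'a::cstar_algebra choices" and F :: "('a, 'i) qfunctor" and JF
    and G :: "('a, 'j) qfunctor" and JG +
  fixes U :: "'a rep \<Rightarrow> ('i, 'j) opr"
  assumes U: "u \<in> Irr ch \<Longrightarrow> unitary_op (Fob F u) (Fob G u) (U u)"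
    and mul_compat: "u \<in> Irr ch \<Longrightarrow> v \<in> Irr ch \<Longrightarrow> (z, s) \<in> set (dec ch u v) \<Longrightarrow>
      f \<in> ell2 (Fob F u) \<Longrightarrow> g \<in> ell2 (Fob F v) \<Longrightarrow>
      U z (mul_op F u v z s (vtens (Fob F u) f g)) = mul_op G u v z s (vtens (Fob G u) (U u f) (U v g))"
    and star_compat: "u \<in> hat ch F \<Longrightarrow> f \<in> ell2 (Fob F u) \<Longrightarrow> U (cj ch u) (JF u f) = JG u (U u f)"
    and unit_compat: "U runit (ket []) = ket []"
begin

text \<open>The guard gives the value zero off \<open>Irr ch\<close>, where nothing is assumed about
  \<open>U w\<close>. The second factor is left alone because H_u and all data on it are shared by
  the two functors.\<close>

definition transport :: "('a rep \<Rightarrow> 'i kernel) \<Rightarrow> ('a rep \<Rightarrow> 'j kernel)" where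
  "transport c = (\<lambda>w. if w \<in> Irr ch then kern_map (U w) id (c w) else (\<lambda>_ _. 0))"

definition transport_inv :: "('a rep \<Rightarrow> 'j kernel) \<Rightarrow> ('a rep \<Rightarrow> 'i kernel)" where
  "transport_inv d = (\<lambda>w. if w \<in> Irr ch then kern_map (adj (Fob F w) (Fob G w) (U w)) id (d w) else (\<lambda>_ _. 0))"

lemma U_bop: "u \<in> Irr ch \<Longrightarrow> U u \<in> bop (Fob F u) (Fob G u)"
  using unitary_opD(1)[OF U] .

lemma U_inv_bop: "u \<in> Irr ch \<Longrightarrow> adj (Fob F u) (Fob G u) (U u) \<in> bop (Fob G u) (Fob F u)"
  using adj_bop[OF U_bop] .

lemma transport_coefs:
  assumes c: "c \<in> coefs ch F" shows "transport c \<in> coefs ch G"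
proof -
  have "{u. transport c u \<noteq> (\<lambda>_ _. 0)} \<subseteq> {u. c u \<noteq> (\<lambda>_ _. 0)}"
    using kern_map_id_zero[OF U_bop] by (auto simp: transport_def split: if_splits)
  then have "finite {u. transport c u \<noteq> (\<lambda>_ _. 0)}" using F.coefsD(1)[OF c] by (rule finite_subset)
  then show ?thesis
    using kern_map_id_kspace[OF U_bop F.coefsD(2)[OF c]] by (auto simp: coefs_def transport_def kspace_zero)
qed

lemma transport_inv_coefs:
  assumes d: "d \<in> coefs ch G" shows "transport_inv d \<in> coefs ch F"
proof -
  have "{u. transport_inv d u \<noteq> (\<lambda>_ _. 0)} \<subseteq> {u. d u \<noteq> (\<lambda>_ _. 0)}"
    using kern_map_id_zero[OF U_inv_bop] by (auto simp: transport_inv_def split: if_splits)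
  then have "finite {u. transport_inv d u \<noteq> (\<lambda>_ _. 0)}" using G.coefsD(1)[OF d] by (rule finite_subset)
  then show ?thesis
    using kern_map_id_kspace[OF U_inv_bop G.coefsD(2)[OF d]] by (auto simp: coefs_def transport_inv_def kspace_zero)
qed

lemma transport_inv_transport:
  assumes c: "c \<in> coefs ch F" shows "transport_inv (transport c) = c"
proof
  fix w
  show "transport_inv (transport c) w = c w"
  proof (cases "w \<in> Irr ch")
    case True
    have "kern_map (adj (Fob F w) (Fob G w) (U w)) id (kern_map (U w) id (c w)) x y = c w x y" for x y
      unfolding kern_map_id[of "adj _ _ _"] col_kern_map_id
      using unitary_opD(2)[OF U[OF True] kspace_col[OF F.coefsD(2)[OF c]]] by simp
    then show ?thesis using True by (simp add: transport_def transport_inv_def fun_eq_iff)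
  next
    case False
    then have "c w = (\<lambda>_ _. 0)" using F.coefsD(3)[OF c, of w] by blast
    then show ?thesis using False by (simp add: transport_inv_def)
  qed
qed

lemma transport_transport_inv:
  assumes d: "d \<in> coefs ch G" shows "transport (transport_inv d) = d"
proof
  fix w
  show "transport (transport_inv d) w = d w"
  proof (cases "w \<in> Irr ch")
    case True
    have "kern_map (U w) id (kern_map (adj (Fob F w) (Fob G w) (U w)) id (d w)) x y = d w x y" for x y
      unfolding kern_map_id[of "U w"] col_kern_map_id
      using unitary_opD(3)[OF U[OF True] kspace_col[OF G.coefsD(2)[OF d]]] by simp
    then show ?thesis using True by (simp add: transport_def transport_inv_def fun_eq_iff)
  next
    case False
    then have "d w = (\<lambda>_ _. 0)" using G.coefsD(3)[OF d, of w] by blast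
    then show ?thesis using False by (simp add: transport_def)
  qed
qed

text \<open>Equal supports make the index sets of the sums for product and involution literally the
  same before and after transport, so the sums can be compared term by term.\<close>

lemma transport_supp:
  assumes c: "c \<in> coefs ch F"
  shows "transport c u \<noteq> (\<lambda>_ _. 0) \<longleftrightarrow> c u \<noteq> (\<lambda>_ _. 0)"
proof -
  have "transport c u = (\<lambda>_ _. 0)" if "c u = (\<lambda>_ _. 0)"
    using that kern_map_id_zero[OF U_bop] by (simp add: transport_def)
  moreover have "c u = (\<lambda>_ _. 0)" if "transport c u = (\<lambda>_ _. 0)"
  proof -
    have "c u = transport_inv (transport c) u" using transport_inv_transport[OF c] by simp
    also have "\<dots> = (\<lambda>_ _. 0)"
      using that kern_map_id_zero[OF U_inv_bop] by (simp add: transport_inv_def)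
    finally show ?thesis .
  qed
  ultimately show ?thesis by blast
qed

lemma transport_elt:
  assumes u: "u \<in> Irr ch" and T: "T \<in> ell2 (Fob F u)"
  shows "transport (elt u T \<phi>) = elt u (U u T) \<phi>"
proof (intro ext)
  fix w x y
  have "kern_map (U u) id (kern T \<phi>) x y = kern (U u T) \<phi> x y"
    using bop_scale[OF U_bop[OF u] T, of "cnj (\<phi> y)"] by (simp add: kern_map_id kern_def mult.commute)
  then show "transport (elt u T \<phi>) w x y = elt u (U u T) \<phi> w x y"
    using u kern_map_id_zero[OF U_bop] by (simp add: transport_def elt_def)
qed

lemma transport_unit: "transport (elt runit (ket []) (ket [])) = elt runit (ket []) (ket [])"
  using F.runit_Irr F.Fob_runit unit_compat by (simp add: transport_elt ket_ell2 hunit_def)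

lemma transport_add:
  assumes c: "c \<in> coefs ch F" and d: "d \<in> coefs ch F"
  shows "transport (\<lambda>w x y. c w x y + d w x y) = (\<lambda>w x y. transport c w x y + transport d w x y)"
  using kspace_col[OF F.coefsD(2)[OF c]] kspace_col[OF F.coefsD(2)[OF d]]
  by (auto simp: transport_def kern_map_id fun_eq_iff bop_add[OF U_bop])

lemma transport_scale:
  assumes c: "c \<in> coefs ch F"
  shows "transport (\<lambda>w x y. a * c w x y) = (\<lambda>w x y. a * transport c w x y)"
  using kspace_col[OF F.coefsD(2)[OF c]]
  by (auto simp: transport_def kern_map_id fun_eq_iff bop_scale[OF U_bop])

text \<open>Reduces compatibility with the product and with the involution alike to an identity
  between single terms.\<close>

lemma transport_sum_single:
  assumes "finite P" and "\<And>p. p \<in> P \<Longrightarrow> tg p \<in> Irr ch \<and> k p \<in> kspace (Fob F (tg p)) (sp (tg p))"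
    and "\<And>p. p \<in> P \<Longrightarrow> kern_map (U (tg p)) id (k p) = l p"
  shows "transport (\<lambda>w x y. \<Sum>p\<in>P. if w = tg p then k p x y else 0) =
    (\<lambda>w x y. \<Sum>p\<in>P. if w = tg p then l p x y else 0)"
proof
  fix w
  show "transport (\<lambda>w x y. \<Sum>p\<in>P. if w = tg p then k p x y else 0) w =
    (\<lambda>x y. \<Sum>p\<in>P. if w = tg p then l p x y else 0)"
  proof (cases "w \<in> Irr ch")
    case True
    have "kern_map (U w) id (\<lambda>x y. \<Sum>p\<in>P. if w = tg p then k p x y else 0) =
        (\<lambda>x y. \<Sum>p\<in>P. kern_map (U w) id (\<lambda>x y. if w = tg p then k p x y else 0) x y)"
    proof (rule kern_map_id_sum[OF U_bop[OF True]])
      show "(\<lambda>x y. if w = tg p then k p x y else 0) \<in> kspace (Fob F w) (sp w)" if "p \<in> P" for p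
        using assms(2)[OF that] by (cases "w = tg p") (simp_all add: kspace_zero)
    qed
    also have "\<dots> = (\<lambda>x y. \<Sum>p\<in>P. if w = tg p then l p x y else 0)"
      using assms(3) kern_map_id_zero[OF U_bop[OF True]] by (intro ext sum.cong) auto
    finally show ?thesis using True by (simp add: transport_def)
  next
    case False
    then have "w \<noteq> tg p" if "p \<in> P" for p using assms(2)[OF that] by blast
    then show ?thesis using False by (simp add: transport_def)
  qed
qed

lemma transport_mult:
  assumes c: "c \<in> coefs ch F" and d: "d \<in> coefs ch F"
  shows "transport (coef_mult ch F c d) = coef_mult ch G (transport c) (transport d)"
proof -
  note tc = transport_coefs[OF c] and td = transport_coefs[OF d]
  have ix: "mul_ix ch (transport c) (transport d) = mul_ix ch c d"
    by (simp add: mul_ix_def transport_supp c d)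
  have "kern_map (U (mul_tgt ch p)) id (mul_term ch F c d p) = mul_term ch G (transport c) (transport d) p"
    if p: "p \<in> mul_ix ch c d" for p
  proof -
    obtain u v i z s where uv: "p = (u, v, i)" "u \<in> Irr ch" "v \<in> Irr ch" "(z, s) \<in> set (dec ch u v)" "mul_tgt ch p = z"
      and t: "dec ch u v ! i = (z, s)" "mul_term ch F c d p = kern_map (mul_op F u v z s) (adj (sp z) (sp (u \<otimes>\<^sub>r v)) s)
         (kern_tens (ar (Fob F u)) (ar (sp u)) (c u) (d v))"
      by (rule F.mul_ix_cases[OF c d p]) iprover
    have t': "mul_term ch G (transport c) (transport d) p = kern_map (mul_op G u v z s) (adj (sp z) (sp (u \<otimes>\<^sub>r v)) s)
         (kern_tens (ar (Fob G u)) (ar (sp u)) (transport c u) (transport d v))"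
      by (simp add: mul_term_def uv(1) t(1))
    let ?kF = "kern_tens (ar (Fob F u)) (ar (sp u)) (c u) (d v)"
    let ?kG = "kern_tens (ar (Fob G u)) (ar (sp u)) (transport c u) (transport d v)"
    let ?A = "mul_op F u v z s" and ?B = "adj (sp z) (sp (u \<otimes>\<^sub>r v)) s"
    note op = F.mul_op_bop[OF uv(2-4)] G.mul_op_bop[OF uv(2-4)] F.dec_bop[OF uv(2-4)]
    have fin: "finite (ix (sp u \<otimes>\<^sub>h sp v))" using uv F.fin by (intro finite_htens)
    have z: "z \<in> Irr ch" using F.dec_Irr uv by blast
    have "kern_map (U z) id (kern_map ?A ?B ?kF) x y' = kern_map (mul_op G u v z s) ?B ?kG x y'" for x y'
    proof -
      have "kern_map (U z) id (kern_map ?A ?B ?kF) x y' =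
          (\<Sum>y\<in>ix (sp u \<otimes>\<^sub>h sp v). cnj (U z (?A (col ?kF y)) x) * ?B (ket y) y')"
        by (rule kern_map_id_expand[OF U_bop[OF z] bop_in_ell2[OF op(1)]
              kern_map_expand[OF op(1,3) fin F.kern_tens_coefs[OF c d]]])
      also have "\<dots> = (\<Sum>y\<in>ix (sp u \<otimes>\<^sub>h sp v). cnj (mul_op G u v z s (col ?kG y) x) * ?B (ket y) y')"
      \<comment> \<open>Every conjugated column of the tensor of two kernels is an elementary tensor
        of their columns, so \<open>mul_compat\<close> on elementary tensors suffices.\<close>
      proof (intro sum.cong refl)
        fix y
        have "U z (?A (col ?kF y)) = mul_op G u v z s (col ?kG y)"
          unfolding col_kern_tens
          using mul_compat[OF uv(2-4) kspace_col[OF F.coefsD(2)[OF c]] kspace_col[OF F.coefsD(2)[OF d]]] uv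
          by (simp add: transport_def col_kern_map_id)
        then show "cnj (U z (?A (col ?kF y)) x) * ?B (ket y) y' = cnj (mul_op G u v z s (col ?kG y) x) * ?B (ket y) y'"
          by (simp only:)
      qed
      also have "\<dots> = kern_map (mul_op G u v z s) ?B ?kG x y'"
        by (rule kern_map_expand[OF op(2,3) fin G.kern_tens_coefs[OF tc td], symmetric])
      finally show ?thesis .
    qed
    then show ?thesis unfolding uv(5) t(2) t' by blast
  qed
  then show ?thesis
    unfolding coef_mult_eq[OF F.coefsD(1)[OF c] F.coefsD(1)[OF d]]
      coef_mult_eq[OF G.coefsD(1)[OF tc] G.coefsD(1)[OF td]] ix
    by (intro transport_sum_single F.finite_mul_ix[OF c d] conjI F.mul_term_kspace[OF c d])
qed

lemma transport_star:
  assumes c: "c \<in> coefs ch F"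
  shows "transport (coef_star ch JF c) = coef_star ch JG (transport c)"
proof -
  note tc = transport_coefs[OF c]
  have "kern_map (U (cj ch u)) id (kern_amap (JF u) (star_op ch u) (c u)) = kern_amap (JG u) (star_op ch u) (transport c u)"
    if u: "u \<in> {u. c u \<noteq> (\<lambda>_ _. 0)}" for u
  proof (intro ext)
    fix x y'
    have hat: "u \<in> hat ch F" "u \<in> hat ch G" and Irr: "u \<in> Irr ch"
      using u coefs_hat[OF c] coefs_hat[OF tc] transport_supp[OF c] F.coefsD(3)[OF c] by blast+
    note k = F.coefsD(2)[OF c, of u] and tk = G.coefsD(2)[OF tc, of u]
    have "kern_map (U (cj ch u)) id (kern_amap (JF u) (star_op ch u) (c u)) x y' =
        (\<Sum>y\<in>ix (sp u). cnj (U (cj ch u) (JF u (col (c u) y)) x) * star_op ch u (ket y) y')"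
      by (rule kern_map_id_expand[OF U_bop[OF F.cj_Irr[OF Irr]] abop_in_ell2[OF F.J_abop[OF hat(1)]]
            kern_amap_expand[OF F.J_abop[OF hat(1)] F.star_op_abop[OF Irr] F.fin[OF Irr] k]])
    also have "\<dots> = (\<Sum>y\<in>ix (sp u). cnj (JG u (col (transport c u) y) x) * star_op ch u (ket y) y')"
      using Irr by (simp add: transport_def col_kern_map_id star_compat[OF hat(1) kspace_col[OF k]])
    also have "\<dots> = kern_amap (JG u) (star_op ch u) (transport c u) x y'"
      by (rule kern_amap_expand[OF G.J_abop[OF hat(2)] F.star_op_abop[OF Irr] F.fin[OF Irr] tk, symmetric])
    finally show "kern_map (U (cj ch u)) id (kern_amap (JF u) (star_op ch u) (c u)) x y' =
      kern_amap (JG u) (star_op ch u) (transport c u) x y'" .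
  qed
  then show ?thesis
    unfolding F.coef_star_eq G.coef_star_eq transport_supp[OF c]
    using F.star_term_kspace[OF c] F.cj_Irr F.coefsD(3)[OF c] F.coefsD(1)[OF c]
    by (intro transport_sum_single) auto
qed

lemma transport_hom:
  assumes "star_alg_hom G.alg \<iota>"
  shows "star_alg_hom F.alg (\<iota> \<circ> transport)"
  using assms transport_coefs
  by (simp add: star_alg_hom_def F.carr G.carr F.alg_simps G.alg_simps transport_add transport_scale
      transport_mult transport_star transport_unit)

text \<open>Follows formally from the laws of \<open>transport\<close> by cancelling it, without
  computing with the adjoints of \<open>U\<close>.\<close>

lemma transport_inv_ops:
  assumes c: "c \<in> coefs ch G" and d: "d \<in> coefs ch G"
  shows "transport_inv (add G.alg c d) = add F.alg (transport_inv c) (transport_inv d)"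
    and "transport_inv (scl G.alg a c) = scl F.alg a (transport_inv c)"
    and "transport_inv (mul G.alg c d) = mul F.alg (transport_inv c) (transport_inv d)"
    and "transport_inv (str G.alg c) = str F.alg (transport_inv c)"
    and "transport_inv (unt G.alg) = unt F.alg"
proof -
  let ?c = "transport_inv c" and ?d = "transport_inv d"
  have *: "?c \<in> coefs ch F" "?d \<in> coefs ch F" "transport ?c = c" "transport ?d = d"
    using c d by (simp_all add: transport_inv_coefs transport_transport_inv)
  show "transport_inv (add G.alg c d) = add F.alg ?c ?d"
    using transport_inv_transport[OF F.add_coefs[OF *(1,2)]]
    by (simp add: F.alg_simps G.alg_simps transport_add *)
  show "transport_inv (scl G.alg a c) = scl F.alg a ?c"
    using transport_inv_transport[OF F.scale_coefs[OF *(1), of a]]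
    by (simp add: F.alg_simps G.alg_simps transport_scale *)
  show "transport_inv (mul G.alg c d) = mul F.alg ?c ?d"
    using transport_inv_transport[OF F.coef_mult_coefs[OF *(1,2)]]
    by (simp add: F.alg_simps G.alg_simps transport_mult *)
  show "transport_inv (str G.alg c) = str F.alg ?c"
    using transport_inv_transport[OF F.coef_star_coefs[OF *(1)]]
    by (simp add: F.alg_simps G.alg_simps transport_star *)
  show "transport_inv (unt G.alg) = unt F.alg"
    using transport_inv_transport[OF F.unit_coefs]
    by (simp add: F.alg_simps G.alg_simps transport_unit)
qed

lemma transport_inv_hom:
  assumes "star_alg_hom F.alg \<iota>"
  shows "star_alg_hom G.alg (\<iota> \<circ> transport_inv)"
  using assms transport_inv_coefs G.closed_alg
  by (simp add: star_alg_hom_def F.carr G.carr transport_inv_ops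
      transport_inv_ops(5)[OF G.unit_coefs G.unit_coefs])

text \<open>Each norm is dominated by the other one, both being maximal.\<close>

lemma completion_iso:
  assumes F: "maximal_completion F.alg \<iota>F" and G: "maximal_completion G.alg \<iota>G"
  obtains \<alpha> where "star_iso \<alpha>" "\<And>c. c \<in> coefs ch F \<Longrightarrow> \<alpha> (\<iota>F c) = \<iota>G (transport c)"
proof -
  have hom: "star_alg_hom F.alg \<iota>F" "star_alg_hom G.alg \<iota>G"
    and dense: "closure (\<iota>F ` coefs ch F) = UNIV" "closure (\<iota>G ` coefs ch G) = UNIV"
    and maxF: "cstar_seminorm F.alg p \<Longrightarrow> c \<in> coefs ch F \<Longrightarrow> p c \<le> norm (\<iota>F c)"
    and maxG: "cstar_seminorm G.alg q \<Longrightarrow> d \<in> coefs ch G \<Longrightarrow> q d \<le> norm (\<iota>G d)" for p c q d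
    using F G by (auto simp: maximal_completion_def maximal_cstar_seminorm_def F.carr G.carr)
  have "norm (\<iota>F c) = norm ((\<iota>G \<circ> transport) c)" if c: "c \<in> carr F.alg" for c
  proof (rule antisym)
    show "norm ((\<iota>G \<circ> transport) c) \<le> norm (\<iota>F c)"
      using maxF[OF cstar_seminorm_hom[OF transport_hom[OF hom(2)] F.closed_alg]] c F.carr by blast
    have "norm ((\<iota>F \<circ> transport_inv) (transport c)) \<le> norm (\<iota>G (transport c))"
      using maxG[OF cstar_seminorm_hom[OF transport_inv_hom[OF hom(1)] G.closed_alg]] transport_coefs c F.carr
      by blast
    then show "norm (\<iota>F c) \<le> norm ((\<iota>G \<circ> transport) c)"
      using c by (simp add: F.carr transport_inv_transport)
  qed
  moreover have "closure ((\<iota>G \<circ> transport) ` carr F.alg) = UNIV"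
  proof -
    have "transport ` coefs ch F = coefs ch G"
      using transport_coefs transport_inv_coefs transport_transport_inv by (metis subsetI image_subsetI rev_image_eqI subset_antisym)
    then show ?thesis using dense(2) by (simp only: F.carr image_comp[symmetric])
  qed
  moreover have "closure (\<iota>F ` carr F.alg) = UNIV" using dense(1) F.carr by simp
  ultimately obtain \<alpha> where "star_iso \<alpha>" "\<And>c. c \<in> carr F.alg \<Longrightarrow> \<alpha> (\<iota>F c) = (\<iota>G \<circ> transport) c"
    using isometric_star_iso[OF F.closed_alg hom(1) transport_hom[OF hom(2)]] by blast
  then show thesis using that F.carr by simp
qed

end

lemma (in coef_data) span_elt:
  assumes \<iota>: "star_alg_hom alg \<iota>" and c: "c \<in> coefs ch F"
  shows "\<iota> c \<in> cspan {\<iota> (elt u T \<phi>) | u T \<phi>. u \<in> hat ch F \<and> T \<in> ell2 (Fob F u) \<and> \<phi> \<in> ell2 (sp u)}" (is "_ \<in> cspan ?S")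
proof -
  obtain n u T \<phi> where c: "c = (\<lambda>w x y. \<Sum>k<(n::nat). elt (u k) (T k) (\<phi> k) w x y)"
    and k: "\<forall>k<n. u k \<in> hat ch F \<and> T k \<in> ell2 (Fob F (u k)) \<and> \<phi> k \<in> ell2 (sp (u k))"
    using c unfolding carr[symmetric] coef_alg_def by auto
  have "\<iota> (\<lambda>w x y. \<Sum>k<m. elt (u k) (T k) (\<phi> k) w x y) \<in> cspan ?S" if "m \<le> n" for m
    using that
  proof (induction m)
    case 0
    \<comment> \<open>\<open>star_alg_hom\<close> does not mention zero, which is therefore written
      as 0 times the unit.\<close>
    have "\<iota> (scl alg 0 (unt alg)) = 0 *\<^sub>C \<iota> (unt alg)"
      using \<iota> unit_coefs by (simp only: star_alg_hom_def carr alg_simps)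
    then have "\<iota> (\<lambda>_ _ _. 0) = 0" by (simp add: alg_simps)
    then show ?case by (simp add: cstar_vec.span_zero)
  next
    case (Suc m)
    let ?c = "\<lambda>w x y. \<Sum>k<m. elt (u k) (T k) (\<phi> k) w x y" and ?e = "elt (u m) (T m) (\<phi> m)"
    have e: "?e \<in> coefs ch F" using Suc.prems k by (intro elt_coefs) (auto simp: hat_def)
    have "?c \<in> coefs ch F"
      using Suc.prems k by (intro sum_coefs elt_coefs) (auto simp: hat_def)
    then have "\<iota> (add alg ?c ?e) = \<iota> ?c + \<iota> ?e"
      using \<iota> e by (simp only: star_alg_hom_def carr)
    then have eq: "\<iota> (\<lambda>w x y. \<Sum>k<Suc m. elt (u k) (T k) (\<phi> k) w x y) = \<iota> ?c + \<iota> ?e"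
      by (simp add: alg_simps)
    have "\<iota> ?e \<in> ?S" using Suc.prems k[rule_format, of m] by auto
    then show ?case
      unfolding eq using Suc by (intro cstar_vec.span_add cstar_vec.span_base[of "\<iota> ?e"]) simp_all
  qed
  then show ?thesis unfolding c by blast
qed

section \<open>From quasitensor functors and transformations to coefficient data\<close>

lemma unitary_op_trivial:
  assumes V: "unitary_op H K V"
  shows "ix H = {} \<longleftrightarrow> ix K = {}"
proof -
  have zero: "f = (\<lambda>_. 0)" if "f \<in> ell2 L" "ix L = {}" for f :: "'z vct" and L
    using that by (auto simp: ell2_def)
  note b = unitary_opD(1)[OF V]
  note b' = adj_bop[OF b]
  have "ix K = {}" if H: "ix H = {}"
  proof (rule ccontr)
    assume "ix K \<noteq> {}"
    then obtain w where "w \<in> ix K" by blast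
    then have "ket w = V (adj H K V (ket w))" using unitary_opD(3)[OF V ket_ell2] by simp
    also have "\<dots> = (\<lambda>_. 0)" using zero[OF bop_in_ell2[OF b'] H] bop_zero[OF b] by simp
    finally have "ket w w = (0::complex)" by (rule fun_cong)
    then show False by (simp add: ket_def)
  qed
  moreover have "ix H = {}" if K: "ix K = {}"
  proof (rule ccontr)
    assume "ix H \<noteq> {}"
    then obtain w where "w \<in> ix H" by blast
    then have "ket w = adj H K V (V (ket w))" using unitary_opD(2)[OF V ket_ell2] by simp
    also have "\<dots> = (\<lambda>_. 0)" using zero[OF bop_in_ell2[OF b] K] bop_zero[OF b'] by simp
    finally have "ket w w = (0::complex)" by (rule fun_cong)
    then show False by (simp add: ket_def)
  qed
  ultimately show ?thesis by blast
qed

text \<open>\<open>V\<close> is onto, so its values test equality; vectors of this form let the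
  computation be pulled back to \<open>H\<close>.\<close>

lemma unitary_ip_eqI:
  assumes V: "unitary_op H K V" and "f \<in> ell2 K" "g \<in> ell2 K"
    and eq: "\<And>h. h \<in> ell2 H \<Longrightarrow> ip (V h) f = ip (V h) g"
  shows "f = g"
proof (rule ell2_eqI[OF assms(2,3)])
  fix w assume "w \<in> ix K"
  then have "V (adj H K V (ket w)) = ket w" by (rule unitary_opD(3)[OF V ket_ell2])
  then show "f w = g w"
    using eq[OF bop_in_ell2[OF adj_bop[OF unitary_opD(1)[OF V]], of "ket w"]] by simp
qed

text \<open>The product involves the adjoint of F(s), whereas naturality is used for s itself. As
  \<open>V\<close> and \<open>V'\<close> are unitary, taking adjoints of the intertwining relation
  gives the one required.\<close>

lemma adj_intertwine:
  assumes V: "unitary_op H K V" and V': "unitary_op H' K' V'" and A: "A \<in> bop H H'" and B: "B \<in> bop K K'"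
    and eq: "\<And>f. f \<in> ell2 H \<Longrightarrow> B (V f) = V' (A f)" and g: "g \<in> ell2 H'"
  shows "V (adj H H' A g) = adj K K' B (V' g)"
proof (rule unitary_ip_eqI[OF V])
  note Vb = unitary_opD(1)[OF V] and V'b = unitary_opD(1)[OF V']
  show "V (adj H H' A g) \<in> ell2 K" "adj K K' B (V' g) \<in> ell2 K"
    by (intro bop_in_ell2[OF Vb] bop_in_ell2[OF adj_bop[OF B]])+
  fix h assume h: "h \<in> ell2 H"
  have "ip (V h) (V (adj H H' A g)) = ip (A h) g"
    using unitary_op_ip[OF V h bop_in_ell2[OF adj_bop[OF A]]] ip_adj[OF A h g] by simp
  also have "\<dots> = ip (V' (A h)) (V' g)"
    using unitary_op_ip[OF V' bop_in_ell2[OF A] g] by simp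
  also have "\<dots> = ip (B (V h)) (V' g)" by (simp only: eq[OF h])
  also have "\<dots> = ip (V h) (adj K K' B (V' g))"
    by (rule ip_adj[OF B bop_in_ell2[OF Vb] bop_in_ell2[OF V'b]])
  finally show "ip (V h) (V (adj H H' A g)) = ip (V h) (adj K K' B (V' g))" .
qed

lemma aadj_inv_abop:
  assumes j: "j \<in> abop H K" "bij_betw j (ell2 H) (ell2 K)" and fin: "finite (ix K)"
  shows "aadj K H (the_inv_into (ell2 H) j) \<in> abop H K"
proof (rule aadj_abop)
  let ?i = "the_inv_into (ell2 H) j"
  have i: "?i f \<in> ell2 H" "j (?i f) = f" if "f \<in> ell2 K" for f
    using j(2) that by (simp_all add: bij_betw_def the_inv_into_into f_the_inv_into_f)
  have ij: "?i (j f) = f" if "f \<in> ell2 H" for f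
    using j(2) that by (simp add: bij_betw_def the_inv_into_f_f)
  \<comment> \<open>The truncation by zero lies in \<open>abop\<close> and agrees with the inverse
    on \<open>ell2 K\<close>, as \<open>aadj_abop\<close> requires.\<close>
  show "(\<lambda>f. if f \<in> ell2 K then ?i f else (\<lambda>_. 0)) \<in> abop K H"
  proof (rule antilinear_finite_abop[OF fin])
    fix f g assume f: "f \<in> ell2 K" and g: "g \<in> ell2 K"
    show "?i (\<lambda>w. f w + g w) = (\<lambda>w. ?i f w + ?i g w)"
      using ij[OF ell2_add(1)[OF i(1)[OF f] i(1)[OF g]]] abop_add[OF j(1) i(1)[OF f] i(1)[OF g]]
      by (simp add: i(2) f g)
  next
    fix f c assume f: "f \<in> ell2 K"
    show "?i (\<lambda>w. c * f w) = (\<lambda>w. cnj c * ?i f w)"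
      using ij[OF ell2_scale[OF i(1)[OF f], of "cnj c"]] abop_scale[OF j(1) i(1)[OF f], of "cnj c"]
      by (simp add: i(2) f)
  qed (rule i(1))
qed simp

context
  fixes t :: "'a::cstar_algebra \<Rightarrow> 'a \<Rightarrow> 'aa::cstar_algebra" and \<Delta> :: "'a \<Rightarrow> 'aa" and ch :: "'a choices"
  assumes t: "cstar_tensor t" and \<Delta>: "star_hom \<Delta>" and ch: "valid_choices t \<Delta> ch"
begin

lemma valid_choicesD:
  assumes "u \<in> Irr ch"
  shows "unitary_rep t \<Delta> u" "finite (ix (sp u))" "cj ch u \<in> Irr ch"
    "cR ch u \<in> arrows runit (cj ch u \<otimes>\<^sub>r u)"
    "cjm ch u \<in> abop (sp u) (sp (cj ch u))" "bij_betw (cjm ch u) (ell2 (sp u)) (ell2 (sp (cj ch u)))"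
  using ch assms
  by (auto simp: valid_choices_def complete_irreducibles_def irreducible_rep_def unitary_rep_def
      conjugate_solution_def represents_vector_def)

lemma valid_choices_dec:
  assumes "u \<in> Irr ch" "v \<in> Irr ch" "(z, s) \<in> set (dec ch u v)"
  shows "z \<in> Irr ch" "s \<in> arrows z (u \<otimes>\<^sub>r v)" "isometric (sp z) (sp (u \<otimes>\<^sub>r v)) s"
proof -
  have "\<forall>(z, s)\<in>set (dec ch u v). z \<in> Irr ch \<and> s \<in> arrows z (u \<otimes>\<^sub>r v) \<and> isometric (sp z) (sp (u \<otimes>\<^sub>r v)) s"
    using ch assms(1,2) unfolding valid_choices_def by blast
  then show "z \<in> Irr ch" "s \<in> arrows z (u \<otimes>\<^sub>r v)" "isometric (sp z) (sp (u \<otimes>\<^sub>r v)) s"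
    using assms(3) by auto
qed

lemma runit_Irr: "runit \<in> Irr ch"
  using ch by (simp add: valid_choices_def complete_irreducibles_def)

lemmas rtens_unitary = unitary_rep_rtens[OF t \<Delta>]

lemma quasitensor_functorD:
  assumes "quasitensor_functor t \<Delta> F" "unitary_rep t \<Delta> u" "unitary_rep t \<Delta> v"
  shows "wf_hilb (Fob F u)" "T \<in> arrows u v \<Longrightarrow> Fmor F u v T \<in> bop (Fob F u) (Fob F v)"
    "Fs F u v \<in> bop (Fob F u \<otimes>\<^sub>h Fob F v) (Fob F (u \<otimes>\<^sub>r v))"
proof -
  show "wf_hilb (Fob F u)" "T \<in> arrows u v \<Longrightarrow> Fmor F u v T \<in> bop (Fob F u) (Fob F v)"
    using assms by (simp_all add: quasitensor_functor_def star_functor_def)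
  show "Fs F u v \<in> bop (Fob F u \<otimes>\<^sub>h Fob F v) (Fob F (u \<otimes>\<^sub>r v))"
    using assms by (intro isometricD(1)) (simp add: quasitensor_functor_def)
qed

lemma mul_op_parts:
  assumes F: "quasitensor_functor t \<Delta> F" and u: "u \<in> Irr ch" and v: "v \<in> Irr ch" and zs: "(z, s) \<in> set (dec ch u v)"
  shows "Fmor F z (u \<otimes>\<^sub>r v) s \<in> bop (Fob F z) (Fob F (u \<otimes>\<^sub>r v))"
    "Fs F u v \<in> bop (Fob F u \<otimes>\<^sub>h Fob F v) (Fob F (u \<otimes>\<^sub>r v))"
  using quasitensor_functorD(2)[OF F valid_choicesD(1)[OF valid_choices_dec(1)[OF u v zs]]
      rtens_unitary[OF valid_choicesD(1)[OF u] valid_choicesD(1)[OF v]] valid_choices_dec(2)[OF u v zs]]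
    quasitensor_functorD(3)[OF F valid_choicesD(1)[OF u] valid_choicesD(1)[OF v]] by simp_all

lemma coef_data_functor:
  assumes F: "quasitensor_functor t \<Delta> F" and J: "functor_conjugation ch F J"
  shows "coef_data ch F J"
proof
  show "finite (ix (sp u))" if "u \<in> Irr ch" for u using valid_choicesD(2)[OF that] .
  show "cj ch u \<in> Irr ch" if "u \<in> Irr ch" for u using valid_choicesD(3)[OF that] .
  show "z \<in> Irr ch" if "u \<in> Irr ch" "v \<in> Irr ch" "(z, s) \<in> set (dec ch u v)" for u v z s
    using valid_choices_dec(1)[OF that] .
  show "mul_op F u v z s \<in> bop (Fob F u \<otimes>\<^sub>h Fob F v) (Fob F z)"
    if "u \<in> Irr ch" "v \<in> Irr ch" "(z, s) \<in> set (dec ch u v)" for u v z s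
    unfolding mul_op_def
    by (rule bop_comp[OF mul_op_parts(2)[OF F that] adj_bop[OF mul_op_parts(1)[OF F that]]])
  show "adj (sp z) (sp (u \<otimes>\<^sub>r v)) s \<in> bop (sp u \<otimes>\<^sub>h sp v) (sp z)"
    if "u \<in> Irr ch" "v \<in> Irr ch" "(z, s) \<in> set (dec ch u v)" for u v z s
    using adj_bop[OF isometricD(1)[OF valid_choices_dec(3)[OF that]]] by simp
  show "J u \<in> abop (Fob F u) (Fob F (cj ch u))" if "u \<in> hat ch F" for u
    using J that by (simp add: functor_conjugation_def represents_vector_def)
  show "star_op ch u \<in> abop (sp u) (sp (cj ch u))" if "u \<in> Irr ch" for u
    unfolding star_op_def
    by (rule aadj_inv_abop[OF valid_choicesD(5,6)[OF that] valid_choicesD(2)[OF valid_choicesD(3)[OF that]]])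
  show "runit \<in> Irr ch" by (rule runit_Irr)
  show "Fob F runit = hunit" using F by (simp add: quasitensor_functor_def)
qed

lemma coef_map_transformation:
  assumes F: "quasitensor_functor t \<Delta> F" and G: "quasitensor_functor t \<Delta> G"
    and U: "unitary_quasitensor_transformation t \<Delta> F G U"
    and JF: "functor_conjugation ch F JF" and JG: "functor_conjugation ch G JG"
  shows "coef_map ch F JF G JG U" "hat ch F = hat ch G"
proof -
  have Uu: "unitary_op (Fob F u) (Fob G u) (U u)" if "unitary_rep t \<Delta> u" for u
    using U that by (simp add: unitary_quasitensor_transformation_def)
  note Ub = unitary_opD(1)[OF Uu]
  have nat: "Fmor G u v T (U u f) = U v (Fmor F u v T f)"
    if "unitary_rep t \<Delta> u" "unitary_rep t \<Delta> v" "T \<in> arrows u v" for u v T f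
  proof -
    have "Fmor G u v T \<circ> U u = U v \<circ> Fmor F u v T"
      using U that unfolding unitary_quasitensor_transformation_def by blast
    then show ?thesis by (simp add: fun_eq_iff)
  qed
  \<comment> \<open>The quasitensor identity is evaluated on elementary tensors, where U \<otimes> U
    is explicit.\<close>
  have Us: "U (u \<otimes>\<^sub>r v) (Fs F u v (vtens (Fob F u) f g)) = Fs G u v (vtens (Fob G u) (U u f) (U v g))"
    if u: "unitary_rep t \<Delta> u" and v: "unitary_rep t \<Delta> v" and f: "f \<in> ell2 (Fob F u)" and g: "g \<in> ell2 (Fob F v)"
    for u v f g
  proof -
    have "U (u \<otimes>\<^sub>r v) \<circ> Fs F u v = Fs G u v \<circ> otens (Fob F u) (Fob G u) (Fob F v) (Fob G v) (U u) (U v)"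
      using U u v unfolding unitary_quasitensor_transformation_def by blast
    then have "U (u \<otimes>\<^sub>r v) (Fs F u v (vtens (Fob F u) f g)) =
        Fs G u v (otens (Fob F u) (Fob G u) (Fob F v) (Fob G v) (U u) (U v) (vtens (Fob F u) f g))"
      by (simp add: fun_eq_iff)
    also have "otens (Fob F u) (Fob G u) (Fob F v) (Fob G v) (U u) (U v) (vtens (Fob F u) f g) =
        vtens (Fob G u) (U u f) (U v g)"
      by (rule otens_vtens[OF f g vtens_ell2[OF f g] quasitensor_functorD(1)[OF F u u]
            quasitensor_functorD(1)[OF G u u] quasitensor_functorD(1)[OF G v v] Ub[OF u] Ub[OF v]])
    finally show ?thesis .
  qed
  have U1: "U runit (ket []) = ket []" using U by (simp add: unitary_quasitensor_transformation_def)
  \<comment> \<open>A unitary forces F(u) and G(u) to vanish together.\<close>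
  show hat: "hat ch F = hat ch G"
    using unitary_op_trivial[OF Uu[OF valid_choicesD(1)]] by (auto simp: hat_def)
  interpret F: coef_data ch F JF by (rule coef_data_functor[OF F JF])
  interpret G: coef_data ch G JG by (rule coef_data_functor[OF G JG])
  show "coef_map ch F JF G JG U"
  proof
    show "unitary_op (Fob F u) (Fob G u) (U u)" if "u \<in> Irr ch" for u
      using Uu[OF valid_choicesD(1)[OF that]] .
    show "U runit (ket []) = ket []" by (rule U1)
  next
    fix u v z s f g
    assume u: "u \<in> Irr ch" and v: "v \<in> Irr ch" and zs: "(z, s) \<in> set (dec ch u v)"
      and f: "f \<in> ell2 (Fob F u)" and g: "g \<in> ell2 (Fob F v)"
    note z = valid_choices_dec[OF u v zs]
    note ru = valid_choicesD(1)[OF u] and rv = valid_choicesD(1)[OF v] and rz = valid_choicesD(1)[OF z(1)]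
    note ruv = rtens_unitary[OF ru rv]
    have "U z (adj (Fob F z) (Fob F (u \<otimes>\<^sub>r v)) (Fmor F z (u \<otimes>\<^sub>r v) s) (Fs F u v (vtens (Fob F u) f g))) =
        adj (Fob G z) (Fob G (u \<otimes>\<^sub>r v)) (Fmor G z (u \<otimes>\<^sub>r v) s) (U (u \<otimes>\<^sub>r v) (Fs F u v (vtens (Fob F u) f g)))"
      by (rule adj_intertwine[OF Uu[OF rz] Uu[OF ruv] mul_op_parts(1)[OF F u v zs] mul_op_parts(1)[OF G u v zs]
            nat[OF rz ruv z(2)] bop_in_ell2[OF mul_op_parts(2)[OF F u v zs]]])
    then show "U z (mul_op F u v z s (vtens (Fob F u) f g)) = mul_op G u v z s (vtens (Fob G u) (U u f) (U v g))"
      by (simp add: mul_op_def Us[OF ru rv f g])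
  next
    fix u f assume hu: "u \<in> hat ch F" and f: "f \<in> ell2 (Fob F u)"
    define c where "c = cj ch u"
    have u: "u \<in> Irr ch" using hu by (simp add: hat_def)
    have c: "c \<in> Irr ch" using valid_choicesD(3)[OF u] by (simp add: c_def)
    note ru = valid_choicesD(1)[OF u] and rc = valid_choicesD(1)[OF c]
    note rcu = rtens_unitary[OF rc ru] and r1 = unitary_rep_runit[OF t \<Delta>]
    have R: "cR ch u \<in> arrows runit (c \<otimes>\<^sub>r u)" using valid_choicesD(4)[OF u] by (simp add: c_def)
    \<comment> \<open>The images of 1 under F(R) and G(R); naturality at R together with U = 1 on
      the trivial representation carries the first to the second.\<close>
    define xF where "xF = Fmor F runit (c \<otimes>\<^sub>r u) (cR ch u) (ket [])"
    define xG where "xG = Fmor G runit (c \<otimes>\<^sub>r u) (cR ch u) (ket [])"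
    have xF: "xF \<in> ell2 (Fob F (c \<otimes>\<^sub>r u))" and xG: "xG \<in> ell2 (Fob G (c \<otimes>\<^sub>r u))"
      unfolding xF_def xG_def
      using bop_in_ell2[OF quasitensor_functorD(2)[OF F r1 rcu R]] bop_in_ell2[OF quasitensor_functorD(2)[OF G r1 rcu R]] .
    have UxF: "U (c \<otimes>\<^sub>r u) xF = xG" using nat[OF r1 rcu R, of "ket []"] by (simp add: xF_def xG_def U1)
    note SF = quasitensor_functorD(3)[OF F rc ru] and SG = quasitensor_functorD(3)[OF G rc ru]
    have repF: "represents_vector (Fob F u) (Fob F c) (JF u) (adj (Fob F c \<otimes>\<^sub>h Fob F u) (Fob F (c \<otimes>\<^sub>r u)) (Fs F c u) xF)"
      using JF hu by (simp add: functor_conjugation_def c_def xF_def)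
    have repG: "represents_vector (Fob G u) (Fob G c) (JG u) (adj (Fob G c \<otimes>\<^sub>h Fob G u) (Fob G (c \<otimes>\<^sub>r u)) (Fs G c u) xG)"
      using JG hu hat by (simp add: functor_conjugation_def c_def xG_def)
    have JFf: "JF u f \<in> ell2 (Fob F c)" for f using abop_in_ell2[OF F.J_abop[OF hu]] by (simp add: c_def)
    have JGf: "JG u f \<in> ell2 (Fob G c)" for f using abop_in_ell2[OF G.J_abop] hu hat by (simp add: c_def)
    have Uf: "U u f \<in> ell2 (Fob G u)" by (rule bop_in_ell2[OF Ub[OF ru]])
    have "U c (JF u f) = JG u (U u f)"
    \<comment> \<open>Inside the inner product S* is moved over to S on the elementary tensor. So U
      meets S only on elementary tensors, and the action of U \<otimes> U on a general vector never
      has to be computed.\<close>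
    proof (rule unitary_ip_eqI[OF Uu[OF rc] bop_in_ell2[OF Ub[OF rc]] JGf])
      fix h assume h: "h \<in> ell2 (Fob F c)"
      have Uh: "U c h \<in> ell2 (Fob G c)" by (rule bop_in_ell2[OF Ub[OF rc]])
      let ?SF = "Fs F c u (vtens (Fob F c) h f)" and ?SG = "Fs G c u (vtens (Fob G c) (U c h) (U u f))"
      have "ip (U c h) (U c (JF u f)) = ip h (JF u f)" by (rule unitary_op_ip[OF Uu[OF rc] h JFf])
      also have "\<dots> = ip (vtens (Fob F c) h f) (adj (Fob F c \<otimes>\<^sub>h Fob F u) (Fob F (c \<otimes>\<^sub>r u)) (Fs F c u) xF)"
        by (rule represents_vector_ip[OF repF bop_in_ell2[OF adj_bop[OF SF]] quasitensor_functorD(1)[OF F ru ru]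
              quasitensor_functorD(1)[OF F rc rc] h f, symmetric])
      also have "\<dots> = ip ?SF xF" by (rule ip_adj[OF SF vtens_ell2[OF h f] xF, symmetric])
      also have "\<dots> = ip (U (c \<otimes>\<^sub>r u) ?SF) (U (c \<otimes>\<^sub>r u) xF)"
        by (rule unitary_op_ip[OF Uu[OF rcu] bop_in_ell2[OF SF] xF, symmetric])
      also have "\<dots> = ip ?SG xG" by (simp only: Us[OF rc ru h f] UxF)
      also have "\<dots> = ip (vtens (Fob G c) (U c h) (U u f)) (adj (Fob G c \<otimes>\<^sub>h Fob G u) (Fob G (c \<otimes>\<^sub>r u)) (Fs G c u) xG)"
        by (rule ip_adj[OF SG vtens_ell2[OF Uh Uf] xG])
      also have "\<dots> = ip (U c h) (JG u (U u f))"
        by (rule represents_vector_ip[OF repG bop_in_ell2[OF adj_bop[OF SG]] quasitensor_functorD(1)[OF G ru ru]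
              quasitensor_functorD(1)[OF G rc rc] Uh Uf])
      finally show "ip (U c h) (U c (JF u f)) = ip (U c h) (JG u (U u f))" .
    qed
    then show "U (cj ch u) (JF u f) = JG u (U u f)" by (simp add: c_def)
  qed
qed

end

section \<open>Existence, equivariance and uniqueness of the isomorphism\<close>

theorem proposition9p4:
  fixes t :: "'a::cstar_algebra \<Rightarrow> 'a \<Rightarrow> 'aa::cstar_algebra"
    and tL :: "'aa \<Rightarrow> 'a \<Rightarrow> 'aaa::cstar_algebra"
    and tR :: "'a \<Rightarrow> 'aa \<Rightarrow> 'aaa"
    and \<Delta> :: "'a \<Rightarrow> 'aa"
    and F :: "('a, 'i) qfunctor" and G :: "('a, 'j) qfunctor"
    and U :: "'a rep \<Rightarrow> ('i, 'j) opr"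
    and ch :: "'a choices"
    and JF :: "'a rep \<Rightarrow> ('i, 'i) opr" and JG :: "'a rep \<Rightarrow> ('j, 'j) opr"
    and \<iota>F :: "('a rep \<Rightarrow> 'i kernel) \<Rightarrow> 'bf::cstar_algebra"
    and \<iota>G :: "('a rep \<Rightarrow> 'j kernel) \<Rightarrow> 'bg::cstar_algebra"
    and tF :: "'bf \<Rightarrow> 'a \<Rightarrow> 'bfa::cstar_algebra" and tG :: "'bg \<Rightarrow> 'a \<Rightarrow> 'bga::cstar_algebra"
    and \<eta>F :: "'bf \<Rightarrow> 'bfa" and \<eta>G :: "'bg \<Rightarrow> 'bga"
  assumes "compact_quantum_group t tL tR \<Delta>"
    and "quasitensor_functor t \<Delta> F" and "quasitensor_functor t \<Delta> G"
    and "unitary_quasitensor_transformation t \<Delta> F G U"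
    and "valid_choices t \<Delta> ch"
    and "functor_conjugation ch F JF" and "functor_conjugation ch G JG"
    and "maximal_completion (coef_alg ch F JF) \<iota>F" and "maximal_completion (coef_alg ch G JG) \<iota>G"
    and "cstar_tensor tF" and "cstar_tensor tG"
    and "canonical_action ch F \<iota>F tF \<eta>F" and "canonical_action ch G \<iota>G tG \<eta>G"
  shows "\<exists>!\<alpha>::'bf \<Rightarrow> 'bg. star_iso \<alpha> \<and>
           (\<forall>b. tensor_map tF tG \<alpha> id (\<eta>F b) = \<eta>G (\<alpha> b)) \<and>
           (\<forall>u\<in>hat ch F. \<forall>T\<in>ell2 (Fob F u). \<forall>\<phi>\<in>ell2 (sp u).
              \<alpha> (\<iota>F (elt u T \<phi>)) = \<iota>G (elt u (U u T) \<phi>))"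
proof -
  have t: "cstar_tensor t" and \<Delta>: "star_hom \<Delta>"
    using assms(1) by (auto simp: compact_quantum_group_def)
  note cm = coef_map_transformation[OF t \<Delta> assms(5,2,3,4,6,7)]
  interpret coef_map ch F JF G JG U by (rule cm(1))
  note hat = cm(2)
  have homF: "star_alg_hom F.alg \<iota>F" and denseF: "closure (\<iota>F ` coefs ch F) = UNIV"
    using assms(8) by (auto simp: maximal_completion_def F.carr)
  define S where "S = {\<iota>F (elt u T \<phi>) | u T \<phi>. u \<in> hat ch F \<and> T \<in> ell2 (Fob F u) \<and> \<phi> \<in> ell2 (sp u)}"
  have "\<iota>F ` coefs ch F \<subseteq> cspan S"
    unfolding S_def using F.span_elt[OF homF] by (rule image_subsetI)
  then have denseS: "closure (cspan S) = UNIV" using denseF closure_mono by blast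
  obtain \<alpha> where \<alpha>: "star_iso \<alpha>" and \<alpha>_val: "\<And>c. c \<in> coefs ch F \<Longrightarrow> \<alpha> (\<iota>F c) = \<iota>G (transport c)"
    using completion_iso[OF assms(8,9)] by blast
  have \<alpha>_elt: "\<alpha> (\<iota>F (elt u T \<phi>)) = \<iota>G (elt u (U u T) \<phi>)"
    if "u \<in> hat ch F" "T \<in> ell2 (Fob F u)" "\<phi> \<in> ell2 (sp u)" for u T \<phi>
  proof -
    have u: "u \<in> Irr ch" using that(1) by (simp add: hat_def)
    show ?thesis using \<alpha>_val[OF elt_coefs[OF u that(2,3)]] transport_elt[OF u that(2)] by simp
  qed
  have star_iso_clin: "clin \<beta>" "continuous_on UNIV \<beta>" if "star_iso \<beta>" for \<beta> :: "'bf \<Rightarrow> 'bg"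
    using that star_hom_clin star_hom_continuous by (auto simp: star_iso_def)
  let ?h = "tensor_map tF tG \<alpha> id"
  note h = tensor_map_star_iso[OF assms(10,11) \<alpha>]
  have \<eta>F: "clin \<eta>F" "continuous_on UNIV \<eta>F" and \<eta>G: "clin \<eta>G" "continuous_on UNIV \<eta>G"
    using assms(12,13) by (auto simp: canonical_action_def)
  have "?h \<circ> \<eta>F = \<eta>G \<circ> \<alpha>"
  proof (rule clin_continuous_eq[OF clin_comp[OF h(1) \<eta>F(1)] _ clin_comp[OF \<eta>G(1) star_iso_clin(1)[OF \<alpha>]] _ _ denseS])
    show "continuous_on UNIV (?h \<circ> \<eta>F)"
      by (rule continuous_on_compose[OF \<eta>F(2) continuous_on_subset[OF h(2) subset_UNIV]])
    show "continuous_on UNIV (\<eta>G \<circ> \<alpha>)"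
      by (rule continuous_on_compose[OF star_iso_clin(2)[OF \<alpha>] continuous_on_subset[OF \<eta>G(2) subset_UNIV]])
    fix x assume "x \<in> S"
    then obtain u T \<phi> where x: "x = \<iota>F (elt u T \<phi>)" and u: "u \<in> hat ch F" and T: "T \<in> ell2 (Fob F u)" and \<phi>: "\<phi> \<in> ell2 (sp u)"
      by (auto simp: S_def)
    let ?b = "\<lambda>i. \<Sum>j\<in>ix (sp u). \<phi> j *\<^sub>C cf u i j"
    have UT: "U u T \<in> ell2 (Fob G u)" using bop_in_ell2[OF U_bop] u by (simp add: hat_def)
    have "\<eta>F x = (\<Sum>i\<in>ix (sp u). tF (\<iota>F (elt u T (ket i))) (?b i))"
      using assms(12) u T \<phi> by (simp add: canonical_action_def x)
    \<comment> \<open>\<alpha> \<otimes> id leaves the coefficients of u untouched and changes only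
      the left factors, which are again elementary.\<close>
    then have "?h (\<eta>F x) = (\<Sum>i\<in>ix (sp u). tG (\<alpha> (\<iota>F (elt u T (ket i)))) (?b i))"
      by (simp add: clin_sum[OF h(1)] h(3))
    also have "\<dots> = (\<Sum>i\<in>ix (sp u). tG (\<iota>G (elt u (U u T) (ket i))) (?b i))"
      by (intro sum.cong refl) (simp add: \<alpha>_elt[OF u T] ket_ell2)
    also have "\<dots> = \<eta>G (\<iota>G (elt u (U u T) \<phi>))"
      using assms(13) u UT \<phi> hat by (simp add: canonical_action_def)
    also have "\<dots> = \<eta>G (\<alpha> x)" by (simp add: x \<alpha>_elt[OF u T \<phi>])
    finally show "(?h \<circ> \<eta>F) x = (\<eta>G \<circ> \<alpha>) x" by simp
  qed
  then have inter: "\<forall>b. ?h (\<eta>F b) = \<eta>G (\<alpha> b)" by (simp add: fun_eq_iff)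
  show ?thesis
  proof (rule ex1I[of _ \<alpha>])
    show "star_iso \<alpha> \<and> (\<forall>b. ?h (\<eta>F b) = \<eta>G (\<alpha> b)) \<and>
        (\<forall>u\<in>hat ch F. \<forall>T\<in>ell2 (Fob F u). \<forall>\<phi>\<in>ell2 (sp u). \<alpha> (\<iota>F (elt u T \<phi>)) = \<iota>G (elt u (U u T) \<phi>))"
      using \<alpha> inter \<alpha>_elt by blast
  next
    fix \<beta> :: "'bf \<Rightarrow> 'bg"
    assume \<beta>: "star_iso \<beta> \<and> (\<forall>b. tensor_map tF tG \<beta> id (\<eta>F b) = \<eta>G (\<beta> b)) \<and>
        (\<forall>u\<in>hat ch F. \<forall>T\<in>ell2 (Fob F u). \<forall>\<phi>\<in>ell2 (sp u). \<beta> (\<iota>F (elt u T \<phi>)) = \<iota>G (elt u (U u T) \<phi>))"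
    show "\<beta> = \<alpha>"
    proof (rule clin_continuous_eq[OF _ _ star_iso_clin[OF \<alpha>] _ denseS])
      show "clin \<beta>" "continuous_on UNIV \<beta>" using \<beta> star_iso_clin by blast+
      show "\<beta> x = \<alpha> x" if "x \<in> S" for x
        using that \<beta> \<alpha>_elt by (auto simp: S_def)
    qed
  qed
qed

end
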